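(* Suppose that Assumptions A and B (stated in the context) hold and assume $\beta=\beta_c:=2\pi^2/\log b$. For each integer $b\ge2$ there exist $\eta>0$ and $C>0$ such that for all $n\ge k\ge0$, $$0<\frac{a_k(q)}{a_k(0)}\le\frac{Ce^{-\eta q^2}}{(1+\sqrt k)^{|q|}},\quad q\in\mathbb Z.$$ Moreover, each $v_k$ is a $C^\infty$ function with $$\sup_{z,z'\in\mathbb R}\bigl|v_{k+1}(z)-b\,v_k(z')\bigr|\le\frac C{\sqrt{1+k}}$$ for all $n>k\ge0$, and $$\sup_{z\in\mathbb R}\max\bigl\{|v_k'(z)|,|v_k''(z)|\bigr\}\le\frac C{\sqrt{1+k}}$$ for all $n\ge k\ge0$. Furthermore, for $n\ge k\ge1$, $$\frac{a_k(1)}{a_k(0)}=\frac1{\sqrt k}\Bigl[\frac{b^3-1}{(b-1)^2(b+1)^3}\Bigr]^{1/2}+O(k^{-1})+O\Bigl(k^{-1/2}\sum_{j\ge\min\{\sqrt k,\,n-k\}}\mathfrak d_j\Bigr),$$ where $\{\mathfrak d_j\}_{j\ge0}$ is the sequence from Assumption A. Consequently, $$v_k'(z)=\frac{4\pi}{\sqrt k}\Bigl[\frac{b^3-1}{(b-1)^2(b+1)^3}\Bigr]^{1/2}\sin(2\pi z)+O(k^{-1})+O\Bigl(k^{-1/2}\sum_{j\ge\min\{\sqrt k,\,n-k\}}\mathfrak d_j\Bigr),$$ with the error terms uniform in $z\in\mathbb R$. The implicit constants do not depend on $n$ or $k$.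
   Context: Let $b\ge2$ be an integer and $\beta>0$. Assumption A. $\{\mathfrak d_j\}_{j\ge0}$ is a positive sequence with $\sum_{j\ge0}\mathfrak d_j<\infty$ and, for each $n\ge1$, $\{\sigma_k^2\}_{k=0}^n$ is a strictly positive sequence (which may depend on $n$) with $|\sigma_k^2-1|\le\mathfrak d_{\min\{k,n-k\}}$ for $k=0,\dots,n$. Moreover $\inf_{n\ge k\ge0}\sigma_k^2>0$. Assumption B. $\nu$ is a $1$-periodic (positive) Radon measure on $\mathbb R$ whose Fourier coefficients $a(q):=\int_{[0,1)}e^{-2\pi iqz}\nu(dz)$, $q\in\mathbb Z$, are real-valued and strictly positive, with $a(-q)=a(q)$ for all $q$ and $\sup_{q\ge0}a(q+1)/a(q)<\infty$. Write $\mu_{s}$ for the normal law $\mathcal N(0,s)$. For each $n\ge1$ define functions $v_0,\dots,v_n\colon\mathbb R\to\mathbb R$ by $$e^{-v_0(z)}:=\int_{\mathbb R}e^{-\frac12\beta\sigma_0^{-2}(z-\zeta)^2}\nu(d\zeta),\qquad e^{-v_{k+1}(z)}:=\int_{\mathbb R}e^{-b\,v_k(z+\zeta)}\mu_{\sigma_{k+1}^2/\beta}(d\zeta),\quad k=0,\dots,n-1.$$ These are $1$-periodic. Set $a_k(q):=\int_0^1e^{-v_k(z)-2\pi iqz}\,dz$ for $q\in\mathbb Z$, $k=0,\dots,n$. The dependence of $\sigma_k^2,v_k,a_k$ on $n$ is suppressed; the constants $\eta,C$ do not depend on $n$ or $k$. Sums over $j\ge\min\{\sqrt k,n-k\}$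 run over integers $j$. *)

theory Defs
  imports "HOL-Probability.Probability"
begin

text \<open>The array entry \<open>s n k\<close> is the variance \<open>\<sigma>\<^sub>k\<^sup>2\<close> of the system of size \<open>n\<close>;
  only the entries with \<open>1 \<le> n\<close> and \<open>k \<le> n\<close> matter. ``Positive'' for \<open>d\<close> is read as
  nonnegative, so that constant unit variances with \<open>d = 0\<close> are included.\<close>

definition almost_unit_variances :: "(nat \<Rightarrow> real) \<Rightarrow> (nat \<Rightarrow> nat \<Rightarrow> real) \<Rightarrow> bool" where
  "almost_unit_variances d s \<longleftrightarrow>
     (\<forall>j. 0 \<le> d j) \<and> summable d \<and>
     (\<forall>n\<ge>1. \<forall>k\<le>n. 0 < s n k \<and> \<bar>s n k - 1\<bar> \<le> d (min k (n - k))) \<and>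
     0 < Inf {s n k | n k. 1 \<le> n \<and> k \<le> n}"

definition periodic_radon_measure :: "real measure \<Rightarrow> bool" where
  "periodic_radon_measure \<nu> \<longleftrightarrow>
     sets \<nu> = sets borel \<and>
     (\<forall>K. compact K \<longrightarrow> emeasure \<nu> K < \<infinity>) \<and>
     (\<forall>A\<in>sets borel. emeasure \<nu> ((\<lambda>x. x + 1) ` A) = emeasure \<nu> A)"

definition fourier_coeff :: "real measure \<Rightarrow> int \<Rightarrow> complex" where
  "fourier_coeff \<nu> q =
     (LINT z:{0..<1}|\<nu>. exp (- (2 * of_real pi * \<i> * of_int q * of_real z)))"

definition positive_fourier_measure :: "real measure \<Rightarrow> bool" where
  "positive_fourier_measure \<nu> \<longleftrightarrow>
     periodic_radon_measure \<nu> \<and>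
     (\<forall>q. fourier_coeff \<nu> q \<in> \<real> \<and> 0 < Re (fourier_coeff \<nu> q)) \<and>
     (\<forall>q. fourier_coeff \<nu> (- q) = fourier_coeff \<nu> q) \<and>
     bdd_above {Re (fourier_coeff \<nu> (q + 1)) / Re (fourier_coeff \<nu> q) | q. 0 \<le> q}"

text \<open>The centred normal law with variance \<open>t\<close>; \<^const>\<open>normal_density\<close> takes the standard deviation.\<close>

definition centred_normal :: "real \<Rightarrow> real measure" where
  "centred_normal t = density lborel (\<lambda>x. ennreal (normal_density 0 (sqrt t) x))"

definition beta_c :: "nat \<Rightarrow> real" where
  "beta_c b = 2 * pi\<^sup>2 / ln (real b)"

text \<open>The renormalized potentials \<open>v\<^sub>k\<close> for one fixed system size, whose variances
  \<open>\<sigma>\<^sub>0\<^sup>2, \<sigma>\<^sub>1\<^sup>2, \<dots>\<close> are the values of \<open>sg\<close>. The recursion prescribes \<open>exp (- v\<^sub>k z)\<close>,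
  hence the logarithms.\<close>

primrec pot :: "nat \<Rightarrow> real \<Rightarrow> real measure \<Rightarrow> (nat \<Rightarrow> real) \<Rightarrow> nat \<Rightarrow> real \<Rightarrow> real" where
  "pot b \<beta> \<nu> sg 0 =
     (\<lambda>z. - ln (LINT \<zeta>|\<nu>. exp (- (1 / 2) * \<beta> * inverse (sg 0) * (z - \<zeta>)\<^sup>2)))"
| "pot b \<beta> \<nu> sg (Suc k) =
     (\<lambda>z. - ln (LINT \<zeta>|centred_normal (sg (Suc k) / \<beta>). exp (- real b * pot b \<beta> \<nu> sg k (z + \<zeta>))))"

definition pot_coeff ::
  "nat \<Rightarrow> real \<Rightarrow> real measure \<Rightarrow> (nat \<Rightarrow> real) \<Rightarrow> nat \<Rightarrow> int \<Rightarrow> complex" where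
  "pot_coeff b \<beta> \<nu> sg k q =
     (LINT z:{0..1}|lborel.
        exp (of_real (- pot b \<beta> \<nu> sg k z) - 2 * of_real pi * \<i> * of_int q * of_real z))"

definition smooth :: "(real \<Rightarrow> real) \<Rightarrow> bool" where
  "smooth f \<longleftrightarrow> (\<forall>m x. (deriv ^^ m) f field_differentiable at x)"

definition limit_const :: "nat \<Rightarrow> real" where
  "limit_const b = sqrt ((real b ^ 3 - 1) / ((real b - 1)\<^sup>2 * (real b + 1) ^ 3))"

text \<open>The sum of the two error scales: a quantity is \<open>O(f) + O(g)\<close> with \<open>f, g \<ge> 0\<close>
  iff it is bounded by a constant multiple of \<open>f + g\<close>.\<close>

definition error_scale :: "(nat \<Rightarrow> real) \<Rightarrow> nat \<Rightarrow> nat \<Rightarrow> real" where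
  "error_scale d n k =
     1 / real k +
     1 / sqrt (real k) * (\<Sum>\<^sub>\<infinity>j\<in>{j::nat. min (sqrt (real k)) (real (n - k)) \<le> real j}. d j)"

end

theory Submission
  imports Defs
begin

text \<open>
  Everything is read off from the Fourier coefficients \<open>a\<^sub>k q\<close> of \<open>exp (- v\<^sub>k)\<close>. Raising
  \<open>exp (- v\<^sub>k)\<close> to the power \<open>b\<close> turns them into their \<open>b\<close>-fold convolution, and at
  \<open>\<beta> = 2 \<pi>\<^sup>2 / ln b\<close> the average over a normal law of variance \<open>\<sigma>\<^sup>2 / \<beta>\<close> multiplies the \<open>q\<close>-th one
  by \<open>b powr (- \<sigma>\<^sup>2 q\<^sup>2)\<close>. The normalized coefficients \<open>r\<^sub>k q = a\<^sub>k q / a\<^sub>k 0\<close> hence obey a closed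
  recursion between positive even sequences. At first order \<open>r\<^sub>k 1\<close> is multiplied by
  \<open>b powr (1 - \<sigma>\<^sup>2)\<close>, which is close to \<open>1\<close>, while the higher coefficients contract: the decay of
  \<open>r\<^sub>k 1\<close> is an effect of third order, and third order damping gives \<open>1 / sqrt k\<close>.

  The recursion starts far from zero, so a bound without expansions comes first. If
  \<open>r (q + 1) \<le> c * r q\<close> for all \<open>q \<ge> 0\<close>, then lowering one positive entry of a tuple
  with sum \<open>q + 1\<close> shows that the \<open>b\<close>-fold convolution has the ratio bound \<open>b * c\<close>; the
  ratio between \<open>0\<close> and \<open>1\<close> is smaller than that by a factor \<open>1 - \<kappa> * (r 1)\<^sup>2\<close>
  (\<open>conv_pow_1_le\<close>). The Gaussian factor turns \<open>b * c\<close> into roughly \<open>c\<close> for the first ratio and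
  into much less for the others. A Lyapunov function for the ratios therefore satisfies
  \<open>W\<^sub>k\<^sub>+\<^sub>1 \<le> W\<^sub>k * (1 - \<kappa> * W\<^sub>k\<^sup>2)\<close> up to factors whose product is bounded, and \<open>r\<^sub>k 1\<close> is
  \<open>O (1 / sqrt k)\<close> (\<open>slope_decay\<close>). Conversely every ratio is at most a constant times \<open>r\<^sub>k 1\<close>
  (\<open>uniform_ratio\<close>), so \<open>r\<^sub>k q\<close> is of order \<open>(r\<^sub>k 1) ^ \<bar>q\<bar>\<close> with an additional Gaussian factor.

  With this hierarchy of sizes the convolution power can be expanded (\<open>conv_pow_expansion\<close>). The
  quotient \<open>r\<^sub>k 2 / (r\<^sub>k 1)\<^sup>2\<close> is driven to a fixed point, and then \<open>1 / (r\<^sub>k 1)\<^sup>2\<close> grows by a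
  constant \<open>drift\<close> in each step, up to errors with sum \<open>O (sqrt k)\<close> and up to the factors
  \<open>b powr (2 * (\<sigma>\<^sup>2 - 1))\<close> (\<open>flow_step\<close>). Solving this linear recursion gives
  \<open>r\<^sub>k 1 = 1 / sqrt (drift * k)\<close> within the stated errors (\<open>slope_asymptotics\<close>), and
  \<open>drift\<close> is the reciprocal square of the limiting constant.

  To return to the potentials, \<open>exp (- v\<^sub>0)\<close> is identified with its cosine series by Poisson
  summation for the Gaussian, and the later ones follow by induction (\<open>pot_series\<close>). The Gaussian
  density on a window of length one bounds \<open>exp (- v\<^sub>k) / a\<^sub>k 0\<close> from below uniformly, so taking
  logarithms and differentiating the series term by term yields all bounds on \<open>v\<^sub>k\<close>
  (\<open>potential_estimates\<close>).
\<close>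

section \<open>Convolution powers of even sequences\<close>

lemma convolution_has_sum:
  fixes x y :: "int \<Rightarrow> 'a :: {real_normed_field, banach}"
  assumes x: "(\<lambda>q. norm (x q)) summable_on UNIV" and y: "(\<lambda>q. norm (y q)) summable_on UNIV"
  shows "((\<lambda>q. \<Sum>\<^sub>\<infinity>p. x p * y (q - p)) has_sum (infsum x UNIV * infsum y UNIV)) UNIV"
proof -
  have "(\<lambda>z. norm (case z of (p, q) \<Rightarrow> x p * y q)) summable_on UNIV \<times> UNIV"
  proof (rule summable_on_SigmaI)
    show "((\<lambda>q. norm (case (p, q) of (p, q) \<Rightarrow> x p * y q)) has_sum (norm (x p) * (\<Sum>\<^sub>\<infinity>q. norm (y q)))) UNIV" for p
      using y by (auto simp: norm_mult intro!: has_sum_cmult_right)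
  qed (auto intro!: summable_on_cmult_left x)
  then have s: "(\<lambda>(p, q). x p * y q) summable_on UNIV \<times> UNIV"
    by (rule abs_summable_summable)
  have "((\<lambda>(p, q). x p * y q) has_sum (infsum x UNIV * infsum y UNIV)) (UNIV \<times> UNIV)"
  proof (rule has_sum_SigmaI[OF _ _ s])
    show "((\<lambda>q. case (p, q) of (p, q) \<Rightarrow> x p * y q) has_sum (x p * infsum y UNIV)) UNIV" for p
      using abs_summable_summable[OF y] by (auto intro!: has_sum_cmult_right)
    show "((\<lambda>p. x p * infsum y UNIV) has_sum infsum x UNIV * infsum y UNIV) UNIV"
      using abs_summable_summable[OF x] by (auto intro!: has_sum_cmult_left)
  qed
  then have h: "((\<lambda>(q, p). x p * y (q - p)) has_sum (infsum x UNIV * infsum y UNIV)) (UNIV \<times> UNIV)"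
    by (subst (asm) has_sum_reindex_bij_witness[where i = "\<lambda>(q, p). (p, q - p)"
          and j = "\<lambda>(p, q). (p + q, p)" and T = "UNIV \<times> UNIV" and h = "\<lambda>(q, p). x p * y (q - p)"]) auto
  show ?thesis
  proof (rule has_sum_SigmaD[OF h])
    fix q :: int
    have "(\<lambda>p. x p * y (q - p)) summable_on UNIV"
      using summable_on_subset_banach[OF s, of "range (\<lambda>p. (p, q - p))"]
        summable_on_reindex[of "\<lambda>p. (p, q - p)" UNIV "\<lambda>(p, q). x p * y q"]
      by (auto simp: inj_on_def o_def)
    then show "((\<lambda>p. case (q, p) of (q, p) \<Rightarrow> x p * y (q - p)) has_sum (\<Sum>\<^sub>\<infinity>p. x p * y (q - p))) UNIV"
      by simp
  qed
qed

definition conv :: "(int \<Rightarrow> real) \<Rightarrow> (int \<Rightarrow> real) \<Rightarrow> int \<Rightarrow> real" where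
  "conv x y q = (\<Sum>\<^sub>\<infinity>p. x p * y (q - p))"

primrec conv_pow :: "(int \<Rightarrow> real) \<Rightarrow> nat \<Rightarrow> int \<Rightarrow> real" where
  "conv_pow x 0 = (\<lambda>q. if q = 0 then 1 else 0)"
| "conv_pow x (Suc m) = conv x (conv_pow x m)"

definition even_weight :: "(int \<Rightarrow> real) \<Rightarrow> bool" where
  "even_weight x \<longleftrightarrow> (\<forall>q. 0 \<le> x q) \<and> (\<forall>q. x (- q) = x q) \<and> x summable_on UNIV"

lemma even_weightD:
  assumes "even_weight x"
  shows "0 \<le> x q" "x (- q) = x q" "x summable_on UNIV" "(\<lambda>q. norm (x q)) summable_on UNIV"
  using assms by (auto simp: even_weight_def summable_on_iff_abs_summable_on_real[symmetric])

lemma even_weight_le_infsum: "even_weight x \<Longrightarrow> x q \<le> infsum x UNIV"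
  using finite_sum_le_infsum[of x UNIV "{q}"] by (auto simp: even_weight_def)

lemma conv_term_summable:
  assumes "even_weight x" "even_weight y"
  shows "(\<lambda>p. x p * y (q - p)) summable_on A"
proof (rule summable_on_subset)
  show "(\<lambda>p. x p * y (q - p)) summable_on UNIV"
  proof (rule summable_on_comparison_test)
    show "(\<lambda>p. x p * infsum y UNIV) summable_on UNIV"
      using assms by (intro summable_on_cmult_left) (auto simp: even_weight_def)
  qed (use assms in \<open>auto intro!: mult_left_mono mult_nonneg_nonneg even_weight_le_infsum simp: even_weightD\<close>)
qed auto

lemma even_weight_conv:
  assumes x: "even_weight x" and y: "even_weight y"
  shows "even_weight (conv x y)" "infsum (conv x y) UNIV = infsum x UNIV * infsum y UNIV"
proof -
  note h = convolution_has_sum[OF even_weightD(4)[OF x] even_weightD(4)[OF y]]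
  have "conv x y (- q) = conv x y q" for q
    unfolding conv_def
  proof (rule infsum_reindex_bij_witness[where i = uminus and j = uminus])
    show "x (- p) * y (q - - p) = x p * y (- q - p)" for p
      using even_weightD(2)[OF x, of p] even_weightD(2)[OF y, of "q + p"] by (simp add: minus_diff_commute)
  qed auto
  then show "even_weight (conv x y)" "infsum (conv x y) UNIV = infsum x UNIV * infsum y UNIV"
    using h x y by (auto simp: even_weight_def conv_def[abs_def] has_sum_iff intro!: infsum_nonneg)
qed

lemma even_weight_conv_pow:
  assumes "even_weight x"
  shows "even_weight (conv_pow x m)" "infsum (conv_pow x m) UNIV = infsum x UNIV ^ m"
proof -
  have "even_weight (conv_pow x m) \<and> infsum (conv_pow x m) UNIV = infsum x UNIV ^ m"
  proof (induction m)
    case 0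
    have "((\<lambda>q::int. if q = 0 then 1 else 0 :: real) has_sum 1) UNIV"
      by (rule has_sum_finite_neutralI[where B = "{0}"]) auto
    then show ?case by (auto simp: even_weight_def has_sum_iff)
  qed (use even_weight_conv[OF assms] in auto)
  then show "even_weight (conv_pow x m)" "infsum (conv_pow x m) UNIV = infsum x UNIV ^ m" by auto
qed

lemma conv_pow_le: "even_weight x \<Longrightarrow> conv_pow x m q \<le> infsum x UNIV ^ m"
  using even_weight_le_infsum even_weight_conv_pow by metis

lemma conv_scale:
  "conv (\<lambda>q. c * x q) (\<lambda>q. d * y q) = (\<lambda>q. c * d * conv x y q)"
proof
  fix q
  have "c * x p * (d * y (q - p)) = c * d * (x p * y (q - p))" for p by simp
  then show "conv (\<lambda>q. c * x q) (\<lambda>q. d * y q) q = c * d * conv x y q"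
    by (simp only: conv_def infsum_cmult_right')
qed

lemma conv_pow_scale: "conv_pow (\<lambda>q. c * x q) m = (\<lambda>q. c ^ m * conv_pow x m q)"
proof (induction m)
  case (Suc m)
  then show ?case using conv_scale[of c x "c ^ m" "conv_pow x m"] by simp
qed auto

lemma conv_ge_term:
  assumes "even_weight x" "even_weight y"
  shows "x p * y (q - p) \<le> conv x y q"
  using finite_sum_le_infsum[OF conv_term_summable[OF assms, of q UNIV], of "{p}"] assms
  by (auto simp: conv_def even_weightD)

section \<open>Ratios of neighbouring coefficients\<close>

definition ratio_le :: "(int \<Rightarrow> real) \<Rightarrow> real \<Rightarrow> bool" where
  "ratio_le x c \<longleftrightarrow> (\<forall>q\<ge>0. x (q + 1) \<le> c * x q)"

text \<open>A pair of integers with sum \<open>q + 1 \<ge> 1\<close> has first entry \<open>p \<ge> 1\<close> or a second entry that is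
  at least \<open>1\<close>. Lowering that entry by one costs the factor \<open>c\<close> or \<open>d\<close>.\<close>

lemma conv_shift_le:
  assumes x: "even_weight x" "ratio_le x c" and y: "even_weight y" "ratio_le y d" and q: "0 \<le> q"
  shows "conv x y (q + 1) \<le> c * (\<Sum>\<^sub>\<infinity>p\<in>{0..}. x p * y (q - p)) + d * (\<Sum>\<^sub>\<infinity>p\<in>{..0}. x p * y (q - p))"
proof -
  note s = conv_term_summable[OF x(1) y(1)]
  have "conv x y (q + 1) = (\<Sum>\<^sub>\<infinity>p\<in>{1..} \<union> {..0}. x p * y (q + 1 - p))"
    unfolding conv_def by (rule infsum_cong_neutral) auto
  also have "\<dots> = (\<Sum>\<^sub>\<infinity>p\<in>{1..}. x p * y (q + 1 - p)) + (\<Sum>\<^sub>\<infinity>p\<in>{..0}. x p * y (q + 1 - p))"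
    by (rule infsum_Un_disjoint) (auto simp: s)
  also have "(\<Sum>\<^sub>\<infinity>p\<in>{1..}. x p * y (q + 1 - p)) = (\<Sum>\<^sub>\<infinity>p\<in>{0..}. x (p + 1) * y (q - p))"
    by (rule infsum_reindex_bij_witness[where i = "\<lambda>p. p + 1" and j = "\<lambda>p. p - 1"])
      (auto simp: algebra_simps)
  also have "\<dots> \<le> (\<Sum>\<^sub>\<infinity>p\<in>{0..}. c * (x p * y (q - p)))"
  proof (rule infsum_mono)
    have "(\<lambda>p. x p * y (q + 1 - p)) summable_on {1..} \<longleftrightarrow>
          (\<lambda>p. x (p + 1) * y (q - p)) summable_on {0..}"
      by (rule summable_on_reindex_bij_witness[where i = "\<lambda>p. p + 1" and j = "\<lambda>p. p - 1"])
        (auto simp: algebra_simps)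
    then show "(\<lambda>p. x (p + 1) * y (q - p)) summable_on {0..}" using s by blast
    show "(\<lambda>p. c * (x p * y (q - p))) summable_on {0..}" by (intro summable_on_cmult_right s)
    show "x (p + 1) * y (q - p) \<le> c * (x p * y (q - p))" if "p \<in> {0..}" for p
      using mult_right_mono[of "x (p + 1)" "c * x p" "y (q - p)"] x y that
      by (auto simp: ratio_le_def even_weightD mult_ac)
  qed
  also have "(\<Sum>\<^sub>\<infinity>p\<in>{..0}. x p * y (q + 1 - p)) \<le> (\<Sum>\<^sub>\<infinity>p\<in>{..0}. d * (x p * y (q - p)))"
  proof (rule infsum_mono)
    show "x p * y (q + 1 - p) \<le> d * (x p * y (q - p))" if "p \<in> {..0}" for p
    proof -
      have "y (q - p + 1) \<le> d * y (q - p)" using y(2) q that by (auto simp: ratio_le_def)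
      from mult_left_mono[OF this even_weightD(1)[OF x(1), of p]]
      show ?thesis by (simp add: algebra_simps)
    qed
  qed (intro summable_on_cmult_right s)+
  finally show ?thesis by (simp add: infsum_cmult_right')
qed

lemma half_sums_le_conv:
  assumes x: "even_weight x" and y: "even_weight y"
  shows "(\<Sum>\<^sub>\<infinity>p\<in>{0..}. x p * y (q - p)) \<le> conv x y q" "(\<Sum>\<^sub>\<infinity>p\<in>{..0}. x p * y (q - p)) \<le> conv x y q"
  unfolding conv_def by (rule infsum_mono2; use conv_term_summable[OF x y] x y in \<open>auto simp: even_weightD\<close>)+

text \<open>At \<open>q = 0\<close> the summand is even in \<open>p\<close>, so the two half sums of \<open>conv_shift_le\<close> overlap
  only in the term \<open>p = 0\<close>. This is where the strict gain in \<open>conv_pow_1_le\<close> comes from.\<close>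

lemma half_sums_eq:
  assumes x: "even_weight x" and y: "even_weight y"
  shows "(\<Sum>\<^sub>\<infinity>p\<in>{0..}. x p * y (0 - p)) = (conv x y 0 + x 0 * y 0) / 2"
    "(\<Sum>\<^sub>\<infinity>p\<in>{..0}. x p * y (0 - p)) = (conv x y 0 + x 0 * y 0) / 2"
proof -
  note s = conv_term_summable[OF x y]
  let ?P = "\<Sum>\<^sub>\<infinity>p\<in>{0..}. x p * y (0 - p)" and ?N = "\<Sum>\<^sub>\<infinity>p\<in>{..0}. x p * y (0 - p)"
  have eq: "?P = ?N"
    by (rule infsum_reindex_bij_witness[where i = uminus and j = uminus])
      (auto simp: even_weightD(2)[OF x] even_weightD(2)[OF y])
  have "conv x y 0 = (\<Sum>\<^sub>\<infinity>p\<in>{0..} \<union> {..0}. x p * y (0 - p))"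
    unfolding conv_def by (rule infsum_cong_neutral) auto
  also have "\<dots> = ?P + ?N - (\<Sum>\<^sub>\<infinity>p\<in>{0..} \<inter> {..0}. x p * y (0 - p))"
    by (rule infsum_Un_Int; rule s)
  also have "{0..} \<inter> {..0} = {0::int}" by auto
  finally show "?P = (conv x y 0 + x 0 * y 0) / 2" "?N = (conv x y 0 + x 0 * y 0) / 2"
    using eq by auto
qed

lemma ratio_le_conv:
  assumes x: "even_weight x" "ratio_le x c" and y: "even_weight y" "ratio_le y d"
    and "0 \<le> c" "0 \<le> d"
  shows "ratio_le (conv x y) (c + d)"
  unfolding ratio_le_def
proof (intro allI impI)
  fix q :: int assume "0 \<le> q"
  have "conv x y (q + 1) \<le> c * (\<Sum>\<^sub>\<infinity>p\<in>{0..}. x p * y (q - p)) + d * (\<Sum>\<^sub>\<infinity>p\<in>{..0}. x p * y (q - p))"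
    by (rule conv_shift_le) fact+
  also have "\<dots> \<le> c * conv x y q + d * conv x y q"
    by (intro add_mono mult_left_mono half_sums_le_conv x y assms)
  finally show "conv x y (q + 1) \<le> (c + d) * conv x y q" by (simp add: algebra_simps)
qed

lemma ratio_le_conv_pow:
  assumes "even_weight x" "ratio_le x c" "0 \<le> c"
  shows "ratio_le (conv_pow x m) (m * c)"
proof (induction m)
  case (Suc m)
  then show ?case
    using ratio_le_conv[OF assms(1,2) even_weight_conv_pow(1)[OF assms(1)], of m "real m * c"] assms(3)
    by (simp add: ring_distribs)
qed (auto simp: ratio_le_def)

lemma conv_pow_0_ge: "even_weight x \<Longrightarrow> x 0 = 1 \<Longrightarrow> 1 \<le> conv_pow x m 0"
proof (induction m)
  case (Suc m)
  then show ?case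
    using conv_ge_term[of x "conv_pow x m" 0 0] even_weight_conv_pow[of x m] by auto
qed auto

lemma conv_pow_1_ge: 
  assumes "even_weight x" "x 0 = 1" shows "m * x 1 \<le> conv_pow x m 1"
proof (induction m)
  case (Suc m)
  note e = even_weight_conv_pow(1)[OF assms(1), of m]
  have "(\<Sum>p\<in>{0, 1}. x p * conv_pow x m (1 - p)) \<le> conv x (conv_pow x m) 1"
    unfolding conv_def using conv_term_summable[OF assms(1) e] e assms(1)
    by (intro finite_sum_le_infsum) (auto simp: even_weightD)
  moreover have "x 1 * 1 \<le> x 1 * conv_pow x m 0"
    by (intro mult_left_mono conv_pow_0_ge assms) (simp add: even_weightD assms)
  ultimately show ?case using Suc assms by (simp add: algebra_simps)
qed (auto)

text \<open>By \<open>half_sums_eq\<close> the bound \<open>b * c\<close> on the ratio improves by the factor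
  \<open>(1 + x 0 * y 0 / conv x y 0) / 2\<close>, where \<open>y\<close> is the power \<open>b - 1\<close>. The terms \<open>p = 1\<close> and
  \<open>p = - 1\<close> of \<open>conv x y 0\<close> keep this factor away from \<open>1\<close> by a multiple of \<open>(x 1)\<^sup>2\<close>.\<close>

lemma conv_pow_1_le:
  assumes x: "even_weight x" "x 0 = 1" "ratio_le x c" and c: "0 \<le> c" and b: "2 \<le> b"
    and S: "infsum x UNIV ^ b \<le> Q"
  shows "conv_pow x b 1 \<le> b * c * conv_pow x b 0 * (1 - (x 1)\<^sup>2 / Q)"
proof -
  obtain m where m: "b = Suc (Suc m)" using b by (metis Suc_le_D numeral_2_eq_2 Suc_le_mono)
  define y where "y = conv_pow x (Suc m)"
  have y: "even_weight y" "ratio_le y (Suc m * c)" 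
    unfolding y_def using even_weight_conv_pow(1)[OF x(1)] ratio_le_conv_pow[OF x(1,3) c] by blast+
  have by': "conv_pow x b = conv x y" by (simp add: m y_def)
  have "x 1 \<le> y 1"
    using conv_ge_term[OF x(1) even_weight_conv_pow(1)[OF x(1), of m], of 1 1] 
      conv_pow_0_ge[OF x(1,2), of m] mult_left_mono[of 1 "conv_pow x m 0" "x 1"] 
    by (simp add: y_def even_weightD[OF x(1)])
  then have x1: "(x 1)\<^sup>2 \<le> x 1 * y 1"
    by (simp add: power2_eq_square mult_left_mono even_weightD[OF x(1)])
  have "(\<Sum>p\<in>{-1,0,1}. x p * y (0 - p)) \<le> conv x y 0"
    unfolding conv_def using conv_term_summable[OF x(1) y(1), of 0] 
    by (intro finite_sum_le_infsum) (auto simp: even_weightD x y)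
  then have 0: "y 0 + 2 * (x 1)\<^sup>2 \<le> conv x y 0"
    using even_weightD(2)[OF x(1), of 1] even_weightD(2)[OF y(1), of 1] x1 x(2) by simp
  have Q: "conv x y 0 \<le> Q" using conv_pow_le[OF x(1), of b 0] S by (simp add: by')
  have pos: "1 \<le> conv x y 0" using conv_pow_0_ge[OF x(1,2), of b] by (simp add: by')
  have "conv x y (0 + 1) \<le> c * ((conv x y 0 + x 0 * y 0) / 2) + Suc m * c * ((conv x y 0 + x 0 * y 0) / 2)"
    using conv_shift_le[OF x(1,3) y, of 0] unfolding half_sums_eq[OF x(1) y(1)] by simp
  also have "\<dots> = b * c * ((conv x y 0 + y 0) / 2)" by (simp add: m x(2) field_simps)
  also have "\<dots> \<le> b * c * (conv x y 0 * (1 - (x 1)\<^sup>2 / Q))"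
  proof (intro mult_left_mono)
    define w where "w = (x 1)\<^sup>2 * (conv x y 0 / Q)"
    have "w \<le> (x 1)\<^sup>2 * 1"
      unfolding w_def using Q pos by (intro mult_left_mono) auto
    then have "(conv x y 0 + y 0) / 2 \<le> conv x y 0 - w" using 0 by simp
    also have "conv x y 0 - w = conv x y 0 * (1 - (x 1)\<^sup>2 / Q)" by (simp add: w_def algebra_simps)
    finally show "(conv x y 0 + y 0) / 2 \<le> conv x y 0 * (1 - (x 1)\<^sup>2 / Q)" .
  qed (use c in auto)
  finally show ?thesis by (simp add: by' mult_ac)
qed

section \<open>Third order expansion of convolution powers\<close>

text \<open>The weighted \<open>l\<^sup>1\<close> norm in which \<open>x q\<close> may be of size \<open>e ^ \<bar>q\<bar>\<close>; for \<open>e \<le> 1\<close> the weight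
  is submultiplicative, which is why convolutions preserve this decay.\<close>

definition decay_norm_le :: "(int \<Rightarrow> real) \<Rightarrow> real \<Rightarrow> real \<Rightarrow> bool" where
  "decay_norm_le x e X \<longleftrightarrow>
     (\<lambda>p. x p / e ^ nat \<bar>p\<bar>) summable_on UNIV \<and> (\<Sum>\<^sub>\<infinity>p. x p / e ^ nat \<bar>p\<bar>) \<le> X"

lemma decay_norm_leD:
  assumes "decay_norm_le x e X" "even_weight x" "0 < e"
  shows "x p \<le> X * e ^ nat \<bar>p\<bar>" "0 \<le> X"
proof -
  have "(\<Sum>p\<in>{p}. x p / e ^ nat \<bar>p\<bar>) \<le> (\<Sum>\<^sub>\<infinity>p. x p / e ^ nat \<bar>p\<bar>)"
    using assms by (intro finite_sum_le_infsum) (auto simp: decay_norm_le_def even_weightD)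
  then have "x p / e ^ nat \<bar>p\<bar> \<le> X" using assms(1) by (simp add: decay_norm_le_def)
  then show "x p \<le> X * e ^ nat \<bar>p\<bar>" using assms(3) by (simp add: field_simps)
  have "0 \<le> (\<Sum>\<^sub>\<infinity>p. x p / e ^ nat \<bar>p\<bar>)"
    using assms by (intro infsum_nonneg) (auto simp: even_weightD)
  then show "0 \<le> X" using assms(1) by (simp add: decay_norm_le_def)
qed

text \<open>The number \<open>\<bar>p\<bar> + \<bar>q - p\<bar>\<close> is the order in \<open>e\<close> of the term \<open>p\<close>. Only the finitely many terms
  of order less than \<open>N\<close> have to be kept.\<close>

lemma conv_near_finite_sum:
  assumes x: "even_weight x" "decay_norm_le x e X" and y: "even_weight y"
    and e: "0 < e" "e \<le> 1" and yY: "\<And>q. y q \<le> Y * e ^ nat \<bar>q\<bar>" and Y: "0 \<le> Y"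
    and J: "finite J" "\<And>p. p \<notin> J \<Longrightarrow> N \<le> nat \<bar>p\<bar> + nat \<bar>q - p\<bar>"
  shows "\<bar>conv x y q - (\<Sum>p\<in>J. x p * y (q - p))\<bar> \<le> X * Y * e ^ N"
proof -
  note s = conv_term_summable[OF x(1) y]
  have "conv x y q = (\<Sum>\<^sub>\<infinity>p\<in>J \<union> - J. x p * y (q - p))" by (simp add: conv_def)
  also have "\<dots> = (\<Sum>p\<in>J. x p * y (q - p)) + (\<Sum>\<^sub>\<infinity>p\<in>-J. x p * y (q - p))"
    using J(1) by (subst infsum_Un_disjoint) (auto simp: s)
  finally have 1: "conv x y q - (\<Sum>p\<in>J. x p * y (q - p)) = (\<Sum>\<^sub>\<infinity>p\<in>-J. x p * y (q - p))" by simp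
  have 2: "0 \<le> (\<Sum>\<^sub>\<infinity>p\<in>-J. x p * y (q - p))"
    by (intro infsum_nonneg mult_nonneg_nonneg even_weightD x y)
  have "(\<Sum>\<^sub>\<infinity>p\<in>-J. x p * y (q - p)) \<le> (\<Sum>\<^sub>\<infinity>p. x p / e ^ nat \<bar>p\<bar> * (Y * e ^ N))"
  proof (rule infsum_mono_neutral)
    show "(\<lambda>p. x p / e ^ nat \<bar>p\<bar> * (Y * e ^ N)) summable_on UNIV"
      using x(2) by (intro summable_on_cmult_left) (simp add: decay_norm_le_def)
    fix p assume "p \<in> - J \<inter> UNIV"
    then have "N \<le> nat \<bar>p\<bar> + nat \<bar>q - p\<bar>" using J(2) by auto
    then have "e ^ (nat \<bar>p\<bar> + nat \<bar>q - p\<bar>) \<le> e ^ N" using e by (intro power_decreasing) auto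
    then have "x p / e ^ nat \<bar>p\<bar> * (Y * e ^ (nat \<bar>p\<bar> + nat \<bar>q - p\<bar>)) \<le> x p / e ^ nat \<bar>p\<bar> * (Y * e ^ N)"
      using e Y x(1) by (intro mult_left_mono) (auto simp: even_weightD)
    moreover have "x p * y (q - p) \<le> x p * (Y * e ^ nat \<bar>q - p\<bar>)"
      using yY[of "q - p"] x(1) by (intro mult_left_mono) (auto simp: even_weightD)
    moreover have "x p * (Y * e ^ nat \<bar>q - p\<bar>) = x p / e ^ nat \<bar>p\<bar> * (Y * e ^ (nat \<bar>p\<bar> + nat \<bar>q - p\<bar>))"
      using e by (simp add: power_add)
    ultimately show "x p * y (q - p) \<le> x p / e ^ nat \<bar>p\<bar> * (Y * e ^ N)" by linarith
  qed (use x e Y in \<open>auto simp: s even_weightD\<close>)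
  also have "\<dots> \<le> X * (Y * e ^ N)"
    unfolding infsum_cmult_left' using x(2) e Y by (intro mult_right_mono) (auto simp: decay_norm_le_def)
  finally show ?thesis using 1 2 by (simp add: mult_ac)
qed

lemma conv_pow_decay:
  assumes x: "even_weight x" "decay_norm_le x e X" and e: "0 < e" "e \<le> 1"
  shows "conv_pow x m q \<le> X ^ m * e ^ nat \<bar>q\<bar>"
proof (induction m arbitrary: q)
  case (Suc m)
  have "\<bar>conv x (conv_pow x m) q - (\<Sum>p\<in>{}. x p * conv_pow x m (q - p))\<bar> \<le> X * X ^ m * e ^ nat \<bar>q\<bar>"
    by (rule conv_near_finite_sum[OF x even_weight_conv_pow(1)[OF x(1)] e Suc])
      (use decay_norm_leD(2)[OF x(2,1) e(1)] in auto)
  then show ?case by simp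
qed (use e in auto)

lemma abs_mult_le_power:
  fixes a :: real
  assumes "\<bar>a\<bar> \<le> A * e ^ i" "\<bar>c\<bar> \<le> C * e ^ j" "n \<le> i + j" "0 < e" "e \<le> 1" "0 \<le> A" "0 \<le> C"
  shows "\<bar>a * c\<bar> \<le> A * C * e ^ n"
proof -
  have "\<bar>a * c\<bar> \<le> (A * e ^ i) * (C * e ^ j)"
    unfolding abs_mult using assms by (intro mult_mono) auto
  also have "\<dots> = A * C * e ^ (i + j)" by (simp add: power_add)
  also have "\<dots> \<le> A * C * e ^ n" using assms by (intro mult_left_mono power_decreasing) auto
  finally show ?thesis .
qed

text \<open>The polynomials count tuples with a given sum: two entries \<open>1, - 1\<close> for sum \<open>0\<close>, one entry
  \<open>1\<close> or entries \<open>1, 1, - 1\<close> or \<open>2, - 1\<close> for sum \<open>1\<close>, one entry \<open>2\<close> or two entries \<open>1\<close> for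
  sum \<open>2\<close>.\<close>

definition third_order_expansion :: "nat \<Rightarrow> real \<Rightarrow> (int \<Rightarrow> real) \<Rightarrow> real \<Rightarrow> bool" where
  "third_order_expansion m K x e \<longleftrightarrow>
    \<bar>conv_pow x m 0 - (1 + real m * (real m - 1) * (x 1)\<^sup>2)\<bar> \<le> K * e ^ 4 \<and>
    \<bar>conv_pow x m 1 - (real m * x 1 + real m * (real m - 1) * (real m - 2) / 2 * (x 1) ^ 3
       + real m * (real m - 1) * (x 1 * x 2))\<bar> \<le> K * e ^ 5 \<and>
    \<bar>conv_pow x m 2 - (real m * x 2 + real m * (real m - 1) / 2 * (x 1)\<^sup>2)\<bar> \<le> K * e ^ 4"

text \<open>Induction on the power. In each step only \<open>\<bar>p\<bar> \<le> 2\<close> contributes below the error order, by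
  \<open>conv_near_finite_sum\<close>, and the polynomials satisfy the resulting recursion up to terms of the error order.\<close>

lemma conv_pow_expansion:
  assumes X: "1 \<le> X"
  shows "\<exists>K\<ge>0. \<forall>x e. even_weight x \<longrightarrow> x 0 = 1 \<longrightarrow> 0 < e \<longrightarrow> e \<le> 1 \<longrightarrow> decay_norm_le x e X \<longrightarrow>
    third_order_expansion m K x e"
proof (induction m)
  case 0
  show ?case by (intro exI[of _ 0]) (auto simp: third_order_expansion_def)
next
  case (Suc m)
  then obtain K where K: "0 \<le> K" and IH: "\<And>x e. even_weight x \<Longrightarrow> x 0 = 1 \<Longrightarrow> 0 < e \<Longrightarrow> e \<le> 1 \<Longrightarrow>
    decay_norm_le x e X \<Longrightarrow>
    third_order_expansion m K x e"
    by blast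
  define a where "a = real m * (real m - 1) * (real m - 2) / 2"
  define c where "c = real m * (real m - 1)"
  define D where "D = \<bar>a\<bar> * X ^ 3 + \<bar>c\<bar> * (X * X)"
  define D2 where "D2 = \<bar>c\<bar> * (X * X)"
  define Y where "Y = X ^ m"
  have D: "0 \<le> D" "0 \<le> D2" "0 \<le> Y" using X by (auto simp: D_def D2_def Y_def)
  define K' where "K' = (1 + 4 * X) * K + 3 * (X * D) + X * D2 + X * Y"
  have K': "0 \<le> K'" using K D X by (auto simp: K'_def)
  show ?case
    unfolding third_order_expansion_def
  proof (intro exI[of _ K'] conjI allI impI K')
    fix x :: "int \<Rightarrow> real" and e :: real
    assume x: "even_weight x" "x 0 = 1" and e: "0 < e" "e \<le> 1" and dn: "decay_norm_le x e X"
    define A where "A = conv_pow x m"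
    have A: "even_weight A" unfolding A_def by (rule even_weight_conv_pow) fact
    have AY: "A q \<le> Y * e ^ nat \<bar>q\<bar>" for q
      unfolding A_def Y_def by (rule conv_pow_decay[OF x(1) dn e])
    note ev = even_weightD(2)[OF x(1), of 1, simplified] even_weightD(2)[OF A, of 1, simplified]
      even_weightD(2)[OF x(1), of 2, simplified] even_weightD(2)[OF A, of 2, simplified]
    have j0: "4 \<le> nat \<bar>p\<bar> + nat \<bar>0 - p\<bar>" if "p \<notin> {-1,0,1}" for p :: int using that by auto
    have j1: "5 \<le> nat \<bar>p\<bar> + nat \<bar>1 - p\<bar>" if "p \<notin> {-1,0,1,2}" for p :: int using that by auto
    have j2: "4 \<le> nat \<bar>p\<bar> + nat \<bar>2 - p\<bar>" if "p \<notin> {0,1,2}" for p :: int using that by auto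
    note near = conv_near_finite_sum[OF x(1) dn A e AY D(3)]
    define u where "u = x 1"
    define w where "w = x 2"
    have u: "\<bar>u\<bar> \<le> X * e ^ 1" and w: "\<bar>w\<bar> \<le> X * e ^ 2"
      using decay_norm_leD(1)[OF dn x(1) e(1), of 1] decay_norm_leD(1)[OF dn x(1) e(1), of 2]
        even_weightD(1)[OF x(1), of 1] even_weightD(1)[OF x(1), of 2] by (auto simp: u_def w_def)
    have uu: "\<bar>u * u\<bar> \<le> X * X * e ^ 2" by (rule abs_mult_le_power[OF u u]) (use e X in auto)
    have uw: "\<bar>u * w\<bar> \<le> X * X * e ^ 3" by (rule abs_mult_le_power[OF u w]) (use e X in auto)
    have uuu: "\<bar>u * (u * u)\<bar> \<le> X * (X * X) * e ^ 3"
      by (rule abs_mult_le_power[OF u uu]) (use e X in auto)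
    define E0 where "E0 = A 0 - (1 + c * u\<^sup>2)"
    define E1 where "E1 = A 1 - (real m * u + a * u ^ 3 + c * (u * w))"
    define E2 where "E2 = A 2 - (real m * w + c / 2 * u\<^sup>2)"
    define M where "M = a * (u * (u * u)) + c * (u * w)"
    define M2 where "M2 = c * (u * u)"
    have E: "\<bar>E0\<bar> \<le> K * e ^ 4" "\<bar>E1\<bar> \<le> K * e ^ 5" "\<bar>E2\<bar> \<le> K * e ^ 4"
      using IH[OF x e dn] unfolding third_order_expansion_def E0_def E1_def E2_def A_def a_def c_def u_def w_def by auto
    have M: "\<bar>M\<bar> \<le> D * e ^ 3"
    proof -
      have "\<bar>a * (u * (u * u))\<bar> \<le> \<bar>a\<bar> * (X * (X * X) * e ^ 3)" "\<bar>c * (u * w)\<bar> \<le> \<bar>c\<bar> * (X * X * e ^ 3)"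
        unfolding abs_mult[of a] abs_mult[of c] by (intro mult_left_mono uuu uw; simp)+
      then show ?thesis by (simp add: M_def D_def power3_eq_cube algebra_simps)
    qed
    have M2: "\<bar>M2\<bar> \<le> D2 * e ^ 2"
      using mult_left_mono[OF uu, of "\<bar>c\<bar>"] by (simp add: M2_def D2_def abs_mult algebra_simps)
    have i: "e ^ 4 \<le> e ^ 4" "e ^ 5 \<le> e ^ 4" using e by (auto intro: power_decreasing)
    have KK: "K * e ^ 5 \<le> K * e ^ 4" using i K by (intro mult_left_mono) auto
    note am = abs_mult_le_power[OF u] abs_mult_le_power[OF w]
    have sXK: "0 \<le> X * K * e ^ 4" "0 \<le> X * K * e ^ 5" "0 \<le> X * D * e ^ 4" "0 \<le> X * D2 * e ^ 4" "0 \<le> X * D * e ^ 5" "0 \<le> X * D2 * e ^ 5"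
      using X K D e by auto
    define t0 where "t0 = conv x A 0 - (A 0 + 2 * (u * A 1))"
    have t0: "\<bar>t0\<bar> \<le> X * Y * e ^ 4"
      using near[of "{-1,0,1}" 4 0, OF _ j0] x(2) ev by (auto simp: t0_def u_def mult_ac)
    have "conv x A 0 - (1 + real (Suc m) * (real (Suc m) - 1) * u\<^sup>2) = E0 + 2 * (u * E1) + 2 * (u * M) + t0"
      by (simp add: t0_def E0_def E1_def M_def c_def power2_eq_square power3_eq_cube algebra_simps)
    moreover have "\<bar>u * E1\<bar> \<le> X * K * e ^ 4" "\<bar>u * M\<bar> \<le> X * D * e ^ 4"
      by (rule am(1)[OF E(2)] am(1)[OF M]; use X K D e in simp)+
    ultimately have "\<bar>conv x A 0 - (1 + real (Suc m) * (real (Suc m) - 1) * u\<^sup>2)\<bar> \<le> K' * e ^ 4"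
      using t0 E(1) sXK by (simp add: K'_def algebra_simps)
    then show "\<bar>conv_pow x (Suc m) 0 - (1 + real (Suc m) * (real (Suc m) - 1) * (x 1)\<^sup>2)\<bar> \<le> K' * e ^ 4"
      by (simp add: A_def u_def)
    define t1 where "t1 = conv x A 1 - (A 1 + u * (A 0 + A 2) + w * A 1)"
    have t1: "\<bar>t1\<bar> \<le> X * Y * e ^ 5"
      using near[of "{-1,0,1,2}" 5 1, OF _ j1] x(2) ev by (auto simp: t1_def u_def w_def algebra_simps)
    have "conv x A 1 - (real (Suc m) * u + real (Suc m) * (real (Suc m) - 1) * (real (Suc m) - 2) / 2 * u ^ 3
        + real (Suc m) * (real (Suc m) - 1) * (u * w)) = E1 + u * E0 + u * E2 + w * E1 + w * M + t1"
      by (simp add: t1_def E0_def E1_def E2_def M_def a_def c_def power2_eq_square power3_eq_cube field_simps)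
    moreover have "\<bar>u * E0\<bar> \<le> X * K * e ^ 5" "\<bar>u * E2\<bar> \<le> X * K * e ^ 5" "\<bar>w * E1\<bar> \<le> X * K * e ^ 5"
        "\<bar>w * M\<bar> \<le> X * D * e ^ 5"
      by (rule am(1)[OF E(1)] am(1)[OF E(3)] am(2)[OF E(2)] am(2)[OF M]; use X K D e in simp)+
    ultimately have "\<bar>conv x A 1 - (real (Suc m) * u + real (Suc m) * (real (Suc m) - 1) * (real (Suc m) - 2) / 2 * u ^ 3
        + real (Suc m) * (real (Suc m) - 1) * (u * w))\<bar> \<le> K' * e ^ 5"
      using t1 E(2) sXK by (simp add: K'_def algebra_simps)
    then show "\<bar>conv_pow x (Suc m) 1 - (real (Suc m) * x 1 + real (Suc m) * (real (Suc m) - 1) * (real (Suc m) - 2) / 2 * (x 1) ^ 3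
        + real (Suc m) * (real (Suc m) - 1) * (x 1 * x 2))\<bar> \<le> K' * e ^ 5"
      by (simp add: A_def u_def w_def)
    define t2 where "t2 = conv x A 2 - (A 2 + u * A 1 + w * A 0)"
    have t2: "\<bar>t2\<bar> \<le> X * Y * e ^ 4"
      using near[of "{0,1,2}" 4 2, OF _ j2] x(2) ev by (auto simp: t2_def u_def w_def algebra_simps)
    have "conv x A 2 - (real (Suc m) * w + real (Suc m) * (real (Suc m) - 1) / 2 * u\<^sup>2)
        = E2 + u * E1 + u * M + w * E0 + w * M2 + t2"
      by (simp add: t2_def E0_def E1_def E2_def M_def M2_def c_def power2_eq_square power3_eq_cube field_simps)
    moreover have "\<bar>u * E1\<bar> \<le> X * K * e ^ 4" "\<bar>u * M\<bar> \<le> X * D * e ^ 4" "\<bar>w * E0\<bar> \<le> X * K * e ^ 4"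
        "\<bar>w * M2\<bar> \<le> X * D2 * e ^ 4"
      by (rule am(1)[OF E(2)] am(1)[OF M] am(2)[OF E(1)] am(2)[OF M2]; use X K D e in simp)+
    ultimately have "\<bar>conv x A 2 - (real (Suc m) * w + real (Suc m) * (real (Suc m) - 1) / 2 * u\<^sup>2)\<bar> \<le> K' * e ^ 4"
      using t2 E(3) sXK by (simp add: K'_def algebra_simps)
    then show "\<bar>conv_pow x (Suc m) 2 - (real (Suc m) * x 2 + real (Suc m) * (real (Suc m) - 1) / 2 * (x 1)\<^sup>2)\<bar> \<le> K' * e ^ 4"
      by (simp add: A_def u_def w_def)
  qed
qed

section \<open>Sequences with Gaussian decay\<close>

text \<open>The product of the ratio bounds \<open>h * t ^ (2 * i)\<close> over \<open>i < \<bar>q\<bar>\<close>.\<close>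

definition gauss_weight :: "real \<Rightarrow> real \<Rightarrow> int \<Rightarrow> real" where
  "gauss_weight t h q = h ^ nat \<bar>q\<bar> * t ^ (nat \<bar>q\<bar> * (nat \<bar>q\<bar> - 1))"

lemma summable_on_nat_abs:
  fixes f :: "nat \<Rightarrow> real"
  assumes "summable f" "\<And>n. 0 \<le> f n"
  shows "(\<lambda>q::int. f (nat \<bar>q\<bar>)) summable_on UNIV"
proof -
  have f: "f summable_on UNIV" using assms by (rule summable_nonneg_imp_summable_on)
  have "(\<lambda>q::int. f (nat \<bar>q\<bar>)) summable_on range int"
    using f by (subst summable_on_reindex) (auto simp: o_def)
  moreover have "(\<lambda>q::int. f (nat \<bar>q\<bar>)) summable_on range (\<lambda>n. - int n)"
    using f by (subst summable_on_reindex) (auto simp: o_def inj_on_def)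
  ultimately have "(\<lambda>q::int. f (nat \<bar>q\<bar>)) summable_on range int \<union> range (\<lambda>n. - int n)"
    by (rule summable_on_union)
  moreover have "range int \<union> range (\<lambda>n. - int n) = UNIV"
  proof (intro equalityI subsetI UNIV_I)
    fix q :: int
    show "q \<in> range int \<union> range (\<lambda>n. - int n)" by (cases q rule: int_cases2) auto
  qed
  ultimately show ?thesis by simp
qed

text \<open>The ratio test: consecutive quotients are at most \<open>2 ^ j * h * (t\<^sup>2) ^ n\<close>, which tends to zero.\<close>

lemma gauss_weight_summable:
  assumes t: "0 < t" "t < 1" and h: "0 \<le> h"
  shows "(\<lambda>q. \<bar>real_of_int q\<bar> ^ j * gauss_weight t h q) summable_on UNIV"
proof -
  define f where "f m = real m ^ j * (h ^ m * t ^ (m * (m - 1)))" for m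
  have "(\<lambda>n. 2 ^ j * h * (t\<^sup>2) ^ n) \<longlonglongrightarrow> 2 ^ j * h * 0"
    using t by (intro tendsto_intros LIMSEQ_power_zero) (auto simp: power_less_one_iff abs_square_less_1)
  then have "\<forall>\<^sub>F n in sequentially. 2 ^ j * h * (t\<^sup>2) ^ n < 1 / 2"
    by (rule order_tendstoD) auto
  then obtain N where N: "\<And>n. n \<ge> N \<Longrightarrow> 2 ^ j * h * (t\<^sup>2) ^ n < 1 / 2"
    by (auto simp: eventually_sequentially)
  have "summable f"
  proof (rule summable_ratio_test[of "1 / 2" "max N 1"])
    fix n assume n: "n \<ge> max N 1"
    have "real (Suc n) ^ j \<le> (2 * real n) ^ j" using n by (intro power_mono) auto
    then have 1: "real (Suc n) ^ j \<le> 2 ^ j * real n ^ j" by (simp add: power_mult_distrib)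
    have e: "Suc n * (Suc n - 1) = n * (n - 1) + 2 * n" using n by (cases n) auto
    have "f (Suc n) = real (Suc n) ^ j * (h ^ n * t ^ (n * (n - 1)) * (h * (t\<^sup>2) ^ n))"
      unfolding f_def e by (simp add: power_add mult_ac flip: power_mult)
    also have "\<dots> \<le> (2 ^ j * real n ^ j) * (h ^ n * t ^ (n * (n - 1)) * (h * (t\<^sup>2) ^ n))"
      using t h by (intro mult_right_mono[OF 1]) auto
    also have "\<dots> = f n * (2 ^ j * h * (t\<^sup>2) ^ n)" by (simp add: f_def mult_ac)
    also have "\<dots> \<le> f n * (1 / 2)"
      using N[of n] n t h by (intro mult_left_mono) (auto simp: f_def)
    finally show "norm (f (Suc n)) \<le> 1 / 2 * norm (f n)" using t h by (auto simp: f_def)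
  qed auto
  then have "(\<lambda>q::int. f (nat \<bar>q\<bar>)) summable_on UNIV"
    by (rule summable_on_nat_abs) (use t h in \<open>auto simp: f_def\<close>)
  then show ?thesis by (simp add: f_def gauss_weight_def)
qed

lemma le_gauss_weight:
  assumes e: "\<And>q. x (- q) = x q" and x0: "x 0 = 1" and h: "0 \<le> h" "0 \<le> t"
    and r: "\<And>q::int. 0 \<le> q \<Longrightarrow> x (q + 1) \<le> h * t ^ (2 * nat q) * x q"
  shows "x q \<le> gauss_weight t h q"
proof -
  have *: "x (int m) \<le> h ^ m * t ^ (m * (m - 1))" for m
  proof (induction m)
    case (Suc m)
    have e: "Suc m * (Suc m - 1) = 2 * m + m * (m - 1)" by (cases m) auto
    have "x (int (Suc m)) \<le> h * t ^ (2 * m) * x (int m)" using r[of "int m"] by (simp add: add_ac)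
    also have "\<dots> \<le> h * t ^ (2 * m) * (h ^ m * t ^ (m * (m - 1)))"
      using h by (intro mult_left_mono Suc) auto
    also have "\<dots> = h ^ Suc m * t ^ (Suc m * (Suc m - 1))" unfolding e power_add by (simp add: mult_ac)
    finally show ?case .
  qed (use x0 in auto)
  have "x q = x (int (nat \<bar>q\<bar>))" using e[of q] by (cases "q \<ge> 0") auto
  also have "\<dots> \<le> gauss_weight t h q" unfolding gauss_weight_def by (rule *)
  finally show ?thesis .
qed

section \<open>The renormalization flow of the Fourier coefficients\<close>

text \<open>The recursion of the normalized coefficients \<open>r n k\<close> at criticality, for all system sizes \<open>n\<close>
  at once: the constants found below depend on the parameters of the locale only, hence neither on
  \<open>n\<close> nor on \<open>k\<close>.\<close>

locale critical_flow =
  fixes b :: nat and d :: "nat \<Rightarrow> real" and s :: "nat \<Rightarrow> nat \<Rightarrow> real" and smin :: real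
    and r :: "nat \<Rightarrow> nat \<Rightarrow> int \<Rightarrow> real" and c0 l0 :: real
  assumes b2: "2 \<le> b"
    and d_nonneg: "0 \<le> d j" and d_summable: "summable d"
    and smin_pos: "0 < smin"
    and smin_le: "1 \<le> n \<Longrightarrow> k \<le> n \<Longrightarrow> smin \<le> s n k"
    and s_near_1: "1 \<le> n \<Longrightarrow> k \<le> n \<Longrightarrow> \<bar>s n k - 1\<bar> \<le> d (min k (n - k))"
    and r_even: "1 \<le> n \<Longrightarrow> k \<le> n \<Longrightarrow> even_weight (r n k)"
    and r_pos: "1 \<le> n \<Longrightarrow> k \<le> n \<Longrightarrow> 0 < r n k q"
    and r_0: "1 \<le> n \<Longrightarrow> k \<le> n \<Longrightarrow> r n k 0 = 1"
    and r_Suc: "1 \<le> n \<Longrightarrow> k < n \<Longrightarrow> r n (Suc k) q =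
       real b powr (- s n (Suc k) * (real_of_int q)\<^sup>2) * conv_pow (r n k) b q / conv_pow (r n k) b 0"
    and l0_pos: "0 < l0"
    and init_ratio: "1 \<le> n \<Longrightarrow> 0 \<le> q \<Longrightarrow> r n 0 (q + 1) \<le> c0 * (real b powr - smin) ^ (2 * nat q) * r n 0 q"
    and init_lower: "1 \<le> n \<Longrightarrow> l0 \<le> r n 0 1"
begin

definition theta :: real where "theta = real b powr - smin"
definition delta :: "nat \<Rightarrow> nat \<Rightarrow> real" where "delta n k = d (min k (n - k))"

lemma theta: "0 < theta" "theta < 1"
  using b2 smin_pos by (auto simp: theta_def powr_less_one)

lemma delta_nonneg: "0 \<le> delta n k" by (simp add: delta_def d_nonneg)

lemma d_tail_summable: "d summable_on A"
  using summable_nonneg_imp_summable_on[OF d_summable d_nonneg] by (rule summable_on_subset) auto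

text \<open>Each value of \<open>min i (n - i)\<close> is taken at most twice, once as \<open>i\<close> and once as \<open>n - i\<close>.\<close>

lemma sum_delta_le_tail:
  assumes I: "I \<subseteq> {..n}" and t: "\<And>i. i \<in> I \<Longrightarrow> t \<le> real i" "\<And>i. i \<in> I \<Longrightarrow> t \<le> real (n - i)"
  shows "(\<Sum>i\<in>I. delta n i) \<le> 2 * (\<Sum>\<^sub>\<infinity>j\<in>{j. t \<le> real j}. d j)"
proof -
  have fin: "finite I" using I finite_subset by blast
  have "(\<Sum>i\<in>I. delta n i) \<le> (\<Sum>i\<in>I. d i + d (n - i))"
    by (intro sum_mono) (auto simp: delta_def min_def d_nonneg)
  also have "\<dots> = sum d I + sum d ((\<lambda>i. n - i) ` I)"
  proof -
    have "inj_on (\<lambda>i. n - i) I" using I by (intro inj_onI) (metis atMost_iff diff_diff_cancel subsetD)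
    then show ?thesis by (simp add: sum.reindex sum.distrib)
  qed
  also have "sum d I \<le> (\<Sum>\<^sub>\<infinity>j\<in>{j. t \<le> real j}. d j)"
    using t fin by (intro finite_sum_le_infsum d_tail_summable) (auto simp: d_nonneg)
  also have "sum d ((\<lambda>i. n - i) ` I) \<le> (\<Sum>\<^sub>\<infinity>j\<in>{j. t \<le> real j}. d j)"
    using t fin by (intro finite_sum_le_infsum d_tail_summable) (auto simp: d_nonneg)
  finally show ?thesis by simp
qed

definition total_delta :: real where "total_delta = 2 * infsum d UNIV"

lemma total_delta_nonneg: "0 \<le> total_delta" by (simp add: total_delta_def infsum_nonneg d_nonneg)

lemma sum_delta_le_total_delta: "I \<subseteq> {..n} \<Longrightarrow> (\<Sum>i\<in>I. delta n i) \<le> total_delta"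
  using sum_delta_le_tail[of I n 0] by (simp add: total_delta_def)

context
  fixes n k :: nat
  assumes n: "1 \<le> n" and k: "k < n"
begin

lemma even_k: "even_weight (r n k)" using r_even n k by auto
lemma r_k_0: "r n k 0 = 1" using r_0 n k by auto
lemma conv_0_ge_1: "1 \<le> conv_pow (r n k) b 0"
  by (rule conv_pow_0_ge[OF even_k r_k_0])

lemma step_ratio:
  assumes "ratio_le (r n k) c" "0 \<le> c" "0 \<le> q"
  shows "r n (Suc k) (q + 1) \<le> real b powr (1 - s n (Suc k) * (2 * q + 1)) * c * r n (Suc k) q"
proof -
  let ?S = "s n (Suc k)" and ?A = "conv_pow (r n k) b"
  have "?A (q + 1) \<le> b * c * ?A q"
    using ratio_le_conv_pow[OF even_k assms(1,2), of b] assms(3) by (simp add: ratio_le_def)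
  then have "real b powr (- ?S * (real_of_int (q + 1))\<^sup>2) * ?A (q + 1) / ?A 0
     \<le> real b powr (- ?S * (real_of_int (q + 1))\<^sup>2) * (b * c * ?A q) / ?A 0"
    using conv_0_ge_1 by (intro divide_right_mono mult_left_mono) auto
  also have "real b powr (- ?S * (real_of_int (q + 1))\<^sup>2) * (b * c * ?A q) / ?A 0 =
     (real b powr (- ?S * (real_of_int (q + 1))\<^sup>2) * real b powr 1) * c * ?A q / ?A 0"
    using b2 by simp
  also have "real b powr (- ?S * (real_of_int (q + 1))\<^sup>2) * real b powr 1 =
      real b powr (1 - ?S * (2 * q + 1)) * real b powr (- ?S * (real_of_int q)\<^sup>2)"
    unfolding powr_add[symmetric] by (simp add: power2_eq_square algebra_simps)
  finally show ?thesis using r_Suc[OF n k] by (simp add: mult_ac)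
qed

lemma step_gain:
  assumes "ratio_le (r n k) c" "0 \<le> c" "infsum (r n k) UNIV ^ b \<le> Q"
  shows "r n (Suc k) 1 \<le> real b powr (1 - s n (Suc k)) * c * (1 - (r n k 1)\<^sup>2 / Q)"
proof -
  let ?S = "s n (Suc k)" and ?A = "conv_pow (r n k) b"
  have "?A 1 \<le> b * c * ?A 0 * (1 - (r n k 1)\<^sup>2 / Q)"
    by (rule conv_pow_1_le[OF even_k r_k_0 assms(1,2) b2 assms(3)])
  then have "?A 1 / ?A 0 \<le> b * c * (1 - (r n k 1)\<^sup>2 / Q)"
    using conv_0_ge_1 by (simp add: field_simps)
  then have "real b powr - ?S * (?A 1 / ?A 0) \<le> real b powr - ?S * (b * c * (1 - (r n k 1)\<^sup>2 / Q))"
    by (intro mult_left_mono) auto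
  moreover have "real b powr (1 - ?S) = real b powr - ?S * b"
    using b2 by (simp add: powr_diff powr_minus divide_inverse)
  ultimately show ?thesis using r_Suc[OF n k, of 1] by (simp add: mult_ac)
qed

text \<open>The \<open>b\<close> tuples with one entry \<open>1\<close> and all others \<open>0\<close> already contribute \<open>b * r n k 1\<close> to
  the convolution power at \<open>1\<close>.\<close>

lemma step_lower: "real b powr (1 - s n (Suc k)) * r n k 1 \<le> r n (Suc k) 1 * conv_pow (r n k) b 0"
proof -
  let ?S = "s n (Suc k)"
  have "real b powr (1 - ?S) = real b powr - ?S * b"
    using b2 by (simp add: powr_diff powr_minus divide_inverse)
  moreover have "real b powr - ?S * (b * r n k 1) \<le> real b powr - ?S * conv_pow (r n k) b 1"
    by (intro mult_left_mono conv_pow_1_ge even_k r_k_0) auto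
  ultimately show ?thesis using r_Suc[OF n k, of 1] conv_0_ge_1 by (simp add: mult_ac)
qed

lemma s_bounds: "1 - delta n (Suc k) \<le> s n (Suc k)" "s n (Suc k) \<le> 1 + delta n (Suc k)" "smin \<le> s n (Suc k)"
  using s_near_1[OF n, of "Suc k"] smin_le[OF n, of "Suc k"] k unfolding delta_def by auto

end

text \<open>A Lyapunov function for the ratios. The first ratio can only shrink by the gain of \<open>step_gain\<close>,
  whose size depends on the first ratio itself. Demanding half of \<open>W\<close> from the higher ratios makes
  one step sufficient: either the first ratio is at least \<open>W / 2\<close> and the gain is of order \<open>W\<^sup>2\<close>,
  or all ratios are at most \<open>W / 2\<close>.\<close>

definition slope_bound :: "real \<Rightarrow> (int \<Rightarrow> real) \<Rightarrow> bool" where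
  "slope_bound W x \<longleftrightarrow> x 1 \<le> W \<and> (\<forall>q\<ge>1. x (q + 1) \<le> W / 2 * x q)"

lemma slope_bound_ratio:
  assumes "slope_bound W x" "even_weight x" "x 0 = 1" "0 \<le> W"
  shows "ratio_le x W" "x 1 \<le> W / 2 \<Longrightarrow> ratio_le x (W / 2)"
proof -
  have *: "ratio_le x c" if "x 1 \<le> c" "W / 2 \<le> c" for c
    unfolding ratio_le_def
  proof (intro allI impI)
    fix q :: int assume q: "0 \<le> q"
    show "x (q + 1) \<le> c * x q"
    proof (cases "q = 0")
      case False
      then have "x (q + 1) \<le> W / 2 * x q" using assms(1) q by (auto simp: slope_bound_def)
      also have "\<dots> \<le> c * x q" using that assms(2) by (intro mult_right_mono) (auto simp: even_weightD)
      finally show ?thesis .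
    qed (use assms(3) that in auto)
  qed
  show "ratio_le x W" using assms(1,4) by (intro *) (auto simp: slope_bound_def)
  show "x 1 \<le> W / 2 \<Longrightarrow> ratio_le x (W / 2)" using assms(1,4) by (intro *) (auto simp: slope_bound_def)
qed

text \<open>The exponent \<open>3 * delta\<close> covers both estimates: the first ratio is multiplied by
  \<open>b powr (1 - s)\<close>, and the higher ones by at most \<open>b powr (1 - 3 * s)\<close>, which is
  \<open>b powr (- 2)\<close>, hence at most \<open>1 / 4\<close>, up to \<open>b powr (3 * delta)\<close>.\<close>

lemma slope_bound_step:
  assumes n: "1 \<le> n" and k: "k < n" and W: "slope_bound W (r n k)" "0 \<le> W"
    and Q: "infsum (r n k) UNIV ^ b \<le> Q" and y: "0 \<le> y" "y \<le> 1 / 2" "y \<le> W\<^sup>2 / (4 * Q)"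
  shows "slope_bound (real b powr (3 * delta n (Suc k)) * (W * (1 - y))) (r n (Suc k))"
proof -
  let ?S = "s n (Suc k)" and ?D = "delta n (Suc k)"
  have D: "0 \<le> ?D" by (rule delta_nonneg)
  have b1: "1 < real b" using b2 by simp
  note ev = even_k[OF n k] and r0 = r_k_0[OF n k] and S = s_bounds[OF n k]
  note rat = slope_bound_ratio[OF W(1) ev r0 W(2)]
  have Q1: "1 \<le> Q" using conv_0_ge_1[OF n k] conv_pow_le[OF ev, of b 0] Q by linarith
  have r1: "0 \<le> r n k 1" using ev by (simp add: even_weightD)
  have bS: "real b powr (1 - ?S) \<le> real b powr (3 * ?D)" using S D b1 by (intro powr_mono) auto
  have main: "r n (Suc k) 1 \<le> real b powr (1 - ?S) * (W * (1 - y))"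
  proof (cases "W / 2 \<le> r n k 1")
    case True
    have "(W / 2)\<^sup>2 \<le> (r n k 1)\<^sup>2" using True W(2) by (intro power_mono) auto
    then have "(W / 2)\<^sup>2 / Q \<le> (r n k 1)\<^sup>2 / Q" using Q1 by (intro divide_right_mono) auto
    then have "1 - (r n k 1)\<^sup>2 / Q \<le> 1 - y" using y(3) by (simp add: power_divide)
    then have "real b powr (1 - ?S) * W * (1 - (r n k 1)\<^sup>2 / Q) \<le> real b powr (1 - ?S) * W * (1 - y)"
      using W(2) by (intro mult_left_mono) auto
    then show ?thesis using step_gain[OF n k rat(1) W(2) Q] by (simp add: mult.assoc)
  next
    case False
    have "r n (Suc k) 1 \<le> real b powr (1 - ?S) * (W / 2) * (1 - (r n k 1)\<^sup>2 / Q)"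
      using False W(2) by (intro step_gain n k rat(2) Q) auto
    also have "\<dots> \<le> real b powr (1 - ?S) * (W / 2) * 1"
      using W(2) Q1 by (intro mult_left_mono) auto
    also have "\<dots> \<le> real b powr (1 - ?S) * (W * (1 - y))"
      unfolding mult_1_right using W(2) y by (intro mult_left_mono) (auto simp: field_simps mult_left_le)
    finally show ?thesis .
  qed
  have "real b powr (1 - ?S) * (W * (1 - y)) \<le> real b powr (3 * ?D) * (W * (1 - y))"
    using W(2) y by (intro mult_right_mono[OF bS]) auto
  moreover have "r n (Suc k) (q + 1) \<le> real b powr (3 * ?D) * (W * (1 - y)) / 2 * r n (Suc k) q"
    if q: "1 \<le> q" for q
  proof -
    have rq: "0 \<le> r n (Suc k) q" using r_even[OF n, of "Suc k"] k by (simp add: even_weightD)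
    have "?S * 3 \<le> ?S * (2 * real_of_int q + 1)"
      using q S(3) smin_pos by (intro mult_left_mono) auto
    then have "real b powr (1 - ?S * (2 * q + 1)) \<le> real b powr (3 * ?D - 2)"
      using S D b1 by (intro powr_mono) auto
    also have "\<dots> = real b powr (3 * ?D) / (real b)\<^sup>2"
      using b1 by (simp add: powr_diff)
    also have "\<dots> \<le> real b powr (3 * ?D) / 4"
      using b2 power_mono[of 2 "real b" 2] by (intro divide_left_mono) auto
    finally have "real b powr (1 - ?S * (2 * q + 1)) * W * r n (Suc k) q
       \<le> real b powr (3 * ?D) / 4 * W * r n (Suc k) q"
      using W(2) rq by (intro mult_right_mono) auto
    also have "\<dots> \<le> real b powr (3 * ?D) * (W * (1 - y)) / 2 * r n (Suc k) q"
      using mult_left_mono[OF mult_left_mono[of "1 / 2" "1 - y" W], of "real b powr (3 * ?D) / 2"] W(2) y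
      by (intro mult_right_mono[OF _ rq]) simp
    finally show ?thesis using step_ratio[OF n k rat(1) W(2), of q] q by linarith
  qed
  ultimately show ?thesis using main by (auto simp: slope_bound_def)
qed

lemma c0_pos: "0 < c0"
proof -
  have "0 < r 1 0 1" by (rule r_pos) auto
  then show ?thesis using init_ratio[of 1 0] r_0[of 1 0] by simp
qed

lemma theta_pow_le_1: "theta ^ m \<le> 1" using theta by (simp add: power_le_one)

lemma slope_bound_init: "1 \<le> n \<Longrightarrow> slope_bound (2 * c0) (r n 0)"
proof -
  assume n: "1 \<le> n"
  have *: "r n 0 (q + 1) \<le> c0 * r n 0 q" if "0 \<le> q" for q
  proof -
    have "c0 * theta ^ (2 * nat q) * r n 0 q \<le> c0 * 1 * r n 0 q"
      using c0_pos theta theta_pow_le_1 r_pos[OF n, of 0 q]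
      by (intro mult_right_mono mult_left_mono) auto
    then show ?thesis using init_ratio[OF n that] by (simp add: theta_def)
  qed
  then show ?thesis using *[of 0] c0_pos r_0[OF n, of 0] by (auto simp: slope_bound_def)
qed

definition cum_delta :: "nat \<Rightarrow> nat \<Rightarrow> real" where "cum_delta n k = (\<Sum>i\<in>{1..k}. delta n i)"

lemma cum_delta_Suc: "cum_delta n (Suc k) = cum_delta n k + delta n (Suc k)" by (simp add: cum_delta_def)

lemma cum_delta_bounds: "k \<le> n \<Longrightarrow> 0 \<le> cum_delta n k" "k \<le> n \<Longrightarrow> cum_delta n k \<le> total_delta"
  unfolding cum_delta_def by (auto intro!: sum_nonneg delta_nonneg sum_delta_le_total_delta)

lemma slope_bounded:
  assumes n: "1 \<le> n"
  shows "k \<le> n \<Longrightarrow> slope_bound (real b powr (3 * cum_delta n k) * (2 * c0)) (r n k)"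
proof (induction k)
  case 0
  then show ?case using slope_bound_init[OF n] b2 by (simp add: cum_delta_def)
next
  case (Suc k)
  let ?W = "real b powr (3 * cum_delta n k) * (2 * c0)"
  have W: "slope_bound ?W (r n k)" "0 \<le> ?W" using Suc c0_pos by auto
  have Q: "0 \<le> infsum (r n k) UNIV ^ b"
    using r_even[OF n, of k] Suc.prems by (auto intro!: zero_le_power infsum_nonneg simp: even_weightD)
  have "slope_bound (real b powr (3 * delta n (Suc k)) * (?W * (1 - 0))) (r n (Suc k))"
    by (rule slope_bound_step[OF n _ W order_refl]) (use Suc.prems Q in auto)
  then show ?case by (simp add: cum_delta_Suc powr_add distrib_left mult_ac)
qed

text \<open>A bound \<open>W\<close> on all ratios improves in one step to \<open>b * W * theta ^ (2 * q)\<close> by the Gaussian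
  factor.\<close>

lemma uniform_gauss_ratio:
  "\<exists>h\<ge>1. \<forall>n\<ge>1. \<forall>k\<le>n. \<forall>q\<ge>0. r n k (q + 1) \<le> h * theta ^ (2 * nat q) * r n k q"
proof -
  define W where "W = real b powr (3 * total_delta) * (2 * c0)"
  have W0: "0 \<le> W" using c0_pos by (simp add: W_def)
  define h where "h = max 1 (max c0 (real b * W))"
  have h: "1 \<le> h" "c0 \<le> h" "real b * W \<le> h" by (auto simp: h_def)
  have "r n k (q + 1) \<le> h * theta ^ (2 * nat q) * r n k q" if n: "1 \<le> n" and k: "k \<le> n" and q: "0 \<le> q" for n k q
  proof (cases k)
    case 0
    have "c0 * theta ^ (2 * nat q) * r n 0 q \<le> h * theta ^ (2 * nat q) * r n 0 q"
      using theta r_pos[OF n, of 0 q] by (intro mult_right_mono h) auto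
    then show ?thesis using init_ratio[OF n q] 0 by (simp add: theta_def)
  next
    case (Suc j)
    then have j: "j < n" using k by simp
    have rq: "0 < r n k q" using r_pos[OF n k] .
    have "real b powr (3 * cum_delta n j) * (2 * c0) \<le> W"
      unfolding W_def using cum_delta_bounds(2)[of j n] j b2 c0_pos by (intro mult_right_mono powr_mono) auto
    moreover note slope_bound_ratio(1)[OF slope_bounded[OF n, of j] even_k[OF n j] r_k_0[OF n j]]
    ultimately have "ratio_le (r n j) W"
      using j c0_pos even_k[OF n j] unfolding ratio_le_def 
      by (smt (verit) mult_right_mono even_weightD(1) powr_ge_zero mult_nonneg_nonneg less_imp_le)
    then have "r n k (q + 1) \<le> real b powr (1 - s n k * (2 * q + 1)) * W * r n k q"
      unfolding Suc by (intro step_ratio n j W0 q)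
    also have "real b powr (1 - s n k * (2 * q + 1)) \<le> real b powr (1 - smin * (2 * q))"
    proof (intro powr_mono)
      have "smin * (2 * real_of_int q) \<le> s n k * (2 * real_of_int q + 1)"
        using smin_le[OF n k] smin_pos q by (intro mult_mono) auto
      then show "1 - s n k * real_of_int (2 * q + 1) \<le> 1 - smin * real_of_int (2 * q)" by simp
    qed (use b2 in auto)
    also have "\<dots> = real b * theta ^ (2 * nat q)"
    proof -
      have "theta ^ (2 * nat q) = real b powr (- smin * (2 * q))"
        unfolding theta_def using b2 q by (subst powr_power) (auto simp: mult_ac)
      then show ?thesis using b2 by (simp add: powr_diff powr_minus divide_inverse)
    qed
    finally have "r n k (q + 1) \<le> (real b * W) * theta ^ (2 * nat q) * r n k q"
      using W0 rq by (simp add: mult_right_mono mult_ac)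
    also have "\<dots> \<le> h * theta ^ (2 * nat q) * r n k q"
      using theta rq by (intro mult_right_mono h) auto
    finally show ?thesis .
  qed
  then show ?thesis using h by blast
qed

lemma r_le_gauss_weight:
  assumes "1 \<le> n" "k \<le> n" "\<And>q. 0 \<le> q \<Longrightarrow> r n k (q + 1) \<le> h * theta ^ (2 * nat q) * r n k q" "0 \<le> h"
  shows "r n k q \<le> gauss_weight theta h q"
  using assms theta r_even[OF assms(1,2)] by (intro le_gauss_weight) (auto simp: even_weightD r_0)

lemma gauss_weight_sum_ge_1: "0 \<le> h \<Longrightarrow> 1 \<le> infsum (gauss_weight theta h) UNIV"
  using finite_sum_le_infsum[of "gauss_weight theta h" UNIV "{0}"]
    gauss_weight_summable[OF theta, of h 0] theta by (auto simp: gauss_weight_def[of _ _ 0])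
      (auto simp: gauss_weight_def)

lemma uniform_mass:
  "\<exists>S\<ge>1. \<forall>n\<ge>1. \<forall>k\<le>n. infsum (r n k) UNIV \<le> 1 + S * r n k 1 \<and> infsum (r n k) UNIV \<le> S"
proof -
  obtain h where h: "1 \<le> h" and r: "\<And>n k q. 1 \<le> n \<Longrightarrow> k \<le> n \<Longrightarrow> 0 \<le> q \<Longrightarrow>
      r n k (q + 1) \<le> h * theta ^ (2 * nat q) * r n k q"
    using uniform_gauss_ratio by blast
  define g where "g = gauss_weight theta h"
  have g: "g summable_on UNIV" using gauss_weight_summable[OF theta, of h 0] h by (simp add: g_def)
  have g0: "0 \<le> g q" for q using h theta by (simp add: g_def gauss_weight_def)
  have "infsum (r n k) UNIV \<le> 1 + infsum g UNIV * r n k 1 \<and> infsum (r n k) UNIV \<le> infsum g UNIV"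
    if n: "1 \<le> n" and k: "k \<le> n" for n k
  proof
    note ev = r_even[OF n k]
    have le: "r n k q \<le> g q" for q unfolding g_def using r[OF n k] h by (intro r_le_gauss_weight n k) auto
    show "infsum (r n k) UNIV \<le> infsum g UNIV"
      by (intro infsum_mono even_weightD(3)[OF ev] g le)
    have r1: "0 < r n k 1" using r_pos[OF n k] .
    define x where "x q = (if q = 0 then 1 else r n k q / r n k 1)" for q
    have xg: "x q \<le> g q" for q
      unfolding g_def
    proof (rule le_gauss_weight)
      fix q :: int assume q: "0 \<le> q"
      have "r n k (q + 1) / r n k 1 \<le> (h * theta ^ (2 * nat q) * r n k q) / r n k 1"
        using r1 r[OF n k q] by (intro divide_right_mono) auto
      then show "x (q + 1) \<le> h * theta ^ (2 * nat q) * x q"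
        using q h r1 by (cases "q = 0") (auto simp: x_def)
    qed (use h theta even_weightD(2)[OF ev] in \<open>auto simp: x_def\<close>)
    have "((\<lambda>q::int. if q = 0 then 1 else 0 :: real) has_sum 1) UNIV"
      by (rule has_sum_finite_neutralI[where B = "{0}"]) auto
    then have sum: "((\<lambda>q. (if q = 0 then 1 else 0) + g q * r n k 1) has_sum (1 + infsum g UNIV * r n k 1)) UNIV"
      by (intro has_sum_add has_sum_cmult_left has_sum_infsum g)
    show "infsum (r n k) UNIV \<le> 1 + infsum g UNIV * r n k 1"
    proof (rule has_sum_mono[OF _ sum])
      show "(r n k has_sum infsum (r n k) UNIV) UNIV" by (intro has_sum_infsum even_weightD(3)[OF ev])
      show "r n k q \<le> (if q = 0 then 1 else 0) + g q * r n k 1" for q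
        using xg[of q] r1 g0[of q] r_0[OF n k] by (auto simp: x_def field_simps split: if_splits)
    qed
  qed
  then show ?thesis
    using gauss_weight_sum_ge_1[of h] h by (intro exI[of _ "infsum g UNIV"]) (auto simp: g_def)
qed

text \<open>The map \<open>U \<mapsto> U * (1 - \<kappa> * U\<^sup>2)\<close> increases \<open>1 / U\<^sup>2\<close> by at least \<open>2 * \<kappa>\<close>, because
  \<open>(1 - y)\<^sup>2 * (1 + 2 * y) \<le> 1\<close> for \<open>0 \<le> y \<le> 1\<close>. So \<open>U\<close> may be chosen explicitly, and the
  accumulated factors \<open>b powr (3 * delta)\<close> only cost a constant.\<close>

lemma slope_decay:
  "\<exists>C\<ge>1. \<forall>n\<ge>1. \<forall>k\<le>n. r n k 1 \<le> C / sqrt (1 + real k)"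
proof -
  obtain S where S: "1 \<le> S" "\<And>n k. 1 \<le> n \<Longrightarrow> k \<le> n \<Longrightarrow> infsum (r n k) UNIV \<le> S"
    using uniform_mass by blast
  define Q where "Q = S ^ b"
  have Q: "1 \<le> Q" using S(1) by (simp add: Q_def)
  \<comment> \<open>This choice makes \<open>U 0\<close> the initial slope bound \<open>2 * c0\<close>.\<close>
  define X0 where "X0 = 1 / (2 * c0)\<^sup>2"
  \<comment> \<open>The second bound makes \<open>kap * (U k)\<^sup>2 \<le> 1 / 2\<close>, as \<open>slope_bound_step\<close> requires.\<close>
  define kap where "kap = min (1 / (4 * Q)) (X0 / 2)"
  have X0: "0 < X0" and kap: "0 < kap" "kap \<le> 1 / (4 * Q)" "kap \<le> X0 / 2"
    using c0_pos Q by (auto simp: X0_def kap_def)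
  define U where "U k = 1 / sqrt (X0 + 2 * kap * real k)" for k
  have U0: "0 < U k" for k using X0 kap by (auto simp: U_def intro!: add_pos_nonneg)
  have U2: "(U k)\<^sup>2 = 1 / (X0 + 2 * kap * real k)" for k
    using X0 kap by (simp add: U_def power_divide)
  have U_step: "U k * (1 - kap * (U k)\<^sup>2) \<le> U (Suc k)" and kU: "kap * (U k)\<^sup>2 \<le> 1 / 2" for k
  proof -
    define y where "y = kap * (U k)\<^sup>2"
    have "kap * (U k)\<^sup>2 \<le> X0 / 2 * (1 / X0)"
      unfolding U2 using kap X0 by (intro mult_mono divide_left_mono mult_pos_pos add_pos_nonneg) auto
    then show y1: "kap * (U k)\<^sup>2 \<le> 1 / 2" using X0 by simp
    have y0: "0 \<le> y" using kap by (simp add: y_def)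
    have "(1 - y)\<^sup>2 * (1 + 2 * y) = 1 - y\<^sup>2 * (3 - 2 * y)"
      by (simp add: power2_eq_square algebra_simps)
    also have "\<dots> \<le> 1" using y1 by (simp add: y_def)
    finally have *: "(1 - y)\<^sup>2 \<le> 1 / (1 + 2 * y)" using y0 by (simp add: field_simps)
    have "(U k * (1 - y))\<^sup>2 \<le> (U k)\<^sup>2 * (1 / (1 + 2 * y))"
      unfolding power_mult_distrib by (intro mult_left_mono *) auto
    also have "\<dots> = (U (Suc k))\<^sup>2"
    proof -
      have "X0 + 2 * kap * real k > 0" using X0 kap by (intro add_pos_nonneg) auto
      then show ?thesis unfolding y_def U2 by (simp add: field_simps)
    qed
    finally show "U k * (1 - kap * (U k)\<^sup>2) \<le> U (Suc k)"
      unfolding y_def using U0[of "Suc k"] by (rule power2_le_imp_le[OF _ less_imp_le])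
  qed
  have slope: "k \<le> n \<Longrightarrow> slope_bound (real b powr (3 * cum_delta n k) * U k) (r n k)" if n: "1 \<le> n" for n k
  proof (induction k)
    case 0
    have "U 0 = 2 * c0" using c0_pos by (simp add: U_def X0_def real_sqrt_divide real_sqrt_mult)
    then show ?case using slope_bound_init[OF n] b2 by (simp add: cum_delta_def)
  next
    case (Suc k)
    let ?P = "real b powr (3 * cum_delta n k)"
    have P: "1 \<le> ?P" using cum_delta_bounds(1)[of k n] Suc.prems b2 by (intro ge_one_powr_ge_zero) auto
    have "(U k)\<^sup>2 * 1 \<le> (U k)\<^sup>2 * ?P\<^sup>2" using P by (intro mult_left_mono) auto
    then have "kap * (U k)\<^sup>2 \<le> 1 / (4 * Q) * (?P * U k)\<^sup>2"
      using kap Q by (intro mult_mono) (auto simp: power_mult_distrib mult_ac)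
    moreover have "infsum (r n k) UNIV ^ b \<le> Q"
      unfolding Q_def using S(2)[OF n, of k] Suc.prems r_even[OF n, of k]
      by (intro power_mono infsum_nonneg) (auto simp: even_weightD)
    ultimately have *: "slope_bound (real b powr (3 * delta n (Suc k)) * (?P * U k * (1 - kap * (U k)\<^sup>2))) (r n (Suc k))"
      using Suc kap U0[of k] kU by (intro slope_bound_step n) auto
    have le: "real b powr (3 * delta n (Suc k)) * (?P * U k * (1 - kap * (U k)\<^sup>2)) \<le> real b powr (3 * cum_delta n (Suc k)) * U (Suc k)"
      unfolding cum_delta_Suc distrib_left powr_add
      using mult_left_mono[OF U_step[of k], of "real b powr (3 * delta n (Suc k)) * ?P"] by (simp add: mult_ac)
    show ?case
      unfolding slope_bound_def
    proof (intro conjI allI impI)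
      show "r n (Suc k) 1 \<le> real b powr (3 * cum_delta n (Suc k)) * U (Suc k)"
        using * le by (auto simp: slope_bound_def)
      fix q :: int assume q: "1 \<le> q"
      have "r n (Suc k) (q + 1) \<le> real b powr (3 * delta n (Suc k)) * (?P * U k * (1 - kap * (U k)\<^sup>2)) / 2 * r n (Suc k) q"
        using * q by (auto simp: slope_bound_def)
      also have "\<dots> \<le> real b powr (3 * cum_delta n (Suc k)) * U (Suc k) / 2 * r n (Suc k) q"
        using r_pos[OF n, of "Suc k" q] Suc.prems by (intro mult_right_mono divide_right_mono le) auto
      finally show "r n (Suc k) (q + 1) \<le> real b powr (3 * cum_delta n (Suc k)) * U (Suc k) / 2 * r n (Suc k) q" .
    qed
  qed
  define m where "m = min X0 (2 * kap)"
  have m: "0 < m" "m \<le> X0" "m \<le> 2 * kap" using X0 kap by (auto simp: m_def)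
  define C where "C = max 1 (real b powr (3 * total_delta) / sqrt m)"
  have "r n k 1 \<le> C / sqrt (1 + real k)" if n: "1 \<le> n" and k: "k \<le> n" for n k
  proof -
    have "m * (1 + real k) \<le> X0 + 2 * kap * real k"
      using m mult_right_mono[OF m(3), of "real k"] by (simp add: algebra_simps)
    then have "sqrt m * sqrt (1 + real k) \<le> sqrt (X0 + 2 * kap * real k)"
      by (simp flip: real_sqrt_mult)
    then have "U k \<le> 1 / (sqrt m * sqrt (1 + real k))"
      unfolding U_def using m X0 kap by (intro divide_left_mono mult_pos_pos) (auto intro!: add_pos_nonneg)
    moreover have "real b powr (3 * cum_delta n k) \<le> real b powr (3 * total_delta)"
      using cum_delta_bounds(2)[OF k] b2 by (intro powr_mono) auto
    ultimately have "real b powr (3 * cum_delta n k) * U k \<le> real b powr (3 * total_delta) * (1 / (sqrt m * sqrt (1 + real k)))"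
      using U0[of k] by (intro mult_mono) auto
    also have "\<dots> = (real b powr (3 * total_delta) / sqrt m) / sqrt (1 + real k)" by simp
    also have "\<dots> \<le> C / sqrt (1 + real k)" by (intro divide_right_mono) (auto simp: C_def)
    finally show ?thesis using slope[OF n k] by (simp add: slope_bound_def)
  qed
  then show ?thesis by (intro exI[of _ C]) (auto simp: C_def)
qed

text \<open>Ratios measured in units of the first coefficient, before and after the step: \<open>step_lower\<close>
  replaces the old unit by the new one.\<close>

lemma step_ratio_rel:
  assumes n: "1 \<le> n" and k: "k < n" and M: "ratio_le (r n k) (M * r n k 1)" "0 \<le> M" and q: "0 \<le> q"
  shows "r n (Suc k) (q + 1) \<le>
    theta ^ (2 * nat q) * conv_pow (r n k) b 0 * M * r n (Suc k) 1 * r n (Suc k) q"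
proof -
  let ?S = "s n (Suc k)" and ?A = "conv_pow (r n k) b 0"
  have rq: "0 < r n (Suc k) q" and r1: "0 < r n k 1" using r_pos n k by auto
  have "real b powr (1 - ?S * (2 * q + 1)) = real b powr (- ?S * (2 * q)) * real b powr (1 - ?S)"
    unfolding powr_add[symmetric] by (simp add: algebra_simps)
  also have "\<dots> \<le> theta ^ (2 * nat q) * real b powr (1 - ?S)"
  proof (intro mult_right_mono)
    have "- ?S * (2 * q) \<le> - smin * (2 * q)" using s_bounds(3)[OF n k] q by (simp add: mult_right_mono)
    then have "real b powr (- ?S * (2 * q)) \<le> real b powr (- smin * (2 * q))"
      using b2 by (intro powr_mono) auto
    also have "\<dots> = theta ^ (2 * nat q)"
      unfolding theta_def using b2 q by (subst powr_power) (auto simp: mult_ac)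
    finally show "real b powr (- ?S * (2 * q)) \<le> theta ^ (2 * nat q)" .
  qed auto
  finally have "real b powr (1 - ?S * (2 * q + 1)) * (M * r n k 1) * r n (Suc k) q
     \<le> theta ^ (2 * nat q) * real b powr (1 - ?S) * (M * r n k 1) * r n (Suc k) q"
    using M r1 rq by (intro mult_right_mono) auto
  also have "\<dots> = theta ^ (2 * nat q) * M * r n (Suc k) q * (real b powr (1 - ?S) * r n k 1)" by simp
  also have "\<dots> \<le> theta ^ (2 * nat q) * M * r n (Suc k) q * (r n (Suc k) 1 * ?A)"
    using theta M rq by (intro mult_left_mono step_lower n k) auto
  finally show ?thesis
    using step_ratio[OF n k M(1) _ q] M(2) r1 by (simp add: mult_ac)
qed

text \<open>The first ratio is \<open>r 1\<close> itself. If all ratios are at most \<open>\<rho> * r 1\<close>, then one step multiplies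
  \<open>\<rho>\<close> for the others by at most \<open>theta\<^sup>2 * A\<close>, where \<open>A\<close> is the convolution power at \<open>0\<close>. By \<open>slope_decay\<close>
  this is less than \<open>1\<close> from some \<open>k0\<close> on, so \<open>\<rho>\<close> grows in at most \<open>k0\<close> steps.\<close>

lemma uniform_ratio:
  "\<exists>H\<ge>1. \<forall>n\<ge>1. \<forall>k\<le>n. \<forall>q\<ge>0. r n k (q + 1) \<le> H * r n k 1 * theta ^ (2 * nat q) * r n k q"
proof -
  obtain S where S: "1 \<le> S" and mass: "\<And>n k. 1 \<le> n \<Longrightarrow> k \<le> n \<Longrightarrow> infsum (r n k) UNIV \<le> 1 + S * r n k 1"
      "\<And>n k. 1 \<le> n \<Longrightarrow> k \<le> n \<Longrightarrow> infsum (r n k) UNIV \<le> S"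
    using uniform_mass by blast
  obtain C where C: "1 \<le> C" "\<And>n k. 1 \<le> n \<Longrightarrow> k \<le> n \<Longrightarrow> r n k 1 \<le> C / sqrt (1 + real k)"
    using slope_decay by blast
  have A_le: "conv_pow (r n k) b 0 \<le> T ^ b" if "1 \<le> n" "k < n" "infsum (r n k) UNIV \<le> T" for n k T
  proof -
    have "0 \<le> infsum (r n k) UNIV" using even_k[OF that(1,2)] by (intro infsum_nonneg) (simp add: even_weightD)
    then show ?thesis using conv_pow_le[OF even_k[OF that(1,2)], of b 0] power_mono[OF that(3), of b] by linarith
  qed
  have "(\<lambda>k. theta ^ 2 * (1 + S * (C / sqrt (1 + real k))) ^ b) \<longlonglongrightarrow> theta ^ 2 * (1 + S * 0) ^ b"
    by (intro tendsto_intros real_tendsto_divide_at_top[OF tendsto_const] filterlim_compose[OF sqrt_at_top]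
      filterlim_tendsto_add_at_top[OF tendsto_const] filterlim_real_sequentially)
  moreover have "theta ^ 2 * (1 + S * 0) ^ b < 1" using theta by (simp add: abs_square_less_1)
  ultimately have "\<forall>\<^sub>F k in sequentially. theta ^ 2 * (1 + S * (C / sqrt (1 + real k))) ^ b < 1"
    by (rule order_tendstoD)
  then obtain k0 where k0: "\<And>k. k0 \<le> k \<Longrightarrow> theta ^ 2 * (1 + S * (C / sqrt (1 + real k))) ^ b < 1"
    by (auto simp: eventually_sequentially)
  define Q where "Q = S ^ b"
  have Q: "1 \<le> Q" using S by (simp add: Q_def)
  \<comment> \<open>The factor \<open>Q\<close> bounds the growth in the steps before \<open>k0\<close>.\<close>
  define rho where "rho k = max 1 (c0 / l0) * Q ^ min k k0" for k
  have rho1: "1 \<le> rho k" for k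
    using mult_mono[of 1 "max 1 (c0 / l0)" 1 "Q ^ min k k0"] Q by (simp add: rho_def)
  have rho_le: "rho k \<le> rho k0" for k
    unfolding rho_def using Q by (intro mult_left_mono power_increasing) auto
  have ind: "k \<le> n \<Longrightarrow> ratio_le (r n k) (rho k * r n k 1)" if n: "1 \<le> n" for n k
  proof (induction k)
    case 0
    show ?case
      unfolding ratio_le_def
    proof (intro allI impI)
      fix q :: int assume q: "0 \<le> q"
      have "r n 0 (q + 1) \<le> c0 * theta ^ (2 * nat q) * r n 0 q" using init_ratio[OF n q] by (simp add: theta_def)
      also have "\<dots> \<le> c0 * 1 * r n 0 q"
        using c0_pos theta_pow_le_1 r_pos[OF n, of 0 q] by (intro mult_right_mono mult_left_mono) auto
      also have "\<dots> \<le> (rho 0 * r n 0 1) * r n 0 q"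
      proof (intro mult_right_mono)
        have "c0 / l0 * l0 \<le> rho 0 * r n 0 1"
          using init_lower[OF n] l0_pos c0_pos by (intro mult_mono) (auto simp: rho_def)
        then show "c0 * 1 \<le> rho 0 * r n 0 1" using l0_pos by simp
      qed (use r_pos[OF n, of 0 q] in auto)
      finally show "r n 0 (q + 1) \<le> (rho 0 * r n 0 1) * r n 0 q" .
    qed
  next
    case (Suc k)
    then have k: "k < n" and IH: "ratio_le (r n k) (rho k * r n k 1)" by auto
    let ?A = "conv_pow (r n k) b 0"
    have A: "theta ^ 2 * ?A * rho k \<le> rho (Suc k)"
    proof (cases "k0 \<le> k")
      case True
      have "infsum (r n k) UNIV \<le> 1 + S * (C / sqrt (1 + real k))"
        using mass(1)[OF n, of k] C(2)[OF n, of k] k S mult_left_mono[of "r n k 1" "C / sqrt (1 + real k)" S] by simp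
      from A_le[OF n k this] have "theta ^ 2 * ?A \<le> theta ^ 2 * (1 + S * (C / sqrt (1 + real k))) ^ b"
        by (intro mult_left_mono) auto
      then have "theta ^ 2 * ?A \<le> 1" using k0[OF True] by simp
      then have "theta ^ 2 * ?A * rho k \<le> 1 * rho k" using rho1[of k] by (intro mult_right_mono) auto
      moreover have "min (Suc k) k0 = min k k0" using True by simp
      ultimately show ?thesis by (simp only: rho_def mult_1)
    next
      case False
      have "?A \<le> Q" unfolding Q_def using mass(2)[OF n, of k] k by (intro A_le n) auto
      then have "theta ^ 2 * ?A * rho k \<le> 1 * Q * rho k"
        using theta_pow_le_1[of 2] rho1[of k] Q conv_0_ge_1[OF n k]
        by (intro mult_right_mono mult_mono) auto
      moreover have "min (Suc k) k0 = Suc (min k k0)" using False by simp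
      ultimately show ?thesis by (simp only: rho_def power_Suc mult_1 mult.left_commute)
    qed
    show ?case
      unfolding ratio_le_def
    proof (intro allI impI)
      fix q :: int assume q: "0 \<le> q"
      have r': "0 < r n (Suc k) q" "0 < r n (Suc k) 1" using r_pos[OF n] k by auto
      show "r n (Suc k) (q + 1) \<le> (rho (Suc k) * r n (Suc k) 1) * r n (Suc k) q"
      proof (cases "q = 0")
        case True
        then show ?thesis using rho1[of "Suc k"] r' r_0[OF n, of "Suc k"] k by simp
      next
        case False
        have "r n (Suc k) (q + 1) \<le> theta ^ (2 * nat q) * ?A * rho k * r n (Suc k) 1 * r n (Suc k) q"
          using rho1[of k] by (intro step_ratio_rel n k IH q) auto
        also have "\<dots> \<le> theta ^ 2 * ?A * rho k * r n (Suc k) 1 * r n (Suc k) q"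
          using r' rho1[of k] conv_0_ge_1[OF n k] theta q False
          by (intro mult_right_mono power_decreasing) auto
        also have "\<dots> \<le> rho (Suc k) * r n (Suc k) 1 * r n (Suc k) q"
          using r' by (intro mult_right_mono A) auto
        finally show ?thesis .
      qed
    qed
  qed
  define H where "H = Q * rho k0"
  have H: "1 \<le> H" "c0 / l0 \<le> H"
  proof -
    show "1 \<le> H" using mult_mono[of 1 Q 1 "rho k0"] Q rho1 by (simp add: H_def)
    have "1 * (c0 / l0) \<le> Q * rho k0"
      using Q rho_le[of 0] c0_pos l0_pos by (intro mult_mono) (auto simp: rho_def)
    then show "c0 / l0 \<le> H" by (simp add: H_def)
  qed
  have "r n k (q + 1) \<le> H * r n k 1 * theta ^ (2 * nat q) * r n k q"
    if n: "1 \<le> n" and k: "k \<le> n" and q: "0 \<le> q" for n k q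
  proof (cases k)
    case 0
    have "c0 / l0 * l0 \<le> H * r n 0 1"
      using init_lower[OF n] l0_pos c0_pos H by (intro mult_mono) auto
    then have "c0 * (theta ^ (2 * nat q) * r n 0 q) \<le> H * r n 0 1 * (theta ^ (2 * nat q) * r n 0 q)"
      using l0_pos theta r_pos[OF n, of 0 q] by (intro mult_right_mono) auto
    then show ?thesis using init_ratio[OF n q] 0 by (simp add: theta_def mult.assoc)
  next
    case (Suc j)
    then have j: "j < n" using k by simp
    have r': "0 < r n k q" "0 < r n k 1" using r_pos[OF n k] by auto
    have "conv_pow (r n j) b 0 * rho j \<le> Q * rho k0"
      unfolding Q_def using j mass(2)[OF n, of j] S rho1[of j] by (intro mult_mono rho_le A_le n) auto
    then have "conv_pow (r n j) b 0 * rho j * (theta ^ (2 * nat q) * r n k 1 * r n k q) \<le>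
      H * (theta ^ (2 * nat q) * r n k 1 * r n k q)"
      unfolding H_def using theta r' by (intro mult_right_mono) auto
    then show ?thesis
      using step_ratio_rel[OF n j ind[OF n, of j] _ q] j rho1[of j] Suc by (simp add: mult_ac)
  qed
  then show ?thesis using H by blast
qed

text \<open>The weight of decay is \<open>r n k 1 / C\<close> instead of \<open>r n k 1\<close> since \<open>conv_near_finite_sum\<close> requires
  a weight of at most \<open>1\<close>.\<close>

lemma uniform_decay_norm:
  "\<exists>X\<ge>1. \<exists>C\<ge>1. \<forall>n\<ge>1. \<forall>k\<le>n. r n k 1 \<le> C \<and> decay_norm_le (r n k) (r n k 1 / C) X"
proof -
  obtain H where H: "1 \<le> H" and r: "\<And>n k q. 1 \<le> n \<Longrightarrow> k \<le> n \<Longrightarrow> 0 \<le> q \<Longrightarrow>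
      r n k (q + 1) \<le> H * r n k 1 * theta ^ (2 * nat q) * r n k q"
    using uniform_ratio by blast
  obtain C where C: "1 \<le> C" "\<And>n k. 1 \<le> n \<Longrightarrow> k \<le> n \<Longrightarrow> r n k 1 \<le> C / sqrt (1 + real k)"
    using slope_decay by blast
  define g where "g = gauss_weight theta (H * C)"
  have g: "g summable_on UNIV"
    using gauss_weight_summable[OF theta, of "H * C" 0] H C(1) by (simp add: g_def)
  have "decay_norm_le (r n k) (r n k 1 / C) (infsum g UNIV)" if n: "1 \<le> n" and k: "k \<le> n" for n k
  proof -
    have r1: "0 < r n k 1" using r_pos[OF n k] .
    have le: "r n k q / (r n k 1 / C) ^ nat \<bar>q\<bar> \<le> g q" for q
    proof -
      have "r n k q \<le> gauss_weight theta (H * r n k 1) q"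
        using r[OF n k] H r1 by (intro r_le_gauss_weight n k) auto
      also have "\<dots> = g q * (r n k 1 / C) ^ nat \<bar>q\<bar>"
        using C(1) by (simp add: gauss_weight_def g_def power_mult_distrib power_divide)
      finally show ?thesis using r1 C(1) by (simp add: divide_simps)
    qed
    have "(\<lambda>q. r n k q / (r n k 1 / C) ^ nat \<bar>q\<bar>) summable_on UNIV"
      by (rule summable_on_comparison_test[OF g le]) (use r_pos[OF n k] C(1) in \<open>auto simp: less_imp_le\<close>)
    then show ?thesis
      unfolding decay_norm_le_def by (intro conjI infsum_mono g le) auto
  qed
  moreover have "r n k 1 \<le> C" if "1 \<le> n" "k \<le> n" for n k
  proof -
    have "C / sqrt (1 + real k) \<le> C / 1" using C(1) by (intro divide_left_mono) auto
    then show ?thesis using C(2)[OF that] by simp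
  qed
  moreover have "1 \<le> infsum g UNIV"
    unfolding g_def using H C(1) by (intro gauss_weight_sum_ge_1) auto
  ultimately show ?thesis using C(1) by blast
qed

end

section \<open>Asymptotics of the flow\<close>

lemma quotient_square_expansion:
  fixes t y :: real
  assumes t: "0 \<le> t" "t \<le> e" and y: "0 \<le> y" "y \<le> e"
  shows "\<bar>((1 + t) / (1 + y))\<^sup>2 - (1 + 2 * (t - y))\<bar> \<le> 12 * e\<^sup>2"
proof -
  define z where "z = (1 + y)\<^sup>2"
  have z: "1 \<le> z" "y \<le> z" using y by (auto simp: z_def power2_eq_square algebra_simps)
  have "((1 + t) / (1 + y))\<^sup>2 - (1 + 2 * (t - y)) = (t * t - 4 * (t * y) + 3 * (y * y) - 2 * (t * y) * y + 2 * (y * y) * y) / z"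
    using y by (simp add: z_def power2_eq_square divide_simps) (simp add: algebra_simps)
  also have "\<bar>\<dots>\<bar> \<le> 12 * e\<^sup>2"
  proof -
    have ps: "t * t \<le> e\<^sup>2" "t * y \<le> e\<^sup>2" "y * y \<le> e\<^sup>2"
      using t y by (auto simp: power2_eq_square intro!: mult_mono)
    have nn: "0 \<le> t * t" "0 \<le> t * y" "0 \<le> y * y" using t y by auto
    have e2: "e\<^sup>2 \<le> e\<^sup>2 * z" using z mult_left_mono[of 1 z "e\<^sup>2"] by simp
    have "(t * y) * y \<le> e\<^sup>2 * z" "(y * y) * y \<le> e\<^sup>2 * z" "0 \<le> (t * y) * y" "0 \<le> (y * y) * y"
      using ps nn z y by (auto intro!: mult_mono)
    then have "\<bar>t * t - 4 * (t * y) + 3 * (y * y) - 2 * (t * y) * y + 2 * (y * y) * y\<bar> \<le> 12 * (e\<^sup>2 * z)"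
      using ps nn e2 by linarith
    then show ?thesis using z by (simp add: abs_divide divide_simps mult_ac)
  qed
  finally show ?thesis .
qed

lemma quotient_expansion:
  fixes t y :: real
  assumes t: "0 \<le> t" "t \<le> e" and y: "0 \<le> y" "y \<le> e"
  shows "\<bar>(1 + t) / (1 + y)\<^sup>2 - 1\<bar> \<le> 4 * e"
proof -
  define z where "z = (1 + y)\<^sup>2"
  have z: "1 \<le> z" "y \<le> z" using y by (auto simp: z_def power2_eq_square algebra_simps)
  have "(1 + t) / (1 + y)\<^sup>2 - 1 = (t - 2 * y - y * y) / z"
    using y by (simp add: z_def power2_eq_square divide_simps) (simp add: algebra_simps)
  also have "\<bar>\<dots>\<bar> \<le> 4 * e"
  proof -
    have "e \<le> e * z" using z t mult_left_mono[of 1 z e] by simp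
    moreover have "y * y \<le> e * z" "0 \<le> y * y" using y t z by (auto intro!: mult_mono)
    ultimately have "\<bar>t - 2 * y - y * y\<bar> \<le> 4 * (e * z)" using t y by linarith
    then show ?thesis using z by (simp add: abs_divide divide_simps mult_ac)
  qed
  finally show ?thesis .
qed

lemma exp_minus_lipschitz:
  fixes x y :: real
  assumes "0 \<le> x" "0 \<le> y"
  shows "\<bar>exp (- x) - exp (- y)\<bar> \<le> \<bar>x - y\<bar>"
proof -
  have *: "exp (- x) - exp (- y) \<le> y - x \<and> 0 \<le> exp (- x) - exp (- y)" if "0 \<le> x" "x \<le> y" for x y :: real
  proof -
    have "1 - exp (- (y - x)) \<le> y - x" using exp_ge_add_one_self[of "- (y - x)"] by linarith
    then have "exp (- x) * (1 - exp (- (y - x))) \<le> 1 * (y - x)"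
      using that by (intro mult_mono) auto
    moreover have "exp (- x) * (1 - exp (- (y - x))) = exp (- x) - exp (- y)"
      by (simp add: right_diff_distrib flip: exp_add)
    ultimately show ?thesis using that by simp
  qed
  show ?thesis using *[of x y] *[of y x] assms by (cases "x \<le> y") auto
qed

lemma abs_exp_minus_1_le:
  fixes x :: real
  assumes "\<bar>x\<bar> \<le> L"
  shows "\<bar>exp x - 1\<bar> \<le> exp L * \<bar>x\<bar>"
proof (cases "0 \<le> x")
  case True
  have "exp x * (1 - exp (- x)) \<le> exp L * x"
    using exp_ge_add_one_self[of "- x"] True assms by (intro mult_mono) auto
  moreover have "exp x * (1 - exp (- x)) = exp x - 1" by (simp add: right_diff_distrib flip: exp_add)
  ultimately show ?thesis using True by simp
next
  case False
  have "1 * (- x) \<le> exp L * \<bar>x\<bar>" using False assms by (intro mult_mono) auto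
  moreover have "1 + x \<le> exp x" by (rule exp_ge_add_one_self)
  moreover have "exp x \<le> 1" using False by simp
  ultimately show ?thesis by linarith
qed

lemma sum_inverse_le_sqrt: "(\<Sum>j<k. 1 / (1 + real j)) \<le> 2 * sqrt (real k)"
proof (induction k)
  case (Suc k)
  have "sqrt (real k) * sqrt (real k) = real k" "sqrt (1 + real k) * sqrt (1 + real k) = 1 + real k" by auto
  moreover have s: "0 \<le> sqrt (real k)" "sqrt (real k) \<le> sqrt (1 + real k)" "1 \<le> sqrt (1 + real k)" by auto
  ultimately have "(sqrt (1 + real k) - sqrt (real k)) * (sqrt (1 + real k) + sqrt (real k)) = 1"
    by (simp add: algebra_simps)
  then have "1 \<le> (sqrt (1 + real k) - sqrt (real k)) * (2 * sqrt (1 + real k))"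
    using s mult_left_mono[of "sqrt (1 + real k) + sqrt (real k)" "2 * sqrt (1 + real k)" "sqrt (1 + real k) - sqrt (real k)"]
    by simp
  then have "1 / sqrt (1 + real k) \<le> 2 * sqrt (1 + real k) - 2 * sqrt (real k)"
    using s by (simp add: divide_simps) (simp add: algebra_simps)
  moreover have "1 / (1 + real k) \<le> 1 / sqrt (1 + real k)"
    using s real_sqrt_le_mono by (intro divide_left_mono) (auto simp: real_le_lsqrt power2_eq_square)
  ultimately show ?case using Suc by (simp add: add_ac)
qed auto

context critical_flow
begin

text \<open>The fixed point of the limiting recursion of \<open>r 2 / (r 1)\<^sup>2\<close>, see \<open>second_ratio_fix_eq\<close>.\<close>

definition second_ratio_fix :: real where "second_ratio_fix = (real b - 1) / (2 * (real b ^ 3 - 1))"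

text \<open>The increment of \<open>1 / (r 1)\<^sup>2\<close> in one step when \<open>r 2 / (r 1)\<^sup>2\<close> sits at its fixed point;
  \<open>drift_eq\<close> displays the contributions of the expansion at \<open>0\<close> and at \<open>1\<close>.\<close>

definition drift :: real where "drift = (real b - 1)\<^sup>2 * (real b + 1) ^ 3 / (real b ^ 3 - 1)"

lemma b_cubed: "1 < real b ^ 3" using b2 by (intro one_less_power) auto

lemma drift_pos: "0 < drift"
proof -
  have "0 < real b ^ 3 - 1" using b_cubed by linarith
  moreover have "0 < (real b - 1)\<^sup>2" "0 < (real b + 1) ^ 3" using b2 by auto
  ultimately show ?thesis unfolding drift_def by (intro divide_pos_pos mult_pos_pos)
qed

lemma limit_const_eq: "limit_const b = 1 / sqrt drift"
proof -
  have "(real b ^ 3 - 1) / ((real b - 1)\<^sup>2 * (real b + 1) ^ 3) = 1 / drift" by (simp add: drift_def)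
  then show ?thesis by (simp only: limit_const_def real_sqrt_divide real_sqrt_one)
qed

lemma drift_eq:
  "drift = 2 * (real b * (real b - 1) - ((real b - 1) * (real b - 2) / 2 + (real b - 1) * second_ratio_fix))"
proof -
  have ne: "real b ^ 3 - 1 \<noteq> 0" using b_cubed by simp
  have "2 * (real b * (real b - 1) - ((real b - 1) * (real b - 2) / 2 + (real b - 1) * second_ratio_fix)) * (real b ^ 3 - 1)
    = (2 * real b * (real b - 1) - (real b - 1) * (real b - 2)) * (real b ^ 3 - 1) - (real b - 1)\<^sup>2"
    using ne by (simp add: second_ratio_fix_def field_simps power2_eq_square)
  also have "\<dots> = (real b - 1)\<^sup>2 * (real b + 1) ^ 3"
    by (simp add: power2_eq_square power3_eq_cube algebra_simps)
  finally show ?thesis using ne by (simp add: drift_def field_simps)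
qed

lemma second_ratio_fix_eq: "second_ratio_fix = (real b * second_ratio_fix + real b * (real b - 1) / 2) / real b ^ 4"
proof -
  have "real b ^ 3 - 1 \<noteq> 0" using b_cubed by linarith
  then have e: "2 * (real b ^ 3 - 1) * second_ratio_fix = real b - 1" by (simp add: second_ratio_fix_def)
  have "real b * second_ratio_fix + real b * (real b - 1) / 2 = real b * second_ratio_fix + real b * (2 * (real b ^ 3 - 1) * second_ratio_fix) / 2"
    by (simp only: e)
  also have "\<dots> = real b ^ 4 * second_ratio_fix" by (simp add: power_numeral_reduce field_simps)
  finally show ?thesis using b2 by simp
qed

abbreviation R where "R n k \<equiv> r n k 1"
definition second_ratio :: "nat \<Rightarrow> nat \<Rightarrow> real" where "second_ratio n k = r n k 2 / (R n k)\<^sup>2"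

text \<open>The expansion in terms of \<open>R n k\<close> and \<open>second_ratio n k\<close>, with the leading factor of the
  value at \<open>1\<close> divided out.\<close>

definition step_bounds :: "real \<Rightarrow> nat \<Rightarrow> nat \<Rightarrow> bool" where
  "step_bounds K n k \<longleftrightarrow>
    0 < R n k \<and> R n k \<le> K \<and> (R n k)\<^sup>2 \<le> K / (1 + real k) \<and> 0 \<le> second_ratio n k \<and> second_ratio n k \<le> K \<and>
    (k < n \<longrightarrow>
    0 \<le> conv_pow (r n k) b 0 - 1 \<and> conv_pow (r n k) b 0 - 1 \<le> K * (R n k)\<^sup>2 \<and>
    \<bar>conv_pow (r n k) b 0 - 1 - real b * (real b - 1) * (R n k)\<^sup>2\<bar> \<le> K * (R n k) ^ 4 \<and>
    0 \<le> conv_pow (r n k) b 1 / (real b * R n k) - 1 \<and> conv_pow (r n k) b 1 / (real b * R n k) - 1 \<le> K * (R n k)\<^sup>2 \<and>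
    \<bar>conv_pow (r n k) b 1 / (real b * R n k) - 1 
       - ((real b - 1) * (real b - 2) / 2 + (real b - 1) * second_ratio n k) * (R n k)\<^sup>2\<bar> \<le> K * (R n k) ^ 4 \<and>
    \<bar>conv_pow (r n k) b 2 / (R n k)\<^sup>2 - (real b * second_ratio n k + real b * (real b - 1) / 2)\<bar> \<le> K * (R n k)\<^sup>2)"

lemma step_expansion: "\<exists>K\<ge>1. \<forall>n\<ge>1. \<forall>k\<le>n. step_bounds K n k"
proof -
  obtain X C where X: "1 \<le> X" and C: "1 \<le> C" and XC: "\<And>n k. 1 \<le> n \<Longrightarrow> k \<le> n \<Longrightarrow>
      R n k \<le> C \<and> decay_norm_le (r n k) (R n k / C) X"
    using uniform_decay_norm by blast
  obtain H where H: "1 \<le> H" and r: "\<And>n k q. 1 \<le> n \<Longrightarrow> k \<le> n \<Longrightarrow> 0 \<le> q \<Longrightarrow>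
      r n k (q + 1) \<le> H * r n k 1 * theta ^ (2 * nat q) * r n k q"
    using uniform_ratio by blast
  obtain C2 where C2: "1 \<le> C2" "\<And>n k. 1 \<le> n \<Longrightarrow> k \<le> n \<Longrightarrow> R n k \<le> C2 / sqrt (1 + real k)"
    using slope_decay by blast
  obtain K0 where K0: "0 \<le> K0" and exp: "\<And>x e. even_weight x \<Longrightarrow> x 0 = 1 \<Longrightarrow> 0 < e \<Longrightarrow> e \<le> 1 \<Longrightarrow>
      decay_norm_le x e X \<Longrightarrow> third_order_expansion b K0 x e"
    using conv_pow_expansion[OF X, of b] by blast
  define K1 where "K1 = K0 * C\<^sup>2 + real b * (real b - 1)"
  define K2 where "K2 = K0 * C\<^sup>2 + ((real b - 1) * (real b - 2) / 2 + (real b - 1) * H)"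
  define K where "K = max (max 1 (max C (C2\<^sup>2))) (max (max H K0) (max K1 K2))"
  have K: "1 \<le> K" "C \<le> K" "C2\<^sup>2 \<le> K" "H \<le> K" "K0 \<le> K" "K1 \<le> K" "K2 \<le> K" by (auto simp: K_def)
  have b1: "2 \<le> real b" using b2 by simp
  show ?thesis
    unfolding step_bounds_def
  proof (intro exI[of _ K] conjI K(1) allI impI)
    fix n k :: nat assume n: "1 \<le> n" and k: "k \<le> n"
    let ?R = "R n k" and ?u = "second_ratio n k"
    show R0: "0 < ?R" using r_pos[OF n k] .
    have RC: "?R \<le> C" using XC[OF n k] by simp
    then show "?R \<le> K" using K by simp
    have "?R\<^sup>2 \<le> (C2 / sqrt (1 + real k))\<^sup>2" using C2(2)[OF n k] R0 by (intro power_mono) auto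
    also have "\<dots> = C2\<^sup>2 / (1 + real k)" by (simp add: power_divide)
    also have "\<dots> \<le> K / (1 + real k)" using K by (intro divide_right_mono) auto
    finally show "?R\<^sup>2 \<le> K / (1 + real k)" .
    have r2: "r n k 2 = ?u * ?R\<^sup>2" using R0 by (simp add: second_ratio_def)
    have r2H: "r n k 2 \<le> H * ?R\<^sup>2"
    proof -
      have "H * ?R * theta ^ 2 * ?R \<le> H * ?R * 1 * ?R"
        using H R0 theta_pow_le_1[of 2] by (intro mult_right_mono mult_left_mono) auto
      then show ?thesis using r[OF n k, of 1] by (simp add: power2_eq_square)
    qed
    show u0: "0 \<le> ?u" using r_pos[OF n k, of 2] by (simp add: second_ratio_def)
    have uH: "?u \<le> H" using r2H R0 by (simp add: second_ratio_def divide_simps)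
    then show "?u \<le> K" using K by simp
    have pw: "K0 * (?R / C) ^ m \<le> K0 * ?R ^ m" for m
      using K0 R0 C by (intro mult_left_mono power_mono) (auto simp: divide_le_eq mult_left_le)
    have R24: "K0 * ?R ^ 4 \<le> K0 * C\<^sup>2 * ?R\<^sup>2"
      using mult_left_mono[OF power_mono[OF RC, of 2], of "K0 * ?R\<^sup>2"] K0 R0 by (simp add: power_numeral_reduce mult_ac)
    assume kn: "k < n"
    have ev: "even_weight (r n k)" and z: "r n k 0 = 1" using r_even r_0 n k by auto
    define A where "A = conv_pow (r n k) b"
    have E: "\<bar>A 0 - (1 + real b * (real b - 1) * ?R\<^sup>2)\<bar> \<le> K0 * ?R ^ 4"
      "\<bar>A 1 - (real b * ?R + real b * (real b - 1) * (real b - 2) / 2 * ?R ^ 3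
         + real b * (real b - 1) * (?R * r n k 2))\<bar> \<le> K0 * ?R ^ 5"
      "\<bar>A 2 - (real b * r n k 2 + real b * (real b - 1) / 2 * ?R\<^sup>2)\<bar> \<le> K0 * ?R ^ 4"
      using exp[OF ev z, of "?R / C"] XC[OF n k] R0 C pw[of 4] pw[of 5]
      by (auto simp: A_def third_order_expansion_def)
    have A0: "1 \<le> A 0" unfolding A_def by (rule conv_0_ge_1[OF n kn])
    then show "0 \<le> conv_pow (r n k) b 0 - 1" by (simp add: A_def)
    have "A 0 - 1 \<le> K1 * ?R\<^sup>2" using E(1) R24 by (simp add: K1_def algebra_simps)
    also have "\<dots> \<le> K * ?R\<^sup>2" using K by (intro mult_right_mono) auto
    finally show "conv_pow (r n k) b 0 - 1 \<le> K * ?R\<^sup>2" by (simp add: A_def)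
    have K04: "K0 * ?R ^ 4 \<le> K * ?R ^ 4" using K R0 by (intro mult_right_mono) auto
    show "\<bar>conv_pow (r n k) b 0 - 1 - real b * (real b - 1) * ?R\<^sup>2\<bar> \<le> K * ?R ^ 4"
      using E(1) K04 by (simp add: A_def algebra_simps)
    have "real b * ?R \<le> A 1" unfolding A_def by (rule conv_pow_1_ge[OF ev z])
    then show "0 \<le> conv_pow (r n k) b 1 / (real b * ?R) - 1" using b1 R0 by (simp add: A_def divide_simps)
    define g where "g = (real b - 1) * (real b - 2) / 2 + (real b - 1) * ?u"
    have g: "0 \<le> g" "g \<le> (real b - 1) * (real b - 2) / 2 + (real b - 1) * H"
      using b1 u0 uH by (auto simp: g_def intro!: mult_left_mono)
    have e1: "A 1 / (real b * ?R) - 1 - g * ?R\<^sup>2 =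
       (A 1 - (real b * ?R + real b * (real b - 1) * (real b - 2) / 2 * ?R ^ 3
         + real b * (real b - 1) * (?R * r n k 2))) / (real b * ?R)"
      unfolding r2 g_def using b1 R0 by (simp add: divide_simps) (simp add: power_numeral_reduce algebra_simps)
    have "\<bar>A 1 / (real b * ?R) - 1 - g * ?R\<^sup>2\<bar> \<le> K0 * ?R ^ 5 / (real b * ?R)"
      unfolding e1 abs_divide using E(2) b1 R0 by (simp add: divide_right_mono)
    also have "\<dots> \<le> K0 * ?R ^ 5 / (1 * ?R)"
      using b1 R0 K0 by (intro divide_left_mono mult_right_mono) auto
    also have "\<dots> = K0 * ?R ^ 4" using R0 by (simp add: power_numeral_reduce)
    finally have y: "\<bar>A 1 / (real b * ?R) - 1 - g * ?R\<^sup>2\<bar> \<le> K0 * ?R ^ 4" .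
    then show "\<bar>conv_pow (r n k) b 1 / (real b * ?R) - 1 
       - ((real b - 1) * (real b - 2) / 2 + (real b - 1) * ?u) * ?R\<^sup>2\<bar> \<le> K * ?R ^ 4"
      using K04 by (simp add: A_def g_def)
    have "A 1 / (real b * ?R) - 1 \<le> K2 * ?R\<^sup>2"
      using y R24 mult_right_mono[OF g(2), of "?R\<^sup>2"] by (simp add: K2_def algebra_simps)
    also have "\<dots> \<le> K * ?R\<^sup>2" using K by (intro mult_right_mono) auto
    finally show "conv_pow (r n k) b 1 / (real b * ?R) - 1 \<le> K * ?R\<^sup>2" by (simp add: A_def)
    have e2: "A 2 / ?R\<^sup>2 - (real b * ?u + real b * (real b - 1) / 2) =
      (A 2 - (real b * r n k 2 + real b * (real b - 1) / 2 * ?R\<^sup>2)) / ?R\<^sup>2"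
      unfolding r2 using R0 by (simp add: divide_simps algebra_simps)
    have "\<bar>A 2 / ?R\<^sup>2 - (real b * ?u + real b * (real b - 1) / 2)\<bar> \<le> K0 * ?R ^ 4 / ?R\<^sup>2"
      unfolding e2 abs_divide using E(3) by (simp add: divide_right_mono)
    also have "\<dots> = K0 * ?R\<^sup>2" using R0 by (simp add: power_numeral_reduce)
    also have "\<dots> \<le> K * ?R\<^sup>2" using K by (intro mult_right_mono) auto
    finally show "\<bar>conv_pow (r n k) b 2 / ?R\<^sup>2 - (real b * ?u + real b * (real b - 1) / 2)\<bar> \<le> K * ?R\<^sup>2"
      by (simp add: A_def)
  qed
qed


text \<open>With this definition \<open>1 / (R n (Suc k))\<^sup>2\<close> equals
  \<open>b powr (2 * (s - 1)) * (1 / (R n k)\<^sup>2 + drift + step_err n k)\<close>.\<close>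

definition step_err :: "nat \<Rightarrow> nat \<Rightarrow> real" where
  "step_err n k = real b powr (- 2 * (s n (Suc k) - 1)) / (R n (Suc k))\<^sup>2 - 1 / (R n k)\<^sup>2 - drift"

text \<open>Writing the values of the convolution power at \<open>0\<close> and \<open>1\<close> as \<open>1 + t\<close> and
  \<open>b * R n k * (1 + y)\<close>, the new \<open>1 / R\<^sup>2\<close> is \<open>((1 + t) / (1 + y))\<^sup>2 / R\<^sup>2\<close> times the variance
  factor. Up to terms of order \<open>R\<^sup>2\<close>, \<open>2 * (t - y) / R\<^sup>2\<close> is \<open>drift\<close> plus a multiple of the distance of
  \<open>second_ratio n k\<close> from its fixed point. That distance contracts with the factor
  \<open>b powr (- 1 - 2 * s) \<le> 1 / 2\<close>.\<close>

lemma flow_step: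
  "\<exists>K\<ge>1. \<forall>n\<ge>1. \<forall>k<n. \<bar>step_err n k\<bar> \<le> K * (\<bar>second_ratio n k - second_ratio_fix\<bar> + 1 / (1 + real k)) \<and>
    \<bar>second_ratio n (Suc k) - second_ratio_fix\<bar> \<le> \<bar>second_ratio n k - second_ratio_fix\<bar> / 2 + K * (delta n (Suc k) + 1 / (1 + real k))"
proof -
  obtain K where K: "1 \<le> K" and st: "\<And>n k. 1 \<le> n \<Longrightarrow> k \<le> n \<Longrightarrow> step_bounds K n k"
    using step_expansion by blast
  define M where "M = real b * K + real b * (real b - 1) / 2"
  define mfix where "mfix = real b * second_ratio_fix + real b * (real b - 1) / 2"
  define K3 where "K3 = K * (1 + 4 * K * K\<^sup>2) + M * (4 * K)"
  define Kf where "Kf = max (max 1 (2 * (real b - 1))) (max ((12 * K\<^sup>2 + 2 * K + 2 * K) * K) (max (2 * ln (real b) * mfix) (K3 * K)))"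
  have Kf: "1 \<le> Kf" "2 * (real b - 1) \<le> Kf" "(12 * K\<^sup>2 + 2 * K + 2 * K) * K \<le> Kf"
    "2 * ln (real b) * mfix \<le> Kf" "K3 * K \<le> Kf" by (auto simp: Kf_def)
  have b1: "2 \<le> real b" using b2 by simp
  have mfix0: "0 \<le> mfix" using b1 b_cubed by (simp add: mfix_def second_ratio_fix_def)
  have M0: "0 \<le> M" using b1 K by (simp add: M_def)
  show ?thesis
  proof (intro exI[of _ Kf] conjI Kf(1) allI impI)
    fix n k :: nat assume n: "1 \<le> n" and k: "k < n"
    define S where "S = s n (Suc k)"
    define \<rho> where "\<rho> = (R n k)\<^sup>2"
    define t where "t = conv_pow (r n k) b 0 - 1"
    define y where "y = conv_pow (r n k) b 1 / (real b * R n k) - 1"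
    define g where "g = (real b - 1) * (real b - 2) / 2 + (real b - 1) * second_ratio n k"
    define a2 where "a2 = conv_pow (r n k) b 2 / \<rho>"
    have R: "0 < R n k" and \<rho>: "0 < \<rho>" "\<rho> \<le> K / (1 + real k)" "\<rho> \<le> K\<^sup>2" and u: "0 \<le> second_ratio n k" "second_ratio n k \<le> K"
      using st[OF n, of k] k by (auto simp: step_bounds_def \<rho>_def intro!: power_mono)
    have \<rho>2: "(R n k) ^ 4 = \<rho>\<^sup>2" by (simp add: \<rho>_def)
    have t: "0 \<le> t" "t \<le> K * \<rho>" "\<bar>t - real b * (real b - 1) * \<rho>\<bar> \<le> K * \<rho>\<^sup>2"
      and y: "0 \<le> y" "y \<le> K * \<rho>" "\<bar>y - g * \<rho>\<bar> \<le> K * \<rho>\<^sup>2"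
      and a2: "\<bar>a2 - (real b * second_ratio n k + real b * (real b - 1) / 2)\<bar> \<le> K * \<rho>"
      using st[OF n, of k] k unfolding step_bounds_def \<rho>2 by (auto simp: t_def y_def g_def a2_def \<rho>_def)
    have A0: "conv_pow (r n k) b 0 = 1 + t" by (simp add: t_def)
    have A1: "conv_pow (r n k) b 1 = real b * R n k * (1 + y)" using R b1 by (simp add: y_def)
    have A2: "conv_pow (r n k) b 2 = a2 * \<rho>" using \<rho> by (simp add: a2_def)
    have R': "R n (Suc k) = real b powr - S * (real b * R n k * (1 + y)) / (1 + t)"
      using r_Suc[OF n k, of 1] by (simp add: S_def A0 A1)
    have r2': "r n (Suc k) 2 = real b powr - (4 * S) * (a2 * \<rho>) / (1 + t)"
      using r_Suc[OF n k, of 2] by (simp add: S_def A0 A2 mult.commute)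
    have bS: "(real b powr - S)\<^sup>2 = real b powr - (2 * S)"
      using b1 by (simp add: power2_eq_square flip: powr_add)
    have bS2: "real b powr (- 2 * (S - 1)) = (real b)\<^sup>2 * real b powr - (2 * S)"
    proof -
      have "real b powr (- 2 * (S - 1)) = real b powr (2 + - (2 * S))" by (simp add: algebra_simps)
      also have "\<dots> = (real b)\<^sup>2 * real b powr - (2 * S)" using b1 by (subst powr_add) simp
      finally show ?thesis .
    qed
    have R'2: "(R n (Suc k))\<^sup>2 = real b powr - (2 * S) * ((real b)\<^sup>2 * \<rho> * (1 + y)\<^sup>2) / (1 + t)\<^sup>2"
      unfolding R' by (simp add: power_mult_distrib power_divide bS \<rho>_def)
    define err where "err = ((1 + t) / (1 + y))\<^sup>2 - (1 + 2 * (t - y))"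
    have err: "\<bar>err\<bar> \<le> 12 * (K * \<rho>)\<^sup>2"
      unfolding err_def by (rule quotient_square_expansion) (use t y in auto)
    have "real b powr (- 2 * (S - 1)) / (R n (Suc k))\<^sup>2 = ((1 + t) / (1 + y))\<^sup>2 / \<rho>"
      unfolding R'2 bS2 using b1 t y by (simp add: power_divide)
    then have "step_err n k = ((1 + t) / (1 + y))\<^sup>2 / \<rho> - 1 / \<rho> - drift"
      by (simp add: step_err_def S_def \<rho>_def)
    also have "\<dots> = err / \<rho> + 2 * (t - real b * (real b - 1) * \<rho>) / \<rho> - 2 * (y - g * \<rho>) / \<rho> - 2 * (real b - 1) * (second_ratio n k - second_ratio_fix)"
      using \<rho>(1) by (simp add: err_def drift_eq g_def diff_divide_distrib add_divide_distrib right_diff_distrib) (simp add: algebra_simps)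
    finally have Eeq: "step_err n k = err / \<rho> + 2 * (t - real b * (real b - 1) * \<rho>) / \<rho> - 2 * (y - g * \<rho>) / \<rho> - 2 * (real b - 1) * (second_ratio n k - second_ratio_fix)" .
    have d1: "\<bar>err / \<rho>\<bar> \<le> 12 * K\<^sup>2 * \<rho>" 
      using err \<rho>(1) by (simp add: abs_divide divide_simps power2_eq_square mult_ac)
    have dz: "\<bar>2 * z / \<rho>\<bar> \<le> 2 * K * \<rho>" if "\<bar>z\<bar> \<le> K * \<rho>\<^sup>2" for z
      using that \<rho>(1) by (simp add: abs_divide abs_mult divide_simps power2_eq_square mult_ac)
    note d2 = dz[OF t(3)] and d3 = dz[OF y(3)]
    have d4: "\<bar>2 * (real b - 1) * (second_ratio n k - second_ratio_fix)\<bar> = 2 * (real b - 1) * \<bar>second_ratio n k - second_ratio_fix\<bar>"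
      using b1 by (simp add: abs_mult)
    have "\<bar>step_err n k\<bar> \<le> (12 * K\<^sup>2 + 2 * K + 2 * K) * \<rho> + 2 * (real b - 1) * \<bar>second_ratio n k - second_ratio_fix\<bar>"
    proof -
      have "\<bar>p + q - v - w\<bar> \<le> P + Q + V + W" if "\<bar>p\<bar> \<le> P" "\<bar>q\<bar> \<le> Q" "\<bar>v\<bar> \<le> V" "\<bar>w\<bar> \<le> W"
        for p q v w P Q V W :: real
        using that by linarith
      from this[OF d1 d2 d3 eq_refl[OF d4]] show ?thesis
        unfolding Eeq by (simp only: distrib_right)
    qed
    also have "\<dots> \<le> Kf * (1 / (1 + real k)) + Kf * \<bar>second_ratio n k - second_ratio_fix\<bar>"
    proof (intro add_mono mult_right_mono Kf)
      have "(12 * K\<^sup>2 + 2 * K + 2 * K) * \<rho> \<le> (12 * K\<^sup>2 + 2 * K + 2 * K) * (K / (1 + real k))"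
        using \<rho>(2) K by (intro mult_left_mono) auto
      also have "\<dots> = (12 * K\<^sup>2 + 2 * K + 2 * K) * K * (1 / (1 + real k))" by simp
      also have "\<dots> \<le> Kf * (1 / (1 + real k))" by (intro mult_right_mono Kf) auto
      finally show "(12 * K\<^sup>2 + 2 * K + 2 * K) * \<rho> \<le> Kf * (1 / (1 + real k))" .
    qed auto
    finally show "\<bar>step_err n k\<bar> \<le> Kf * (\<bar>second_ratio n k - second_ratio_fix\<bar> + 1 / (1 + real k))" by (simp add: distrib_left add.commute)
    define w where "w = (1 + t) / (1 + y)\<^sup>2"
    have w: "\<bar>w - 1\<bar> \<le> 4 * (K * \<rho>)" unfolding w_def by (rule quotient_expansion) (use t y in auto)
    define m where "m = real b * second_ratio n k + real b * (real b - 1) / 2"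
    have m: "0 \<le> m" "m \<le> M" using u b1 by (auto simp: m_def M_def)
    define c where "c = real b powr - (2 * S) / (real b)\<^sup>2"
    have S0: "0 < S" using s_bounds(3)[OF n k] smin_pos by (simp add: S_def)
    have bS1: "real b powr - (2 * S) \<le> 1" using b1 S0 by (simp add: powr_le_one_le powr_minus inverse_le_1_iff ge_one_powr_ge_zero)
    have c: "0 \<le> c" "c \<le> 1" "c * real b \<le> 1 / 2"
    proof -
      show "0 \<le> c" by (simp add: c_def)
      have "c \<le> 1 / (real b)\<^sup>2" unfolding c_def using bS1 by (intro divide_right_mono) auto
      then have "c * real b \<le> 1 / (real b)\<^sup>2 * real b" using b1 by (intro mult_right_mono) auto
      also have "\<dots> = 1 / real b" using b1 by (simp add: power2_eq_square)
      also have "\<dots> \<le> 1 / 2" using b1 by (intro divide_left_mono) auto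
      finally show cb: "c * real b \<le> 1 / 2" .
      then show "c \<le> 1" using b1 \<open>0 \<le> c\<close> mult_left_mono[of 1 "real b" c] by simp
    qed
    have u': "second_ratio n (Suc k) = c * (a2 * w)"
    proof -
      have "real b powr - (4 * S) = real b powr - (2 * S) * real b powr - (2 * S)"
        by (simp flip: powr_add)
      then show ?thesis
        unfolding second_ratio_def R'2 r2' c_def w_def using t y b1 \<rho>(1) by (simp add: divide_simps power2_eq_square)
    qed
    have "a2 * w - m = (a2 - m) * (1 + (w - 1)) + m * (w - 1)" by (simp add: algebra_simps)
    also have "\<bar>\<dots>\<bar> \<le> \<bar>a2 - m\<bar> * (1 + \<bar>w - 1\<bar>) + m * \<bar>w - 1\<bar>"
      using m by (intro order_trans[OF abs_triangle_ineq] add_mono) (auto simp: abs_mult intro!: mult_left_mono)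
    also have "\<dots> \<le> (K * \<rho>) * (1 + 4 * K * K\<^sup>2) + M * (4 * (K * \<rho>))"
    proof (intro add_mono mult_mono)
      have "K * \<rho> \<le> K * K\<^sup>2" using \<rho>(3) K by (intro mult_left_mono) auto
      then show "\<bar>w - 1\<bar> \<le> 4 * K * K\<^sup>2" using w by simp
    qed (use a2 w m M0 K \<rho> in \<open>auto simp: m_def\<close>)
    also have "\<dots> = K3 * \<rho>" by (simp add: K3_def algebra_simps)
    also have "\<dots> \<le> K3 * (K / (1 + real k))" using K M0 by (intro mult_left_mono \<rho>) (auto simp: K3_def)
    also have "\<dots> = K3 * K * (1 / (1 + real k))" by simp
    also have "\<dots> \<le> Kf * (1 / (1 + real k))" by (intro mult_right_mono Kf) auto
    finally have aw: "\<bar>a2 * w - m\<bar> \<le> Kf * (1 / (1 + real k))" .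
    have ufix: "second_ratio_fix = mfix / real b ^ 4" unfolding mfix_def by (rule second_ratio_fix_eq)
    have cc: "\<bar>(c - 1 / real b ^ 4) * mfix\<bar> \<le> Kf * delta n (Suc k)"
    proof -
      have "\<bar>c - 1 / real b ^ 4\<bar> = \<bar>real b powr - (2 * S) - real b powr - 2\<bar> / (real b)\<^sup>2"
        using b1 by (simp add: c_def powr_minus powr_numeral divide_simps abs_divide power_numeral_reduce)
      also have "\<dots> \<le> \<bar>real b powr - (2 * S) - real b powr - 2\<bar> / 1"
        using b1 by (intro divide_left_mono) (auto simp: one_le_power)
      also have "\<dots> = \<bar>exp (- (2 * S * ln (real b))) - exp (- (2 * ln (real b)))\<bar>"
        using b1 by (simp add: powr_def)
      also have "\<dots> \<le> \<bar>2 * S * ln (real b) - 2 * ln (real b)\<bar>"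
        using b1 S0 by (intro exp_minus_lipschitz) auto
      also have "\<dots> = 2 * ln (real b) * \<bar>S - 1\<bar>"
      proof -
        have "2 * S * ln (real b) - 2 * ln (real b) = 2 * ln (real b) * (S - 1)" by (simp add: algebra_simps)
        then show ?thesis using b1 by (simp add: abs_mult)
      qed
      also have "\<dots> \<le> 2 * ln (real b) * delta n (Suc k)"
        using s_bounds[OF n k] b1 by (intro mult_left_mono) (auto simp: S_def)
      finally have "\<bar>c - 1 / real b ^ 4\<bar> * mfix \<le> 2 * ln (real b) * delta n (Suc k) * mfix"
        using mfix0 by (intro mult_right_mono)
      also have "\<dots> = 2 * ln (real b) * mfix * delta n (Suc k)" by simp
      also have "\<dots> \<le> Kf * delta n (Suc k)" by (intro mult_right_mono Kf delta_nonneg)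
      finally show ?thesis using mfix0 by (simp add: abs_mult)
    qed
    have "second_ratio n (Suc k) - second_ratio_fix = c * (a2 * w - m) + (c * real b) * (second_ratio n k - second_ratio_fix) + (c - 1 / real b ^ 4) * mfix"
    proof -
      have "(c * real b) * (second_ratio n k - second_ratio_fix) = c * (m - mfix)" by (simp add: m_def mfix_def algebra_simps)
      moreover have "second_ratio_fix = 1 / real b ^ 4 * mfix" using ufix by simp
      ultimately show ?thesis by (simp only: u') (simp add: algebra_simps)
    qed
    also have "\<bar>\<dots>\<bar> \<le> 1 * \<bar>a2 * w - m\<bar> + 1 / 2 * \<bar>second_ratio n k - second_ratio_fix\<bar> + Kf * delta n (Suc k)"
    proof -
      have "\<bar>c * (a2 * w - m)\<bar> \<le> 1 * \<bar>a2 * w - m\<bar>" unfolding abs_mult using c by (intro mult_right_mono) auto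
      moreover have "\<bar>(c * real b) * (second_ratio n k - second_ratio_fix)\<bar> \<le> 1 / 2 * \<bar>second_ratio n k - second_ratio_fix\<bar>"
        unfolding abs_mult[of "c * real b"] using c by (intro mult_right_mono) auto
      ultimately show ?thesis using cc by linarith
    qed
    finally show "\<bar>second_ratio n (Suc k) - second_ratio_fix\<bar> \<le> \<bar>second_ratio n k - second_ratio_fix\<bar> / 2 + Kf * (delta n (Suc k) + 1 / (1 + real k))"
      using aw by (simp add: distrib_left)
  qed
qed


text \<open>The sum of \<open>e j\<close> for \<open>j < k\<close> plus \<open>2 * e k\<close> increases in one step by at most twice the
  inhomogeneity of a recursion \<open>e (Suc j) \<le> e j / 2 + g j\<close>.\<close>

lemma sum_step_err:
  "\<exists>K\<ge>1. \<forall>n\<ge>1. \<forall>k\<le>n. 1 \<le> k \<longrightarrow> (\<Sum>j<k. \<bar>step_err n j\<bar>) \<le> K * sqrt (real k)"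
proof -
  obtain K where K: "1 \<le> K" and st: "\<And>n k. 1 \<le> n \<Longrightarrow> k < n \<Longrightarrow> \<bar>step_err n k\<bar> \<le> K * (\<bar>second_ratio n k - second_ratio_fix\<bar> + 1 / (1 + real k)) \<and>
    \<bar>second_ratio n (Suc k) - second_ratio_fix\<bar> \<le> \<bar>second_ratio n k - second_ratio_fix\<bar> / 2 + K * (delta n (Suc k) + 1 / (1 + real k))"
    using flow_step by blast
  obtain Ku where Ku: "1 \<le> Ku" "\<And>n k. 1 \<le> n \<Longrightarrow> k \<le> n \<Longrightarrow> 0 \<le> second_ratio n k \<and> second_ratio n k \<le> Ku"
    using step_expansion unfolding step_bounds_def by blast
  have ufix0: "0 \<le> second_ratio_fix" using b2 b_cubed by (simp add: second_ratio_fix_def)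
  define D where "D = 2 * (Ku + second_ratio_fix) + 2 * K * total_delta"
  have D0: "0 \<le> D" using Ku K ufix0 total_delta_nonneg by (simp add: D_def)
  define Kf where "Kf = max 1 (K * (D + 2 * (2 * K + 1)))"
  have "(\<Sum>j<k. \<bar>step_err n j\<bar>) \<le> Kf * sqrt (real k)" if n: "1 \<le> n" and k: "k \<le> n" "1 \<le> k" for n k
  proof -
    define e where "e j = \<bar>second_ratio n j - second_ratio_fix\<bar>" for j
    have V: "k \<le> n \<Longrightarrow> (\<Sum>j<k. e j) + 2 * e k \<le> 2 * e 0 + 2 * K * (cum_delta n k + (\<Sum>j<k. 1 / (1 + real j)))" for k
    proof (induction k)
      case (Suc k)
      have "e (Suc k) \<le> e k / 2 + K * (delta n (Suc k) + 1 / (1 + real k))"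
        using st[OF n, of k] Suc.prems by (simp add: e_def)
      moreover have "2 * K * (cum_delta n (Suc k) + (\<Sum>j<Suc k. 1 / (1 + real j))) =
        2 * K * (cum_delta n k + (\<Sum>j<k. 1 / (1 + real j))) + 2 * (K * (delta n (Suc k) + 1 / (1 + real k)))"
        by (simp add: cum_delta_Suc algebra_simps)
      moreover have "(\<Sum>j<Suc k. e j) = (\<Sum>j<k. e j) + e k" by simp
      ultimately show ?case using Suc by linarith
    qed (simp add: cum_delta_def)
    have "e 0 \<le> Ku + second_ratio_fix" using Ku(2)[OF n, of 0] ufix0 unfolding e_def by linarith
    moreover have "0 \<le> e k" by (simp add: e_def)
    moreover have "2 * K * (cum_delta n k + (\<Sum>j<k. 1 / (1 + real j))) \<le> 2 * K * (total_delta + (\<Sum>j<k. 1 / (1 + real j)))"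
      using K cum_delta_bounds(2)[OF k(1)] by (intro mult_left_mono) auto
    ultimately have se: "(\<Sum>j<k. e j) \<le> D + 2 * K * (\<Sum>j<k. 1 / (1 + real j))"
      using V[OF k(1)] unfolding D_def distrib_left by linarith
    have "(\<Sum>j<k. \<bar>step_err n j\<bar>) \<le> (\<Sum>j<k. K * (e j + 1 / (1 + real j)))"
      using st[OF n] k by (intro sum_mono) (auto simp: e_def)
    also have "\<dots> = K * ((\<Sum>j<k. e j) + (\<Sum>j<k. 1 / (1 + real j)))"
      by (simp only: sum_distrib_left[symmetric] sum.distrib)
    also have "\<dots> \<le> K * (D + (2 * K + 1) * (\<Sum>j<k. 1 / (1 + real j)))"
      using K se by (intro mult_left_mono) (auto simp: algebra_simps)
    also have "\<dots> \<le> K * (D * sqrt (real k) + (2 * K + 1) * (2 * sqrt (real k)))"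
    proof (intro mult_left_mono add_mono sum_inverse_le_sqrt)
      show "D \<le> D * sqrt (real k)" using D0 k(2) mult_left_mono[of 1 "sqrt (real k)" D] by simp
    qed (use K in auto)
    also have "\<dots> = K * (D + 2 * (2 * K + 1)) * sqrt (real k)" by (simp add: algebra_simps)
    also have "\<dots> \<le> Kf * sqrt (real k)" by (intro mult_right_mono) (auto simp: Kf_def)
    finally show ?thesis .
  qed
  then show ?thesis by (intro exI[of _ Kf]) (auto simp: Kf_def)
qed

text \<open>The logarithm of the accumulated variance factors \<open>b powr (2 * (s - 1))\<close>.\<close>

definition gain :: "nat \<Rightarrow> nat \<Rightarrow> real" where
  "gain n k = (\<Sum>i\<in>{1..k}. 2 * (s n i - 1) * ln (real b))"

lemma gain_diff:
  assumes n: "1 \<le> n" and k: "i \<le> k" "k \<le> n"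
  shows "\<bar>gain n k - gain n i\<bar> \<le> 2 * ln (real b) * (\<Sum>j\<in>{i<..k}. delta n j)"
proof -
  have "gain n k = gain n i + (\<Sum>j\<in>{i<..k}. 2 * (s n j - 1) * ln (real b))"
  proof -
    have "{1..k} = {1..i} \<union> {i<..k}" using k by auto
    then show ?thesis unfolding gain_def by (simp only:) (rule sum.union_disjoint, auto)
  qed
  then have "\<bar>gain n k - gain n i\<bar> \<le> (\<Sum>j\<in>{i<..k}. \<bar>2 * (s n j - 1) * ln (real b)\<bar>)"
    by simp
  also have "\<dots> \<le> (\<Sum>j\<in>{i<..k}. 2 * ln (real b) * delta n j)"
  proof (rule sum_mono)
    fix j assume "j \<in> {i<..k}"
    then have "2 * ln (real b) * \<bar>s n j - 1\<bar> \<le> 2 * ln (real b) * delta n j"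
      using s_near_1[OF n, of j] k b2 by (intro mult_left_mono) (auto simp: delta_def)
    then show "\<bar>2 * (s n j - 1) * ln (real b)\<bar> \<le> 2 * ln (real b) * delta n j"
      using b2 by (simp add: abs_mult mult_ac)
  qed
  finally show ?thesis by (simp add: sum_distrib_left)
qed

lemma gain_diff_total:
  assumes n: "1 \<le> n" and k: "i \<le> k" "k \<le> n"
  shows "\<bar>gain n k - gain n i\<bar> \<le> 2 * ln (real b) * total_delta"
proof -
  have "2 * ln (real b) * (\<Sum>j\<in>{i<..k}. delta n j) \<le> 2 * ln (real b) * total_delta"
    using b2 k by (intro mult_left_mono sum_delta_le_total_delta) auto
  then show ?thesis using gain_diff[OF assms] by linarith
qed

lemma inverse_square_solution:
  assumes n: "1 \<le> n"
  shows "k \<le> n \<Longrightarrow> 1 / (R n k)\<^sup>2 = exp (gain n k) / (R n 0)\<^sup>2 + (\<Sum>i<k. exp (gain n k - gain n i) * (drift + step_err n i))"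
proof (induction k)
  case 0
  then show ?case by (simp add: gain_def)
next
  case (Suc k)
  define g where "g = 2 * (s n (Suc k) - 1) * ln (real b)"
  have gS: "gain n (Suc k) = gain n k + g" by (simp add: gain_def g_def)
  have "real b powr (- 2 * (s n (Suc k) - 1)) = exp (- g)"
    using b2 by (simp add: powr_def g_def) (simp add: algebra_simps)
  then have "exp (- g) / (R n (Suc k))\<^sup>2 = 1 / (R n k)\<^sup>2 + (drift + step_err n k)" by (simp add: step_err_def)
  then have "exp g * (exp (- g) / (R n (Suc k))\<^sup>2) = exp g * (1 / (R n k)\<^sup>2 + (drift + step_err n k))" by simp
  moreover have "exp g * (exp (- g) / (R n (Suc k))\<^sup>2) = 1 / (R n (Suc k))\<^sup>2" by (simp add: exp_minus)
  ultimately have "1 / (R n (Suc k))\<^sup>2 = exp g * (1 / (R n k)\<^sup>2) + exp g * (drift + step_err n k)"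
    by (simp add: distrib_left)
  also have "\<dots> = exp (gain n (Suc k)) / (R n 0)\<^sup>2 + (\<Sum>i<Suc k. exp (gain n (Suc k) - gain n i) * (drift + step_err n i))"
  proof -
    have "exp (gain n (Suc k)) = exp g * exp (gain n k)" by (simp add: gS exp_add)
    moreover have "exp (gain n (Suc k) - gain n i) = exp g * exp (gain n k - gain n i)" for i
      unfolding gS by (simp add: algebra_simps flip: exp_add)
    then have "(\<Sum>i<k. exp (gain n (Suc k) - gain n i) * (drift + step_err n i)) =
        exp g * (\<Sum>i<k. exp (gain n k - gain n i) * (drift + step_err n i))"
      by (simp only: sum_distrib_left mult.assoc)
    moreover have "exp (gain n (Suc k) - gain n k) = exp g" by (simp add: gS)
    ultimately show ?thesis using Suc by (simp add: distrib_left)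
  qed
  finally show ?case .
qed

text \<open>Compare \<open>1 / (R n k)\<^sup>2\<close> with \<open>drift * k\<close> in the explicit solution. The factor
  \<open>exp (gain n k - gain n i)\<close> differs from \<open>1\<close> by a multiple of the tail sum of \<open>d\<close> when
  \<open>i \<ge> sqrt k\<close>, and is bounded for the at most \<open>2 * sqrt k\<close> smaller \<open>i\<close>. Dividing by
  \<open>k powr (3 / 2)\<close> when passing to \<open>R n k\<close> gives the error scale.\<close>

lemma slope_asymptotics:
  "\<exists>K>0. \<forall>n\<ge>1. \<forall>k\<in>{1..n}. \<bar>R n k - 1 / sqrt (real k) * limit_const b\<bar> \<le> K * error_scale d n k"
proof -
  obtain KE where KE: "1 \<le> KE" and sE: "\<And>n k. 1 \<le> n \<Longrightarrow> k \<le> n \<Longrightarrow> 1 \<le> k \<Longrightarrow> (\<Sum>j<k. \<bar>step_err n j\<bar>) \<le> KE * sqrt (real k)"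
    using sum_step_err by blast
  obtain C where C: "1 \<le> C" "\<And>n k. 1 \<le> n \<Longrightarrow> k \<le> n \<Longrightarrow> R n k \<le> C / sqrt (1 + real k)"
    using slope_decay by blast
  define L where "L = 2 * ln (real b) * total_delta"
  have lnb: "0 < ln (real b)" using b2 by simp
  have L0: "0 \<le> L" using lnb total_delta_nonneg by (simp add: L_def)
  define K5 where "K5 = exp L / l0\<^sup>2 + exp L * KE + drift * (2 * (exp L * L))"
  define K6 where "K6 = drift * (exp L * (4 * ln (real b)))"
  have K56: "0 < K5" "0 \<le> K6" using l0_pos KE drift_pos L0 lnb
    by (auto simp: K5_def K6_def intro!: add_pos_nonneg)
  have "\<bar>R n k - 1 / sqrt (real k) * limit_const b\<bar> \<le> (C * (K5 + K6) / drift) * error_scale d n k"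
    if n: "1 \<le> n" and k: "1 \<le> k" "k \<le> n" for n k
  proof -
    define T where "T = (\<Sum>\<^sub>\<infinity>j\<in>{j. min (sqrt (real k)) (real (n - k)) \<le> real j}. d j)"
    have T0: "0 \<le> T" unfolding T_def by (intro infsum_nonneg d_nonneg)
    have R0: "0 < R n i" if "i \<le> n" for i using r_pos[OF n that] .
    have gb: "exp (gain n k - gain n i) \<le> exp L" if "i \<le> k" for i
      using gain_diff_total[OF n that k(2)] by (simp add: L_def)
    have g1: "\<bar>exp (gain n k - gain n i) - 1\<bar> \<le> exp L * (4 * ln (real b) * T) + (if real i < sqrt (real k) then exp L * L else 0)"
      if i: "i < k" for i
    proof -
      have gL: "\<bar>gain n k - gain n i\<bar> \<le> L" unfolding L_def using i k by (intro gain_diff_total n) auto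
      have "\<bar>exp (gain n k - gain n i) - 1\<bar> \<le> exp L * \<bar>gain n k - gain n i\<bar>"
        by (rule abs_exp_minus_1_le[OF gL])
      also have "\<dots> \<le> exp L * (4 * ln (real b) * T) + (if real i < sqrt (real k) then exp L * L else 0)"
      proof (cases "real i < sqrt (real k)")
        case True
        have "0 \<le> exp L * (4 * ln (real b) * T)" using lnb T0 by simp
        moreover have "exp L * \<bar>gain n k - gain n i\<bar> \<le> exp L * L" using gL by (intro mult_left_mono) auto
        ultimately have "exp L * \<bar>gain n k - gain n i\<bar> \<le> exp L * (4 * ln (real b) * T) + exp L * L"
          by linarith
        then show ?thesis using True by simp
      next
        case False
        have "(\<Sum>j\<in>{i<..k}. delta n j) \<le> 2 * T"
          unfolding T_def by (rule sum_delta_le_tail) (use False k in \<open>auto simp: min_le_iff_disj\<close>)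
        then have "2 * ln (real b) * (\<Sum>j\<in>{i<..k}. delta n j) \<le> 2 * ln (real b) * (2 * T)"
          using lnb by (intro mult_left_mono) auto
        then have "\<bar>gain n k - gain n i\<bar> \<le> 4 * ln (real b) * T"
          using gain_diff[OF n less_imp_le[OF i] k(2)] by linarith
        then have "exp L * \<bar>gain n k - gain n i\<bar> \<le> exp L * (4 * ln (real b) * T)"
          by (intro mult_left_mono) auto
        then show ?thesis using False by simp
      qed
      finally show ?thesis .
    qed
    define X where "X = 1 / (R n k)\<^sup>2"
    have "X - drift * k = exp (gain n k - gain n 0) / (R n 0)\<^sup>2 + (\<Sum>i<k. exp (gain n k - gain n i) * step_err n i)
       + drift * (\<Sum>i<k. exp (gain n k - gain n i) - 1)"
      unfolding X_def inverse_square_solution[OF n k(2)]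
    proof -
      have "exp (gain n k - gain n i) * (drift + step_err n i) =
        drift + exp (gain n k - gain n i) * step_err n i + drift * (exp (gain n k - gain n i) - 1)" for i
        by (simp add: algebra_simps)
      moreover have "gain n 0 = 0" by (simp add: gain_def)
      ultimately show "exp (gain n k) / (R n 0)\<^sup>2 + (\<Sum>i<k. exp (gain n k - gain n i) * (drift + step_err n i)) - drift * real k =
        exp (gain n k - gain n 0) / (R n 0)\<^sup>2 + (\<Sum>i<k. exp (gain n k - gain n i) * step_err n i)
         + drift * (\<Sum>i<k. exp (gain n k - gain n i) - 1)"
        by (simp only: sum.distrib sum_distrib_left[symmetric]) simp
    qed
    also have "\<bar>\<dots>\<bar> \<le> exp L / l0\<^sup>2 * sqrt (real k) + exp L * (KE * sqrt (real k))
       + drift * (real k * (exp L * (4 * ln (real b) * T)) + 2 * sqrt (real k) * (exp L * L))"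
    proof (intro order_trans[OF abs_triangle_ineq] add_mono)
      have "exp (gain n k - gain n 0) / (R n 0)\<^sup>2 \<le> exp L / l0\<^sup>2"
        using gb[of 0] init_lower[OF n] l0_pos by (intro frac_le power_mono) auto
      also have "\<dots> \<le> exp L / l0\<^sup>2 * sqrt (real k)"
        using mult_left_mono[of 1 "sqrt (real k)" "exp L / l0\<^sup>2"] k by simp
      finally show "\<bar>exp (gain n k - gain n 0) / (R n 0)\<^sup>2\<bar> \<le> exp L / l0\<^sup>2 * sqrt (real k)" by simp
      have "\<bar>\<Sum>i<k. exp (gain n k - gain n i) * step_err n i\<bar> \<le> (\<Sum>i<k. exp L * \<bar>step_err n i\<bar>)"
      proof (rule order_trans[OF sum_abs sum_mono])
        fix i assume "i \<in> {..<k}"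
        then have "exp (gain n k - gain n i) * \<bar>step_err n i\<bar> \<le> exp L * \<bar>step_err n i\<bar>"
          by (intro mult_right_mono gb) auto
        then show "\<bar>exp (gain n k - gain n i) * step_err n i\<bar> \<le> exp L * \<bar>step_err n i\<bar>" by (simp add: abs_mult)
      qed
      also have "\<dots> \<le> exp L * (KE * sqrt (real k))"
        using mult_left_mono[OF sE[OF n k(2,1)], of "exp L"] by (simp add: sum_distrib_left)
      finally show "\<bar>\<Sum>i<k. exp (gain n k - gain n i) * step_err n i\<bar> \<le> exp L * (KE * sqrt (real k))" .
      have "\<bar>\<Sum>i<k. exp (gain n k - gain n i) - 1\<bar> \<le>
        (\<Sum>i<k. exp L * (4 * ln (real b) * T) + (if real i < sqrt (real k) then exp L * L else 0))"
        by (rule order_trans[OF sum_abs sum_mono]) (use g1 in simp)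
      also have "\<dots> = real k * (exp L * (4 * ln (real b) * T)) + real (card {i\<in>{..<k}. real i < sqrt (real k)}) * (exp L * L)"
        by (simp add: sum.distrib sum.If_cases Int_def)
      also have "\<dots> \<le> real k * (exp L * (4 * ln (real b) * T)) + (2 * sqrt (real k)) * (exp L * L)"
      proof (rule add_left_mono, rule mult_right_mono)
        have "{i\<in>{..<k}. real i < sqrt (real k)} \<subseteq> {..nat \<lfloor>sqrt (real k)\<rfloor>}"
          by (auto simp: le_nat_floor)
        then have "card {i\<in>{..<k}. real i < sqrt (real k)} \<le> nat \<lfloor>sqrt (real k)\<rfloor> + 1"
          using card_mono[OF finite_atMost, of "{i\<in>{..<k}. real i < sqrt (real k)}" "nat \<lfloor>sqrt (real k)\<rfloor>"] by simp
        moreover have "real (nat \<lfloor>sqrt (real k)\<rfloor>) \<le> sqrt (real k)" by simp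
        moreover have "1 \<le> sqrt (real k)" using k by simp
        ultimately show "real (card {i\<in>{..<k}. real i < sqrt (real k)}) \<le> 2 * sqrt (real k)" by linarith
      qed (use L0 in auto)
      finally have "drift * \<bar>\<Sum>i<k. exp (gain n k - gain n i) - 1\<bar> \<le>
         drift * (real k * (exp L * (4 * ln (real b) * T)) + (2 * sqrt (real k)) * (exp L * L))"
        using drift_pos by (intro mult_left_mono) auto
      then show "\<bar>drift * (\<Sum>i<k. exp (gain n k - gain n i) - 1)\<bar> \<le>
         drift * (real k * (exp L * (4 * ln (real b) * T)) + 2 * sqrt (real k) * (exp L * L))"
        using drift_pos by (simp add: abs_mult)
    qed
    also have "\<dots> = K5 * sqrt (real k) + K6 * (real k * T)"
      by (simp add: K5_def K6_def distrib_right distrib_left mult_ac)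
    also have "\<dots> \<le> (K5 + K6) * (sqrt (real k) + real k * T)"
    proof -
      have "0 \<le> K6 * sqrt (real k)" "0 \<le> K5 * (real k * T)" using K56 T0 by simp_all
      then show ?thesis unfolding distrib_right distrib_left by linarith
    qed
    finally have X: "\<bar>X - drift * k\<bar> \<le> (K5 + K6) * (sqrt (real k) + real k * T)" .
    define y where "y = drift * real k"
    have y0: "0 < y" using drift_pos k by (simp add: y_def)
    have X0: "0 < X" and RX: "R n k = 1 / sqrt X" using R0[OF k(2)] by (auto simp: X_def real_sqrt_divide)
    have "1 / sqrt X - 1 / sqrt y = (y - X) / (sqrt X * sqrt y * (sqrt X + sqrt y))"
    proof -
      have "(sqrt y - sqrt X) * (sqrt X + sqrt y) = y - X" using X0 y0 by (simp add: algebra_simps)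
      moreover have "0 < sqrt X + sqrt y" using X0 y0 by (intro add_pos_pos) auto
      ultimately have "(y - X) / (sqrt X * sqrt y * (sqrt X + sqrt y)) = (sqrt y - sqrt X) / (sqrt X * sqrt y)"
        by (metis less_irrefl mult_divide_mult_cancel_right)
      also have "\<dots> = 1 / sqrt X - 1 / sqrt y" using X0 y0 by (simp add: diff_divide_distrib)
      finally show ?thesis ..
    qed
    then have "\<bar>R n k - 1 / sqrt y\<bar> = \<bar>X - y\<bar> / (sqrt X * sqrt y * (sqrt X + sqrt y))"
      using X0 y0 by (simp add: RX abs_divide abs_mult abs_minus_commute)
    also have "\<dots> \<le> \<bar>X - y\<bar> / (sqrt X * sqrt y * sqrt y)"
      proof (rule divide_left_mono)
      show "sqrt X * sqrt y * sqrt y \<le> sqrt X * sqrt y * (sqrt X + sqrt y)"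
        using X0 y0 by (intro mult_left_mono) simp_all
      show "0 < sqrt X * sqrt y * (sqrt X + sqrt y) * (sqrt X * sqrt y * sqrt y)"
        using X0 y0 by (simp add: add_pos_pos)
    qed simp
    also have "\<dots> = \<bar>X - y\<bar> * R n k / y" using y0 by (simp add: RX mult.assoc)
    also have "\<dots> \<le> (K5 + K6) * (sqrt (real k) + real k * T) * (C / sqrt (real k)) / y"
    proof (rule divide_right_mono, rule mult_mono)
      have "C / sqrt (1 + real k) \<le> C / sqrt (real k)" using C(1) k by (intro divide_left_mono) auto
      then show "R n k \<le> C / sqrt (real k)" using C(2)[OF n k(2)] by simp
    qed (use X K56 T0 R0[OF k(2)] y0 in \<open>auto simp: y_def\<close>)
    also have "\<dots> = (C * (K5 + K6) / drift) * error_scale d n k"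
    proof -
      have "error_scale d n k = (sqrt (real k) + real k * T) / (sqrt (real k) * real k)"
        unfolding error_scale_def T_def[symmetric] using k by (simp add: add_divide_distrib)
      then show ?thesis by (simp add: y_def mult_ac)
    qed
    also have "1 / sqrt y = 1 / sqrt (real k) * limit_const b"
      by (simp add: limit_const_eq y_def real_sqrt_mult)
    finally show ?thesis .
  qed
  moreover have "0 < C * (K5 + K6) / drift" using C(1) K56 drift_pos by (auto intro!: divide_pos_pos mult_pos_pos add_pos_nonneg)
  ultimately show ?thesis by (intro exI[of _ "C * (K5 + K6) / drift"]) auto
qed

end

section \<open>Series indexed by the integers\<close>

lemma sums_int_decode:
  fixes f :: "int \<Rightarrow> 'a :: banach"
  assumes "(\<lambda>q. norm (f q)) summable_on UNIV"
  shows "(\<lambda>i. f (int_decode i)) sums infsum f UNIV" "summable (\<lambda>i. norm (f (int_decode i)))"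
proof -
  have "(f has_sum infsum f UNIV) UNIV" using abs_summable_summable[OF assms] by (rule has_sum_infsum)
  then have "((\<lambda>i. f (int_decode i)) has_sum infsum f UNIV) UNIV"
    by (subst has_sum_reindex_bij_betw[OF bij_int_decode])
  then show "(\<lambda>i. f (int_decode i)) sums infsum f UNIV" by (rule has_sum_imp_sums)
  have "(\<lambda>i. norm (f (int_decode i))) summable_on UNIV"
    by (subst summable_on_reindex_bij_betw[OF bij_int_decode, of "\<lambda>q. norm (f q)"]) (rule assms)
  then show "summable (\<lambda>i. norm (f (int_decode i)))" by (rule summable_on_imp_summable)
qed

lemma infsum_eq_suminf_int_decode:
  fixes f :: "int \<Rightarrow> 'a :: banach"
  assumes "(\<lambda>q. norm (f q)) summable_on UNIV"
  shows "infsum f UNIV = (\<Sum>i. f (int_decode i))"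
  using sums_int_decode(1)[OF assms] by (simp add: sums_iff)

text \<open>Countable sums are interchanged with integrals after enumerating the integers by
  \<open>int_decode\<close>.\<close>

lemma integral_infsum_int:
  fixes f :: "int \<Rightarrow> 'b \<Rightarrow> 'a :: {banach, second_countable_topology}"
  assumes M: "finite_measure M" and f: "\<And>q. f q \<in> borel_measurable M"
    and le: "\<And>q x. norm (f q x) \<le> g q" and g: "g summable_on UNIV"
  shows "(LINT x|M. (\<Sum>\<^sub>\<infinity>q. f q x)) = (\<Sum>\<^sub>\<infinity>q. LINT x|M. f q x)"
    "integrable M (\<lambda>x. \<Sum>\<^sub>\<infinity>q. f q x)"
    "(\<lambda>q. norm (LINT x|M. f q x)) summable_on UNIV"
proof -
  interpret finite_measure M by (rule M)
  have int: "integrable M (f q)" for q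
    using f le by (intro integrable_const_bound[where B = "g q"]) auto
  have g0: "0 \<le> g q" for q using le[of q undefined] norm_ge_zero order_trans by blast
  have gs: "summable (\<lambda>i. g (int_decode i))"
    using sums_int_decode(2)[of g] g g0 by simp
  have ns: "(\<lambda>q. norm (f q x)) summable_on UNIV" for x
    by (rule summable_on_comparison_test[OF g]) (use le in auto)
  have nI: "norm (LINT x|M. f q x) \<le> g q * measure M (space M)" for q
  proof -
    have "norm (LINT x|M. f q x) \<le> (LINT x|M. norm (f q x))" by (rule integral_norm_bound)
    also have "\<dots> \<le> (LINT x|M. g q)" using int le by (intro integral_mono) auto
    finally show ?thesis by (simp add: mult.commute)
  qed
  show s: "(\<lambda>q. norm (LINT x|M. f q x)) summable_on UNIV"
    by (rule summable_on_comparison_test[OF summable_on_cmult_left[OF g] nI]) auto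
  have eq: "(\<Sum>\<^sub>\<infinity>q. f q x) = (\<Sum>i. f (int_decode i) x)" for x
    by (rule infsum_eq_suminf_int_decode[OF ns])
  have 1: "AE x in M. summable (\<lambda>i. norm (f (int_decode i) x))"
    using sums_int_decode(2)[OF ns] by simp
  have 2: "summable (\<lambda>i. LINT x|M. norm (f (int_decode i) x))"
  proof (rule summable_comparison_test)
    have "norm (LINT x|M. norm (f (int_decode i) x)) \<le> g (int_decode i) * measure M (space M)" for i
    proof -
      have "(LINT x|M. norm (f (int_decode i) x)) \<le> (LINT x|M. g (int_decode i))"
        using int le by (intro integral_mono) auto
      then show ?thesis by (simp add: mult.commute)
    qed
    then show "\<exists>N. \<forall>i\<ge>N. norm (LINT x|M. norm (f (int_decode i) x)) \<le> g (int_decode i) * measure M (space M)"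
      by blast
  qed (intro summable_mult2 gs)
  show "(LINT x|M. (\<Sum>\<^sub>\<infinity>q. f q x)) = (\<Sum>\<^sub>\<infinity>q. LINT x|M. f q x)"
    unfolding eq infsum_eq_suminf_int_decode[OF s] by (rule integral_suminf[OF int 1 2])
  show "integrable M (\<lambda>x. \<Sum>\<^sub>\<infinity>q. f q x)"
    unfolding eq by (rule integrable_suminf[OF int 1 2])
qed

lemma continuous_on_infsum_int:
  fixes f :: "int \<Rightarrow> 'b::topological_space \<Rightarrow> 'a :: banach"
  assumes "\<And>q. continuous_on S (f q)" and le: "\<And>q x. x \<in> S \<Longrightarrow> norm (f q x) \<le> g q" and g: "g summable_on UNIV"
  shows "continuous_on S (\<lambda>x. \<Sum>\<^sub>\<infinity>q. f q x)"
proof (cases "S = {}")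
  case False
  then have g0: "0 \<le> g q" for q using le[of _ q] norm_ge_zero order_trans by blast
  have gs: "summable (\<lambda>i. g (int_decode i))"
    using sums_int_decode(2)[of g] g g0 by simp
  have ns: "(\<lambda>q. norm (f q x)) summable_on UNIV" if "x \<in> S" for x
    by (rule summable_on_comparison_test[OF g]) (use le that in auto)
  have "uniform_limit S (\<lambda>n x. \<Sum>i<n. f (int_decode i) x) (\<lambda>x. \<Sum>i. f (int_decode i) x) sequentially"
    by (rule Weierstrass_m_test[OF le gs])
  then have "continuous_on S (\<lambda>x. \<Sum>i. f (int_decode i) x)"
    by (rule uniform_limit_theorem[rotated]) (auto intro!: continuous_intros assms always_eventually)
  then show ?thesis
    by (rule continuous_on_eq) (simp add: infsum_eq_suminf_int_decode[OF ns])
qed auto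

section \<open>Cosine series\<close>

definition cos_series :: "(int \<Rightarrow> real) \<Rightarrow> real \<Rightarrow> real" where
  "cos_series a z = (\<Sum>\<^sub>\<infinity>q. a q * cos (2 * pi * of_int q * z))"

definition exp_series :: "(int \<Rightarrow> real) \<Rightarrow> real \<Rightarrow> complex" where
  "exp_series a z = (\<Sum>\<^sub>\<infinity>q. of_real (a q) * cis (2 * pi * of_int q * z))"

lemma cos_term_summable:
  assumes "even_weight a"
  shows "(\<lambda>q. norm (a q * cos (2 * pi * of_int q * z))) summable_on UNIV"
  by (rule summable_on_comparison_test[OF even_weightD(3)[OF assms]])
    (auto simp: abs_mult even_weightD[OF assms] mult_left_le)

lemma exp_term_summable:
  assumes "even_weight a"
  shows "(\<lambda>q. norm (of_real (a q) * cis (2 * pi * of_int q * z))) summable_on UNIV"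
  using even_weightD(4)[OF assms] by (simp add: norm_mult)

text \<open>Products and Fourier coefficients are simpler for exponentials, derivatives and positivity for
  cosines; for even coefficients both series agree.\<close>

lemma exp_series_eq:
  assumes a: "even_weight a"
  shows "exp_series a z = of_real (cos_series a z)"
proof -
  have "cnj (exp_series a z) = (\<Sum>\<^sub>\<infinity>q. cnj (of_real (a q) * cis (2 * pi * of_int q * z)))"
    unfolding exp_series_def by (rule infsum_cnj[symmetric])
  also have "\<dots> = exp_series a z"
    unfolding exp_series_def
    by (rule infsum_reindex_bij_witness[where i = uminus and j = uminus])
      (auto simp: even_weightD(2)[OF a] cis_cnj)
  finally have "Im (exp_series a z) = 0" by (simp add: complex_eq_iff)
  moreover have "Re (exp_series a z) = cos_series a z"
    unfolding exp_series_def cos_series_def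
    by (subst infsum_Re[symmetric]) (auto intro: abs_summable_summable exp_term_summable[OF a])
  ultimately show ?thesis by (simp add: complex_eq_iff)
qed

lemma cos_series_conv:
  assumes a: "even_weight a" and c: "even_weight c"
  shows "cos_series (conv a c) z = cos_series a z * cos_series c z"
proof -
  let ?e = "\<lambda>q::int. cis (2 * pi * of_int q * z)"
  have "((\<lambda>q. \<Sum>\<^sub>\<infinity>p. of_real (a p) * ?e p * (of_real (c (q - p)) * ?e (q - p))) has_sum
      (exp_series a z * exp_series c z)) UNIV"
    unfolding exp_series_def
    by (rule convolution_has_sum[OF exp_term_summable[OF a] exp_term_summable[OF c]])
  moreover have "(\<Sum>\<^sub>\<infinity>p. of_real (a p) * ?e p * (of_real (c (q - p)) * ?e (q - p))) = of_real (conv a c q) * ?e q" for q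
  proof -
    have "?e p * ?e (q - p) = ?e q" for p by (simp add: cis_mult algebra_simps)
    then have "of_real (a p) * ?e p * (of_real (c (q - p)) * ?e (q - p)) = of_real (a p * c (q - p)) * ?e q" for p
      by (simp add: algebra_simps)
    then have "(\<Sum>\<^sub>\<infinity>p. of_real (a p) * ?e p * (of_real (c (q - p)) * ?e (q - p))) =
        (\<Sum>\<^sub>\<infinity>p. of_real (a p * c (q - p))) * ?e q"
      by (simp only: infsum_cmult_left')
    also have "(\<Sum>\<^sub>\<infinity>p. of_real (a p * c (q - p))) = (of_real (conv a c q) :: complex)"
      unfolding conv_def using conv_term_summable[OF a c]
      by (intro infsumI has_sum_of_real has_sum_infsum)
    finally show ?thesis .
  qed
  ultimately have "exp_series (conv a c) z = exp_series a z * exp_series c z"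
    by (simp add: exp_series_def[of "conv a c"] infsumI)
  then have "(of_real (cos_series (conv a c) z) :: complex) = of_real (cos_series a z * cos_series c z)"
    by (simp add: exp_series_eq a c even_weight_conv)
  then show ?thesis by (simp only: of_real_eq_iff)
qed

lemma cos_series_conv_pow:
  assumes a: "even_weight a"
  shows "cos_series (conv_pow a m) z = cos_series a z ^ m"
proof (induction m)
  case 0
  have "((\<lambda>q::int. (if q = 0 then 1 else 0) * cos (2 * pi * of_int q * z)) has_sum 1) UNIV"
    by (rule has_sum_finite_neutralI[where B = "{0}"]) auto
  then show ?case by (simp add: cos_series_def infsumI)
qed (simp add: cos_series_conv[OF a even_weight_conv_pow(1)[OF a]])

lemma cos_series_le: "even_weight a \<Longrightarrow> \<bar>cos_series a z\<bar> \<le> infsum a UNIV"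
  unfolding cos_series_def
  using norm_infsum_le[OF has_sum_infsum[OF abs_summable_summable[OF cos_term_summable]] has_sum_infsum, of a a z]
  by (auto simp: abs_mult even_weightD mult_left_le)

lemma cos_shift_int: "cos (2 * pi * of_int q * (z + of_int m)) = cos (2 * pi * of_int q * z)"
proof -
  have "2 * pi * of_int q * (z + of_int m) = 2 * pi * of_int q * z + 2 * pi * of_int (q * m)"
    by (simp add: algebra_simps)
  then show ?thesis
    using cos_integer_2pi[of "of_int (q * m)"] sin_integer_2pi[of "of_int (q * m)"]
    by (simp only: cos_add) simp
qed

lemma cos_series_periodic: "cos_series a (z + of_int m) = cos_series a z"
  by (simp only: cos_series_def cos_shift_int)

lemma continuous_on_cos_series: "even_weight a \<Longrightarrow> continuous_on S (cos_series a)"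
  unfolding cos_series_def[abs_def]
  by (rule continuous_on_infsum_int[where g = a])
    (auto intro!: continuous_intros simp: abs_mult even_weightD mult_left_le)

lemma integral_cis_unit_interval:
  "(LINT x:{0..1}|lborel. cis (2 * pi * of_int m * x)) = (if m = 0 then 1 else 0)"
proof (cases "m = 0")
  case True
  then show ?thesis by (simp add: set_lebesgue_integral_def)
next
  case False
  let ?c = "2 * of_real pi * \<i> * of_int m :: complex"
  have c: "?c \<noteq> 0" using False by simp
  have e: "exp (?c * of_real x) = cis (2 * pi * of_int m * x)" for x by (simp add: cis_conv_exp mult_ac)
  have "((\<lambda>x. cis (2 * pi * of_int m * x)) has_integral (exp (?c * of_real 1) / ?c - exp (?c * of_real 0) / ?c)) {0..1}"
  proof (rule fundamental_theorem_of_calculus)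
    fix x :: real
    have "((\<lambda>z. exp (?c * z) / ?c) has_field_derivative exp (?c * of_real x)) (at (of_real x))"
      using c by (auto intro!: derivative_eq_intros)
    then have "((\<lambda>x. exp (?c * of_real x) / ?c) has_vector_derivative exp (?c * of_real x)) (at x within {0..1})"
      by (rule has_vector_derivative_real_field)
    then show "((\<lambda>x. exp (?c * of_real x) / ?c) has_vector_derivative cis (2 * pi * of_int m * x)) (at x within {0..1})"
      by (simp only: e)
  qed auto
  moreover have "exp (?c * of_real 1) = 1"
    unfolding e using cos_integer_2pi[of "of_int m"] sin_integer_2pi[of "of_int m"] by (simp add: complex_eq_iff)
  ultimately have "integral {0..1} (\<lambda>x. cis (2 * pi * of_int m * x)) = 0" by (simp add: integral_unique)
  moreover have "(LINT x:{0..1}|lborel. cis (2 * pi * of_int m * x)) = integral {0..1} (\<lambda>x. cis (2 * pi * of_int m * x))"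
    by (intro set_borel_integral_eq_integral borel_integrable_atLeastAtMost' continuous_intros)
  ultimately show ?thesis using False by simp
qed

lemma cos_series_fourier_coeff:
  assumes a: "even_weight a"
  shows "(LINT z:{0..1}|lborel. of_real (cos_series a z) * cis (- (2 * pi * of_int q * z))) = of_real (a q)"
proof -
  have fin: "finite_measure (restrict_space lborel {0..1::real})"
    by (rule finite_measureI) (simp add: space_restrict_space emeasure_restrict_space)
  define f where "f p z = of_real (a p) * cis (2 * pi * of_int (p - q) * z)" for p :: int and z :: real
  have "of_real (cos_series a z) * cis (- (2 * pi * of_int q * z)) = (\<Sum>\<^sub>\<infinity>p. f p z)" for z
    unfolding exp_series_eq[OF a, symmetric] exp_series_def infsum_cmult_left'[symmetric]
    by (rule infsum_cong) (simp add: f_def cis_mult algebra_simps)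
  then have "(LINT z:{0..1}|lborel. of_real (cos_series a z) * cis (- (2 * pi * of_int q * z)))
      = (LINT z|restrict_space lborel {0..1}. (\<Sum>\<^sub>\<infinity>p. f p z))"
    by (simp add: integral_restrict_space set_lebesgue_integral_def)
  also have "\<dots> = (\<Sum>\<^sub>\<infinity>p. LINT z|restrict_space lborel {0..1}. f p z)"
    using even_weightD[OF a]
    by (intro integral_infsum_int[OF fin, where g = a] measurable_restrict_space1)
      (auto simp: f_def norm_mult intro!: borel_measurable_continuous_onI continuous_intros)
  also have "\<dots> = (\<Sum>\<^sub>\<infinity>p. if p = q then of_real (a q) else 0)"
  proof (rule infsum_cong)
    fix p
    have "(LINT z|restrict_space lborel {0..1}. f p z) = (LINT z:{0..1}|lborel. of_real (a p) * cis (2 * pi * of_int (p - q) * z))"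
      by (simp add: integral_restrict_space set_lebesgue_integral_def f_def)
    also have "\<dots> = of_real (a p) * (if p - q = 0 then 1 else 0)"
      by (subst set_integral_mult_right) (simp only: integral_cis_unit_interval)
    finally show "(LINT z|restrict_space lborel {0..1}. f p z) = (if p = q then of_real (a q) else 0)" by simp
  qed
  also have "\<dots> = of_real (a q)"
    by (rule infsumI, rule has_sum_finite_neutralI[where B = "{q}"]) auto
  finally show ?thesis .
qed

section \<open>Gaussian averages\<close>

lemma prob_space_centred_normal: "0 < t \<Longrightarrow> prob_space (centred_normal t)"
  unfolding centred_normal_def by (intro prob_space_normal_density) simp

lemma centred_normal_cos:
  assumes t: "0 < t"
  shows "(LINT x|centred_normal t. cos (w * (z + x))) = exp (- (w\<^sup>2 * t / 2)) * cos (w * z)"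
proof -
  interpret N: prob_space std_normal_distribution by (rule prob_space_normal_density) simp
  have "distributed std_normal_distribution lborel (\<lambda>x. 0 + sqrt t * x) (normal_density (0 + sqrt t * 0) (\<bar>sqrt t\<bar> * 1))"
    by (rule N.normal_density_affine) (use t in \<open>auto simp: distributed_def distr_id2\<close>)
  then have D: "centred_normal t = distr std_normal_distribution lborel (\<lambda>x. sqrt t * x)"
    using t by (simp add: distributed_distr_eq_density[symmetric] centred_normal_def distributed_def)
  have "(LINT x|centred_normal t. iexp (w * x)) = char std_normal_distribution (w * sqrt t)"
    unfolding D char_def by (subst integral_distr) (auto simp: mult_ac)
  also have "\<dots> = of_real (exp (- (w\<^sup>2 * t / 2)))"
    using t by (simp add: char_std_normal_distribution power_mult_distrib)
  finally have 1: "(LINT x|centred_normal t. iexp (w * x)) = of_real (exp (- (w\<^sup>2 * t / 2)))" .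
  interpret C: prob_space "centred_normal t" by (rule prob_space_centred_normal[OF t])
  have ci: "iexp y = cis y" for y by (simp add: cis_conv_exp)
  have i: "integrable (centred_normal t) (\<lambda>x. iexp (w * x))"
    by (rule C.integrable_const_bound[where B = 1]) (auto simp: centred_normal_def)
  have "(LINT x|centred_normal t. iexp (w * z) * iexp (w * x)) = iexp (w * z) * of_real (exp (- (w\<^sup>2 * t / 2)))"
    using i 1 by simp
  then have "Re (LINT x|centred_normal t. iexp (w * z) * iexp (w * x)) = Re (iexp (w * z) * of_real (exp (- (w\<^sup>2 * t / 2))))"
    by simp
  also have "Re (LINT x|centred_normal t. iexp (w * z) * iexp (w * x)) = (LINT x|centred_normal t. Re (iexp (w * z) * iexp (w * x)))"
    using i by (intro integral_Re[symmetric]) simp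
  also have "(\<lambda>x. Re (iexp (w * z) * iexp (w * x))) = (\<lambda>x. cos (w * (z + x)))"
    by (simp only: ci cis_mult cis.sel distrib_left)
  finally show ?thesis unfolding ci by (simp add: mult.commute)
qed

lemma centred_normal_cos_series:
  assumes a: "even_weight a" and t: "0 < t"
  shows "(LINT x|centred_normal t. cos_series a (z + x)) = cos_series (\<lambda>q. exp (- (2 * pi\<^sup>2 * (real_of_int q)\<^sup>2 * t)) * a q) z"
proof -
  interpret C: prob_space "centred_normal t" by (rule prob_space_centred_normal[OF t])
  have "(LINT x|centred_normal t. cos_series a (z + x)) = (\<Sum>\<^sub>\<infinity>q. LINT x|centred_normal t. a q * cos (2 * pi * of_int q * (z + x)))"
    unfolding cos_series_def
    by (rule integral_infsum_int[where g = a, OF C.finite_measure_axioms])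
      (auto simp: centred_normal_def abs_mult even_weightD[OF a] mult_left_le
        intro!: borel_measurable_continuous_onI continuous_intros)
  also have "\<dots> = cos_series (\<lambda>q. exp (- (2 * pi\<^sup>2 * (real_of_int q)\<^sup>2 * t)) * a q) z"
    unfolding cos_series_def
  proof (rule infsum_cong)
    fix q
    have "(2 * pi * of_int q)\<^sup>2 * t / 2 = 2 * pi\<^sup>2 * (of_int q)\<^sup>2 * t"
      by (simp add: power_mult_distrib)
    then show "(LINT x|centred_normal t. a q * cos (2 * pi * of_int q * (z + x))) =
        exp (- (2 * pi\<^sup>2 * (of_int q)\<^sup>2 * t)) * a q * cos (2 * pi * of_int q * z)"
      using centred_normal_cos[OF t, of "2 * pi * of_int q" z] by simp
  qed
  finally show ?thesis .
qed

lemma cos_series_integral: 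
  assumes a: "even_weight a"
  shows "(LINT z:{0..1}|lborel. cos_series a z) = a 0"
proof -
  have "of_real (LINT z:{0..1}|lborel. cos_series a z) = (of_real (a 0) :: complex)"
    using cos_series_fourier_coeff[OF a, of 0] by (simp add: set_integral_complex_of_real[symmetric])
  then show ?thesis by (simp only: of_real_eq_iff)
qed

text \<open>By periodicity \<open>z\<close> may be taken from the unit interval. The points of the unit interval are then
  at distance at most one from \<open>z\<close>, where the density is at least its value at \<open>1\<close>, and the series
  integrates to \<open>a 0\<close> over that interval.\<close>

lemma centred_normal_lower_bound:
  assumes a: "even_weight a" and t: "0 < t" and nn: "\<And>z. 0 \<le> cos_series a z"
  shows "normal_density 0 (sqrt t) 1 * a 0 \<le> (LINT x|centred_normal t. cos_series a (z + x))"
proof -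
  define w where "w = frac z"
  have w: "0 \<le> w" "w \<le> 1" using frac_lt_1[of z] by (auto simp: w_def less_imp_le)
  have zw: "cos_series a (z + x) = cos_series a (w + x)" for x
    using cos_series_periodic[of a "w + x" "\<lfloor>z\<rfloor>"] by (simp add: w_def frac_def algebra_simps)
  have F: "cos_series a \<in> borel_measurable borel"
    by (intro borel_measurable_continuous_onI continuous_on_cos_series a)
  then have m: "(\<lambda>x. cos_series a (w + x)) \<in> borel_measurable borel" by measurable
  have I1: "integrable lborel (\<lambda>x. normal_density 0 (sqrt t) x * cos_series a (w + x))"
  proof (rule Bochner_Integration.integrable_bound)
    show "integrable lborel (\<lambda>x. normal_density 0 (sqrt t) x * infsum a UNIV)" using t by simp
    show "AE x in lborel. norm (normal_density 0 (sqrt t) x * cos_series a (w + x)) \<le> norm (normal_density 0 (sqrt t) x * infsum a UNIV)"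
      using cos_series_le[OF a] by (auto simp: abs_mult intro!: mult_left_mono order_trans[OF _ abs_ge_self])
  qed (use m in simp)
  have "normal_density 0 (sqrt t) 1 * a 0 = (LINT x:{0..1}|lborel. normal_density 0 (sqrt t) 1 * cos_series a x)"
    by (simp add: cos_series_integral[OF a])
  also have "\<dots> = (LINT x|lborel. indicat_real {0..1} (w + x) * (normal_density 0 (sqrt t) 1 * cos_series a (w + x)))"
    unfolding set_lebesgue_integral_def by (subst lborel_integral_real_affine[of 1 _ w]) simp_all
  also have "\<dots> \<le> (LINT x|lborel. normal_density 0 (sqrt t) x * cos_series a (w + x))"
  proof (rule integral_mono'[OF I1])
    fix x :: real
    show "indicat_real {0..1} (w + x) * (normal_density 0 (sqrt t) 1 * cos_series a (w + x)) \<le> normal_density 0 (sqrt t) x * cos_series a (w + x)"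
    proof (cases "w + x \<in> {0..1}")
      case True
      then have "\<bar>x\<bar> \<le> 1" using w by auto
      then have "x\<^sup>2 \<le> 1" by (simp add: abs_square_le_1)
      then have "- (1 / (2 * t)) \<le> - (x\<^sup>2 / (2 * t))" using t by (simp add: divide_right_mono)
      then have "normal_density 0 (sqrt t) 1 \<le> normal_density 0 (sqrt t) x"
        using t by (simp add: normal_density_def divide_right_mono)
      then show ?thesis using True nn by (simp add: mult_right_mono)
    qed (use nn in simp)
    show "0 \<le> normal_density 0 (sqrt t) x * cos_series a (w + x)" using nn by simp
  qed
  also have "\<dots> = (LINT x|centred_normal t. cos_series a (z + x))"
    unfolding centred_normal_def zw using m by (subst integral_density) (auto simp: normal_density_nonneg)
  finally show ?thesis .
qed

section \<open>Uniqueness of Fourier coefficients\<close>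

text \<open>An even function of period one is a function \<open>h\<close> of \<open>cos (2 * pi * x)\<close>, and \<open>h\<close> is a uniform limit of
  polynomials. Powers of \<open>cos (2 * pi * x)\<close> are linear combinations of cosines, so \<open>f\<close> is
  orthogonal to these polynomials and therefore to itself.\<close>

lemma even_periodic_uniqueness:
  fixes f :: "real \<Rightarrow> real"
  assumes f: "continuous_on {0..1} f" and sym: "\<And>x. x \<in> {0..1} \<Longrightarrow> f (1 - x) = f x"
    and zero: "\<And>n::int. integral {0..1} (\<lambda>x. f x * cos (2 * pi * of_int n * x)) = 0"
    and x: "x \<in> {0..1}"
  shows "f x = 0"
proof -
  have ci: "(\<lambda>x. f x * g x) integrable_on {0..1}" if "continuous_on {0..1} g" for g
    using f that by (intro integrable_continuous_interval continuous_intros)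
  have pow: "integral {0..1} (\<lambda>x. f x * (cos (2 * pi * of_int n * x) * cos (2 * pi * x) ^ m)) = 0" for n m
  proof (induction m arbitrary: n)
    case (Suc m)
    have "f x * (cos (2 * pi * of_int n * x) * cos (2 * pi * x) ^ Suc m) =
      (f x * (cos (2 * pi * of_int (n + 1) * x) * cos (2 * pi * x) ^ m)
       + f x * (cos (2 * pi * of_int (n - 1) * x) * cos (2 * pi * x) ^ m)) / 2" for x
    proof -
      have "cos (2 * pi * of_int n * x) * cos (2 * pi * x) = (cos (2 * pi * of_int (n + 1) * x) + cos (2 * pi * of_int (n - 1) * x)) / 2"
      proof -
        have "2 * pi * of_int (n + 1) * x = 2 * pi * of_int n * x + 2 * pi * x"
          "2 * pi * of_int (n - 1) * x = 2 * pi * of_int n * x - 2 * pi * x" by (simp_all add: algebra_simps)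
        then show ?thesis by (simp only: cos_times_cos add.commute)
      qed
      then have "cos (2 * pi * of_int n * x) * cos (2 * pi * x) ^ Suc m =
        (cos (2 * pi * of_int (n + 1) * x) + cos (2 * pi * of_int (n - 1) * x)) / 2 * cos (2 * pi * x) ^ m"
        by (simp only: power_Suc mult.assoc[symmetric])
      then show ?thesis by (simp only:) (simp add: algebra_simps add_divide_distrib)
    qed
    moreover have "integral {0..1} (\<lambda>x. f x * (cos (2 * pi * of_int (n + 1) * x) * cos (2 * pi * x) ^ m)
       + f x * (cos (2 * pi * of_int (n - 1) * x) * cos (2 * pi * x) ^ m)) = 0"
      using Suc[of "n + 1"] Suc[of "n - 1"] by (subst integral_add) (auto intro!: ci continuous_intros)
    ultimately show ?case by (simp only: integral_divide)
  qed (simp add: zero)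
  have poly: "integral {0..1} (\<lambda>x. f x * p (cos (2 * pi * x))) = 0" if p: "real_polynomial_function p" for p
  proof -
    obtain c N where p: "p = (\<lambda>x. \<Sum>i\<le>N. c i * x ^ i)" using p real_polynomial_function_iff_sum by auto
    have "integral {0..1} (\<lambda>x. f x * p (cos (2 * pi * x))) = integral {0..1} (\<lambda>x. \<Sum>i\<le>(N::nat). c i * (f x * cos (2 * pi * x) ^ i))"
      by (simp add: p sum_distrib_left mult_ac)
    also have "\<dots> = (\<Sum>i\<le>N. c i * integral {0..1} (\<lambda>x. f x * cos (2 * pi * x) ^ i))"
      by (subst integral_sum) (auto intro!: integrable_continuous_interval continuous_intros f)
    also have "\<dots> = 0" using pow[of 0] by simp
    finally show ?thesis .
  qed
  define h where "h y = f (arccos y / (2 * pi))" for y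
  have h: "continuous_on {-1..1} h"
  proof -
    have "arccos y \<le> 2 * pi" if "y \<in> {-1..1}" for y
    proof -
      have "arccos y \<le> pi" using that by (intro arccos_ubound) auto
      then show ?thesis using pi_gt_zero by linarith
    qed
    then show ?thesis
      unfolding h_def
      by (intro continuous_on_compose2[OF f])
        (auto intro!: continuous_intros continuous_on_arccos' simp: divide_le_eq arccos_lbound)
  qed
  have hf: "h (cos (2 * pi * x)) = f x" if "x \<in> {0..1}" for x
  proof (cases "x \<le> 1 / 2")
    case True
    then have "arccos (cos (2 * pi * x)) = 2 * pi * x" using that by (intro arccos_cos) auto
    then show ?thesis by (simp add: h_def)
  next
    case False
    have "cos (2 * pi * x) = cos (2 * pi * (1 - x))" by (simp add: right_diff_distrib cos_diff)
    moreover have "arccos (cos (2 * pi * (1 - x))) = 2 * pi * (1 - x)"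
      using False that by (intro arccos_cos) auto
    ultimately show ?thesis using sym[OF that] by (simp add: h_def)
  qed
  have cf2: "continuous_on {0..1} (\<lambda>x. f x * f x)" by (intro continuous_intros f)
  define B where "B = integral {0..1} (\<lambda>x. \<bar>f x\<bar>)"
  have B0: "0 \<le> B" unfolding B_def by (intro integral_nonneg integrable_continuous_interval continuous_intros f) auto
  have "integral {0..1} (\<lambda>x. f x * f x) \<le> e" if e: "0 < e" for e
  proof -
    define e' where "e' = e / (B + 1)"
    have e': "0 < e'" using e B0 by (simp add: e'_def)
    obtain p where p: "real_polynomial_function p" "\<And>y. y \<in> {-1..1} \<Longrightarrow> \<bar>h y - p y\<bar> < e'"
      using Stone_Weierstrass_real_polynomial_function[OF _ h e'] by auto
    have pc: "continuous_on {0..1} (\<lambda>x. p (cos (2 * pi * x)))"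
      by (rule continuous_on_compose2[OF continuous_on_polymonial_function[of p UNIV]])
        (use p(1) in \<open>auto intro!: continuous_intros simp: real_polynomial_function_eq\<close>)
    have "integral {0..1} (\<lambda>x. f x * f x) = integral {0..1} (\<lambda>x. f x * f x) - integral {0..1} (\<lambda>x. f x * p (cos (2 * pi * x)))"
      using poly[OF p(1)] by simp
    also have "\<dots> = integral {0..1} (\<lambda>x. f x * f x - f x * p (cos (2 * pi * x)))"
      using ci[OF f] ci[OF pc] by (rule integral_diff[symmetric])
    also have "\<dots> \<le> integral {0..1} (\<lambda>x. e' * \<bar>f x\<bar>)"
    proof (rule integral_le)
      show "f x * f x - f x * p (cos (2 * pi * x)) \<le> e' * \<bar>f x\<bar>" if "x \<in> {0..1}" for x
      proof -
        have "\<bar>f x - p (cos (2 * pi * x))\<bar> \<le> e'" using p(2)[of "cos (2 * pi * x)"] hf[OF that] by auto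
        then have "\<bar>f x\<bar> * \<bar>f x - p (cos (2 * pi * x))\<bar> \<le> \<bar>f x\<bar> * e'" by (intro mult_left_mono) auto
        then show ?thesis by (simp add: right_diff_distrib flip: abs_mult) (simp add: mult.commute)
      qed
    qed (intro integrable_continuous_interval continuous_intros f pc)+
    also have "\<dots> = e' * B" by (simp add: B_def)
    also have "\<dots> \<le> e" using B0 e by (simp add: e'_def field_simps)
    finally show ?thesis .
  qed
  then have "integral {0..1} (\<lambda>x. f x * f x) \<le> 0" by (rule field_le_epsilon[where y = 0, simplified])
  moreover have "0 \<le> integral {0..1} (\<lambda>x. f x * f x)"
    by (intro integral_nonneg integrable_continuous_interval cf2) auto
  ultimately have "integral {0..1} (\<lambda>x. f x * f x) = 0" by simp
  then have "\<forall>x\<in>{0..1}. f x * f x = 0" using integral_eq_0_iff[OF cf2] by simp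
  then show ?thesis using x by auto
qed

section \<open>Unfolding integrals over periods\<close>

text \<open>This covers both the periodic measure \<open>\<nu>\<close> and Lebesgue measure.\<close>

definition unit_shift_invariant :: "real measure \<Rightarrow> bool" where
  "unit_shift_invariant M \<longleftrightarrow> sets M = sets borel \<and> (\<forall>A\<in>sets borel. emeasure M ((\<lambda>x. x + 1) ` A) = emeasure M A)"

lemma nn_integral_unit_shift:
  assumes M: "unit_shift_invariant M" and f: "f \<in> borel_measurable borel"
  shows "(\<integral>\<^sup>+x. f (x + of_int j) \<partial>M) = (\<integral>\<^sup>+x. f x \<partial>M)"
proof -
  have sM [measurable_cong]: "sets M = sets borel" using M by (simp add: unit_shift_invariant_def)
  have "distr M borel (\<lambda>x. x - 1) = M"
  proof (rule measure_eqI)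
    fix A assume A: "A \<in> sets (distr M borel (\<lambda>x. x - 1))"
    then have "emeasure (distr M borel (\<lambda>x. x - 1)) A = emeasure M ((\<lambda>x. x - 1) -` A \<inter> space M)"
      by (subst emeasure_distr) auto
    also have "(\<lambda>x. x - 1) -` A \<inter> space M = (\<lambda>x. x + 1) ` A"
      using sets_eq_imp_space_eq[OF sM] by (auto simp: image_iff) (metis diff_add_cancel)
    finally show "emeasure (distr M borel (\<lambda>x. x - 1)) A = emeasure M A"
      using M A by (simp add: unit_shift_invariant_def)
  qed (simp add: sM)
  then have one: "(\<integral>\<^sup>+x. g (x - 1) \<partial>M) = (\<integral>\<^sup>+x. g x \<partial>M)" if "g \<in> borel_measurable borel" for g
    using that nn_integral_distr[of "\<lambda>x. x - 1" M borel g] by simp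
  have "(\<integral>\<^sup>+x. f (x + of_int j) \<partial>M) = (\<integral>\<^sup>+x. f (x + of_int 0) \<partial>M)"
  proof (induction j rule: int_induct[where k = 0])
    case (step1 i)
    have "(\<lambda>x. f (x + of_int (i + 1))) \<in> borel_measurable borel" using f by measurable
    from one[OF this] show ?case using step1 by (simp add: algebra_simps)
  next
    case (step2 i)
    have "(\<lambda>x. f (x + of_int i)) \<in> borel_measurable borel" using f by measurable
    from one[OF this] show ?case using step2 by (simp add: algebra_simps)
  qed simp
  then show ?thesis by simp
qed

lemma nn_integral_unfold_periods:
  assumes M: "unit_shift_invariant M" and f: "f \<in> borel_measurable borel"
  shows "(\<integral>\<^sup>+x. f x \<partial>M) = (\<integral>\<^sup>+x. (\<Sum>i. f (x + of_int (int_decode i))) * indicator {0..<1} x \<partial>M)"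
proof -
  have sM [measurable_cong]: "sets M = sets borel" using M by (simp add: unit_shift_invariant_def)
  have ind: "(\<lambda>x::real. indicator {0..<1} (x - c) :: ennreal) \<in> borel_measurable borel" for c
    by measurable
  have "f x = (\<Sum>i. f x * indicator {0..<1} (x - of_int (int_decode i)))" for x
  proof -
    have "(\<Sum>i. f x * indicator {0..<1} (x - of_int (int_decode i))) =
      (\<Sum>i\<in>{int_encode \<lfloor>x\<rfloor>}. f x * indicator {0..<1} (x - of_int (int_decode i)))"
    proof (rule suminf_finite)
      fix i assume "i \<notin> {int_encode \<lfloor>x\<rfloor>}"
      then have "int_decode i \<noteq> \<lfloor>x\<rfloor>" by (metis int_decode_inverse singletonI)
      then have "x - of_int (int_decode i) \<notin> {0..<1}" using floor_unique[of "int_decode i" x] by auto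
      then show "f x * indicator {0..<1} (x - of_int (int_decode i)) = 0" by simp
    qed simp
    also have "\<dots> = f x"
      using frac_lt_1[of x] by (simp add: indicator_def) (auto simp: frac_def)
    finally show ?thesis ..
  qed
  then have "(\<integral>\<^sup>+x. f x \<partial>M) = (\<integral>\<^sup>+x. (\<Sum>i. f x * indicator {0..<1} (x - of_int (int_decode i))) \<partial>M)" by simp
  also have "\<dots> = (\<Sum>i. \<integral>\<^sup>+x. f x * indicator {0..<1} (x - of_int (int_decode i)) \<partial>M)"
    using f ind by (intro nn_integral_suminf) (simp add: measurable_cong_sets[OF sM refl])
  also have "\<dots> = (\<Sum>i. \<integral>\<^sup>+x. f (x + of_int (int_decode i)) * indicator {0..<1} x \<partial>M)"
  proof (rule suminf_cong)
    fix i
    have "(\<lambda>x. f x * indicator {0..<1} (x - of_int (int_decode i))) \<in> borel_measurable borel" using f by measurable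
    from nn_integral_unit_shift[OF M this, of "int_decode i"]
    show "(\<integral>\<^sup>+x. f x * indicator {0..<1} (x - of_int (int_decode i)) \<partial>M) = (\<integral>\<^sup>+x. f (x + of_int (int_decode i)) * indicator {0..<1} x \<partial>M)"
      by simp
  qed
  also have "\<dots> = (\<integral>\<^sup>+x. (\<Sum>i. f (x + of_int (int_decode i)) * indicator {0..<1} x) \<partial>M)"
  proof (intro nn_integral_suminf[symmetric])
    show "(\<lambda>x. f (x + of_int (int_decode i)) * indicator {0..<1} x) \<in> borel_measurable M" for i
      unfolding measurable_cong_sets[OF sM refl] using f by measurable
  qed
  finally show ?thesis by (simp add: ennreal_suminf_multc)
qed

lemma nn_integral_unfold_periods_real:
  fixes f :: "real \<Rightarrow> real"
  assumes M: "unit_shift_invariant M" and f: "f \<in> borel_measurable borel" and nn: "\<And>x. 0 \<le> f x"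
    and F: "\<And>x. x \<in> {0..<1} \<Longrightarrow> ((\<lambda>j. f (x + of_int j)) has_sum F x) UNIV"
  shows "(\<integral>\<^sup>+x. ennreal (f x) \<partial>M) = (\<integral>\<^sup>+x. ennreal (F x) * indicator {0..<1} x \<partial>M)"
proof -
  have "(\<Sum>i. ennreal (f (x + of_int (int_decode i)))) = ennreal (F x)" if "x \<in> {0..<1}" for x
  proof -
    have s: "(\<lambda>j. norm (f (x + of_int j))) summable_on UNIV" and F': "F x = (\<Sum>\<^sub>\<infinity>j. f (x + of_int j))"
      using F[OF that] nn by (auto simp: has_sum_iff)
    show ?thesis
      unfolding F' using sums_int_decode[OF s] nn by (intro suminf_ennreal_eq) auto
  qed
  then have "(\<Sum>i. ennreal (f (x + of_int (int_decode i)))) * indicator {0..<1} x = ennreal (F x) * indicator {0..<1} x" for x :: real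
    by (cases "x \<in> {0..<1}") auto
  then show ?thesis using nn_integral_unfold_periods[OF M, of f] f by simp
qed

section \<open>Poisson summation\<close>

definition gauss :: "real \<Rightarrow> real \<Rightarrow> real" where "gauss t x = exp (- (x\<^sup>2 / (2 * t)))"

definition theta_sum :: "real \<Rightarrow> real \<Rightarrow> real" where
  "theta_sum t x = (\<Sum>\<^sub>\<infinity>j. gauss t (x + of_int j))"

text \<open>The Fourier transform of \<open>gauss t\<close> at the integers.\<close>

definition theta_coeff :: "real \<Rightarrow> int \<Rightarrow> real" where
  "theta_coeff t q = sqrt (2 * pi * t) * exp (- (2 * pi\<^sup>2 * (real_of_int q)\<^sup>2 * t))"

lemma theta_sum_bound:
  assumes t: "0 < t"
  obtains G where "G summable_on UNIV" "\<And>x j. x \<in> {0..1} \<Longrightarrow> norm (gauss t (x + of_int j)) \<le> G j"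
proof
  define G where "G j = exp (1 / t) * exp (- (1 / (2 * t))) ^ nat \<bar>j\<bar>" for j :: int
  have "summable (\<lambda>m. exp (1 / t) * exp (- (1 / (2 * t))) ^ m)"
    using t by (intro summable_mult summable_geometric) simp
  then show "G summable_on UNIV" unfolding G_def by (rule summable_on_nat_abs) simp
  fix x :: real and j :: int assume x: "x \<in> {0..1}"
  \<comment> \<open>A linear lower bound of the square makes the majorant geometric.\<close>
  have "real_of_int \<bar>j\<bar> - 2 \<le> (x + of_int j)\<^sup>2"
  proof (cases "0 \<le> j")
    case True
    have "of_int \<bar>j\<bar> - 1 \<le> (of_int j :: real)\<^sup>2"
      using True zero_le_power2[of "of_int j - 1 :: real"] by (simp add: power2_eq_square algebra_simps)
    also have "\<dots> \<le> (x + of_int j)\<^sup>2" using True x by (intro power_mono) auto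
    finally show ?thesis by simp
  next
    case False
    define m where "m = - of_int j - (1::real)"
    have m: "0 \<le> m" using False by (simp add: m_def)
    have "m - 1 \<le> m\<^sup>2" using zero_le_power2[of "m - 1"] m by (simp add: power2_eq_square algebra_simps)
    also have "\<dots> \<le> (- (x + of_int j))\<^sup>2" using m x by (intro power_mono) (auto simp: m_def)
    also have "\<dots> = (x + of_int j)\<^sup>2" by (rule power2_minus)
    finally show ?thesis using False by (simp add: m_def)
  qed
  then have "(real_of_int \<bar>j\<bar> - 2) / (2 * t) \<le> (x + of_int j)\<^sup>2 / (2 * t)"
    using t by (intro divide_right_mono) auto
  then have "gauss t (x + of_int j) \<le> exp (1 / t + of_nat (nat \<bar>j\<bar>) * - (1 / (2 * t)))"
  proof -
    have "1 / t + of_nat (nat \<bar>j\<bar>) * - (1 / (2 * t)) = - ((real_of_int \<bar>j\<bar> - 2) / (2 * t))"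
      using t by (simp add: field_simps)
    then show ?thesis using \<open>(real_of_int \<bar>j\<bar> - 2) / (2 * t) \<le> (x + of_int j)\<^sup>2 / (2 * t)\<close>
      by (simp only: gauss_def exp_le_cancel_iff neg_le_iff_le)
  qed
  also have "\<dots> = G j" by (simp only: G_def exp_add exp_of_nat_mult)
  finally show "norm (gauss t (x + of_int j)) \<le> G j" by (simp add: gauss_def)
qed

lemma
  assumes t: "0 < t"
  shows continuous_on_theta_sum: "continuous_on {0..1} (theta_sum t)"
    and gauss_summable: "x \<in> {0..1} \<Longrightarrow> (\<lambda>j. gauss t (x + of_int j)) summable_on UNIV"
proof -
  obtain G where G: "G summable_on UNIV" "\<And>x j. x \<in> {0..1} \<Longrightarrow> norm (gauss t (x + of_int j)) \<le> G j"
    using theta_sum_bound[OF t] by blast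
  show "continuous_on {0..1} (theta_sum t)"
    unfolding theta_sum_def[abs_def]
    by (rule continuous_on_infsum_int[OF _ G(2,1)]) (use t in \<open>auto simp: gauss_def intro!: continuous_intros\<close>)
  show "(\<lambda>j. gauss t (x + of_int j)) summable_on UNIV" if "x \<in> {0..1}"
    by (rule summable_on_comparison_test[OF G(1)]) (use G(2)[OF that] in \<open>auto simp: gauss_def\<close>)
qed

lemma theta_sum_shift: "theta_sum t (x + of_int m) = theta_sum t x"
  unfolding theta_sum_def
  by (rule infsum_reindex_bij_witness[where i = "\<lambda>j. j - m" and j = "\<lambda>j. j + m"]) (auto simp: algebra_simps)

lemma theta_sum_minus: "theta_sum t (- x) = theta_sum t x"
  unfolding theta_sum_def
proof (rule infsum_reindex_bij_witness[where i = uminus and j = uminus])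
  show "gauss t (x + of_int (- j)) = gauss t (- x + of_int j)" for j
    by (simp add: gauss_def power2_commute)
qed auto

lemma even_weight_theta_coeff:
  assumes t: "0 < t" shows "even_weight (theta_coeff t)"
proof -
  define th where "th = exp (- (2 * pi\<^sup>2 * t))"
  have th: "0 < th" "th < 1" using t by (auto simp: th_def)
  \<comment> \<open>This is \<open>q\<^sup>2 = \<bar>q\<bar> + \<bar>q\<bar> * (\<bar>q\<bar> - 1)\<close>.\<close>
  have eq: "exp (- (2 * pi\<^sup>2 * (real_of_int q)\<^sup>2 * t)) = gauss_weight th th q" for q
  proof -
    have "nat \<bar>q\<bar> + nat \<bar>q\<bar> * (nat \<bar>q\<bar> - 1) = nat \<bar>q\<bar> * nat \<bar>q\<bar>" by (cases "nat \<bar>q\<bar>") auto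
    then have "gauss_weight th th q = th ^ (nat \<bar>q\<bar> * nat \<bar>q\<bar>)"
      by (simp only: gauss_weight_def power_add[symmetric])
    also have "\<dots> = exp (real (nat \<bar>q\<bar> * nat \<bar>q\<bar>) * - (2 * pi\<^sup>2 * t))" by (simp only: th_def exp_of_nat_mult)
    also have "real (nat \<bar>q\<bar> * nat \<bar>q\<bar>) = (real_of_int q)\<^sup>2" by (simp add: power2_eq_square)
    finally show ?thesis by (simp add: mult_ac)
  qed
  have "(\<lambda>q. sqrt (2 * pi * t) * gauss_weight th th q) summable_on UNIV"
    using gauss_weight_summable[OF th, of th 0] th by (intro summable_on_cmult_right) simp
  then show ?thesis using t by (simp add: even_weight_def theta_coeff_def[abs_def] eq[symmetric])
qed

lemma unit_shift_invariant_lborel: "unit_shift_invariant lborel"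
  unfolding unit_shift_invariant_def
proof (intro conjI ballI)
  fix A :: "real set" assume A: "A \<in> sets borel"
  have "(\<lambda>x. x + 1) ` A = (+) (-1) -` A \<inter> space lborel" by (auto simp: image_iff) (metis add.commute diff_add_cancel diff_conv_add_uminus)
  then have "emeasure lborel ((\<lambda>x. x + 1) ` A) = emeasure (distr lborel borel ((+) (-1))) A"
    using A by (simp add: emeasure_distr)
  then show "emeasure lborel ((\<lambda>x. x + 1) ` A) = emeasure lborel A" by (simp add: lborel_distr_plus)
qed simp

lemma nn_integral_unit_interval:
  fixes h :: "real \<Rightarrow> real"
  assumes h: "continuous_on {0..1} h" and nn: "\<And>x. x \<in> {0..1} \<Longrightarrow> 0 \<le> h x"
  shows "(\<integral>\<^sup>+x. ennreal (h x) * indicator {0..<1} x \<partial>lborel) = ennreal (integral {0..1} h)"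
proof -
  have i: "set_integrable lborel {0..1} h" by (rule borel_integrable_atLeastAtMost'[OF h])
  have "(\<integral>\<^sup>+x. ennreal (h x) * indicator {0..<1} x \<partial>lborel) = (\<integral>\<^sup>+x. ennreal (indicator {0..1} x *\<^sub>R h x) \<partial>lborel)"
    using AE_lborel_singleton[of "1::real"]
    by (intro nn_integral_cong_AE) (auto split: split_indicator)
  also have "\<dots> = ennreal (LINT x:{0..1}|lborel. h x)"
    unfolding set_lebesgue_integral_def using i nn
    by (intro nn_integral_eq_integral) (auto simp: set_integrable_def split: split_indicator)
  also have "(LINT x:{0..1}|lborel. h x) = integral {0..1} h"
    by (rule set_borel_integral_eq_integral(2)[OF i])
  finally show ?thesis .
qed

lemma gauss_eq_density: "0 < t \<Longrightarrow> gauss t x = sqrt (2 * pi * t) * normal_density 0 (sqrt t) x"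
  by (simp add: gauss_def normal_density_def)

text \<open>Unfolding the integral over one period turns it into a Gaussian integral over the line. The
  factor \<open>1 + cos\<close> keeps the integrand nonnegative, as the unfolding concerns nonnegative
  functions; the contribution of the \<open>1\<close> is removed at the end.\<close>

lemma theta_sum_fourier:
  assumes t: "0 < t"
  shows "integral {0..1} (\<lambda>x. theta_sum t x * cos (2 * pi * of_int n * x)) = theta_coeff t n"
proof -
  have plus: "integral {0..1} (\<lambda>x. theta_sum t x * (1 + cos (2 * pi * of_int n * x))) = theta_coeff t 0 + theta_coeff t n" for n
  proof -
    interpret C: prob_space "centred_normal t" by (rule prob_space_centred_normal[OF t])
    let ?c = "\<lambda>x. 1 + cos (2 * pi * of_int n * x)"
    have c0: "0 \<le> ?c x" for x using cos_ge_minus_one[of "2 * pi * of_int n * x"] by linarith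
    have ic: "integrable (centred_normal t) (\<lambda>x. cos (2 * pi * of_int n * (0 + x)))"
      by (rule C.integrable_const_bound[where B = 1]) (auto simp: centred_normal_def)
    have th0: "0 \<le> theta_sum t x" for x unfolding theta_sum_def by (intro infsum_nonneg) (simp add: gauss_def)
    have "(\<integral>\<^sup>+x. ennreal (theta_sum t x * ?c x) * indicator {0..<1} x \<partial>lborel) = (\<integral>\<^sup>+x. ennreal (gauss t x * ?c x) \<partial>lborel)"
    proof (rule nn_integral_unfold_periods_real[of lborel "\<lambda>x. gauss t x * ?c x" "\<lambda>x. theta_sum t x * ?c x", symmetric, OF unit_shift_invariant_lborel])
      show "(\<lambda>x. gauss t x * ?c x) \<in> borel_measurable borel" unfolding gauss_def by measurable
      fix x :: real assume x: "x \<in> {0..<1}"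
      show "((\<lambda>j. gauss t (x + of_int j) * ?c (x + of_int j)) has_sum theta_sum t x * ?c x) UNIV"
        unfolding cos_shift_int theta_sum_def using gauss_summable[OF t, of x] x
        by (auto intro!: has_sum_cmult_left)
    qed (use c0 in \<open>auto simp: gauss_def\<close>)
    also have "\<dots> = (\<integral>\<^sup>+x. ennreal (normal_density 0 (sqrt t) x) * ennreal (sqrt (2 * pi * t) * ?c x) \<partial>lborel)"
      using t c0 by (intro nn_integral_cong) (simp add: gauss_eq_density ennreal_mult[symmetric] mult_ac normal_density_nonneg)
    also have "\<dots> = (\<integral>\<^sup>+x. ennreal (sqrt (2 * pi * t) * ?c x) \<partial>centred_normal t)"
      unfolding centred_normal_def by (subst nn_integral_density) auto
    also have "\<dots> = ennreal (LINT x|centred_normal t. sqrt (2 * pi * t) * ?c x)"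
      using ic t c0 by (intro nn_integral_eq_integral) auto
    also have "(LINT x|centred_normal t. sqrt (2 * pi * t) * ?c x) = theta_coeff t 0 + theta_coeff t n"
    proof -
      have "(2 * pi * of_int n)\<^sup>2 * t / 2 = 2 * pi\<^sup>2 * (of_int n)\<^sup>2 * t" by (simp add: power_mult_distrib)
      then have "(LINT x|centred_normal t. ?c x) = 1 + exp (- (2 * pi\<^sup>2 * (of_int n)\<^sup>2 * t))"
        using ic centred_normal_cos[OF t, of "2 * pi * of_int n" 0] C.prob_space by simp
      then show ?thesis by (simp only: integral_mult_right_zero) (simp add: theta_coeff_def distrib_left)
    qed
    finally have "ennreal (integral {0..1} (\<lambda>x. theta_sum t x * ?c x)) = ennreal (theta_coeff t 0 + theta_coeff t n)"
    proof -
      have "continuous_on {0..1} (\<lambda>x. theta_sum t x * ?c x)"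
        by (intro continuous_intros continuous_on_theta_sum t)
      from nn_integral_unit_interval[OF this] show ?thesis if "(\<integral>\<^sup>+x. ennreal (theta_sum t x * ?c x) * indicator {0..<1} x \<partial>lborel) = ennreal (theta_coeff t 0 + theta_coeff t n)"
        using that th0 c0 by simp
    qed
    moreover have "0 \<le> integral {0..1} (\<lambda>x. theta_sum t x * ?c x)"
      using th0 c0 by (intro integral_nonneg integrable_continuous_interval continuous_intros continuous_on_theta_sum t) auto
    moreover have "0 \<le> theta_coeff t 0 + theta_coeff t n" using t by (simp add: theta_coeff_def)
    ultimately show ?thesis by simp
  qed
  have i: "(\<lambda>x. theta_sum t x * cos (2 * pi * of_int m * x)) integrable_on {0..1}" for m :: int
    by (intro integrable_continuous_interval continuous_intros continuous_on_theta_sum t)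
  have th: "theta_sum t integrable_on {0..1}" by (intro integrable_continuous_interval continuous_on_theta_sum t)
  have "integral {0..1} (theta_sum t) = theta_coeff t 0" using plus[of 0] by simp
  moreover have "integral {0..1} (\<lambda>x. theta_sum t x * (1 + cos (2 * pi * of_int n * x))) =
      integral {0..1} (theta_sum t) + integral {0..1} (\<lambda>x. theta_sum t x * cos (2 * pi * of_int n * x))"
    using integral_add[OF th i[of n]] by (simp add: distrib_left)
  ultimately show ?thesis using plus[of n] by simp
qed

lemma cos_series_cos_coeff:
  assumes a: "even_weight a"
  shows "integral {0..1} (\<lambda>x. cos_series a x * cos (2 * pi * of_int n * x)) = a n"
proof -
  let ?h = "\<lambda>x. complex_of_real (cos_series a x) * cis (- (2 * pi * of_int n * x))"
  have i: "set_integrable lborel {0..1} ?h"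
    by (intro borel_integrable_atLeastAtMost' continuous_intros continuous_on_cos_series a)
  have "a n = Re (LINT x:{0..1}|lborel. ?h x)" by (simp only: cos_series_fourier_coeff[OF a] Re_complex_of_real)
  also have "\<dots> = Re (integral {0..1} ?h)" by (simp only: set_borel_integral_eq_integral(2)[OF i])
  also have "\<dots> = integral {0..1} (\<lambda>x. Re (?h x))"
    using integral_linear[OF set_borel_integral_eq_integral(1)[OF i] bounded_linear_Re] by (simp add: o_def)
  finally show ?thesis by simp
qed

lemma theta_poisson:
  assumes t: "0 < t"
  shows "theta_sum t x = cos_series (theta_coeff t) x"
proof -
  note ev = even_weight_theta_coeff[OF t]
  define f where "f x = theta_sum t x - cos_series (theta_coeff t) x" for x
  have "f x = 0" if "x \<in> {0..1}" for x
  proof (rule even_periodic_uniqueness[OF _ _ _ that])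
    show "continuous_on {0..1} f"
      unfolding f_def by (intro continuous_intros continuous_on_theta_sum continuous_on_cos_series ev t)
    have "cos_series (theta_coeff t) (- x) = cos_series (theta_coeff t) x" for x
      by (simp add: cos_series_def)
    then show "f (1 - x) = f x" for x
      using theta_sum_shift[of t "- x" 1] theta_sum_minus[of t x] cos_series_periodic[of "theta_coeff t" "- x" 1]
      by (simp add: f_def)
    show "integral {0..1} (\<lambda>x. f x * cos (2 * pi * of_int n * x)) = 0" for n
      unfolding f_def left_diff_distrib
      by (subst integral_diff) (auto simp: theta_sum_fourier[OF t] cos_series_cos_coeff[OF ev]
        intro!: integrable_continuous_interval continuous_intros continuous_on_theta_sum continuous_on_cos_series ev t)
  qed
  from this[of "frac x"] have "f (frac x) = 0" using frac_lt_1[of x] by (simp add: less_imp_le)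
  moreover have "x = frac x + of_int \<lfloor>x\<rfloor>" by (simp add: frac_def)
  ultimately show ?thesis
    using theta_sum_shift[of t "frac x" "\<lfloor>x\<rfloor>"] cos_series_periodic[of "theta_coeff t" "frac x" "\<lfloor>x\<rfloor>"]
    by (simp add: f_def)
qed

section \<open>The initial potential\<close>

lemma gauss_summable_all:
  assumes t: "0 < t" shows "((\<lambda>j. gauss t (x + of_int j)) has_sum theta_sum t x) UNIV"
proof -
  have "(\<lambda>j. gauss t (frac x + of_int j)) summable_on UNIV"
    using frac_lt_1[of x] by (intro gauss_summable t) (simp add: less_imp_le)
  moreover have "(\<lambda>j. gauss t (frac x + of_int j)) summable_on UNIV \<longleftrightarrow> (\<lambda>j. gauss t (x + of_int j)) summable_on UNIV"
    by (rule summable_on_reindex_bij_witness[where i = "\<lambda>j. j + \<lfloor>x\<rfloor>" and j = "\<lambda>j. j - \<lfloor>x\<rfloor>"])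
      (auto simp: frac_def algebra_simps)
  ultimately show ?thesis unfolding theta_sum_def by (intro has_sum_infsum) simp
qed

lemma theta_sum_lower: "0 < t \<Longrightarrow> exp (- (1 / (2 * t))) \<le> theta_sum t x"
proof -
  assume t: "0 < t"
  have "exp (- (1 / (2 * t))) \<le> gauss t (x + of_int (- \<lfloor>x\<rfloor>))"
  proof -
    have "(frac x)\<^sup>2 \<le> 1" using frac_lt_1[of x] by (simp add: abs_square_le_1 less_imp_le)
    then have "(frac x)\<^sup>2 / (2 * t) \<le> 1 / (2 * t)" using t by (intro divide_right_mono) auto
    then show ?thesis by (simp add: gauss_def frac_def)
  qed
  also have "\<dots> \<le> theta_sum t x"
    using finite_sum_le_has_sum[OF gauss_summable_all[OF t, of x], of "{- \<lfloor>x\<rfloor>}"] by (simp add: gauss_def)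
  finally show ?thesis .
qed

lemma positive_fourier_measureD:
  assumes "positive_fourier_measure \<nu>"
  shows "sets \<nu> = sets borel" "unit_shift_invariant \<nu>" "finite_measure (restrict_space \<nu> {0..<1})"
    "Im (fourier_coeff \<nu> q) = 0" "0 < Re (fourier_coeff \<nu> q)" "fourier_coeff \<nu> (- q) = fourier_coeff \<nu> q"
proof -
  note a = assms[unfolded positive_fourier_measure_def periodic_radon_measure_def]
  show s: "sets \<nu> = sets borel" and "unit_shift_invariant \<nu>" "0 < Re (fourier_coeff \<nu> q)"
    "fourier_coeff \<nu> (- q) = fourier_coeff \<nu> q"
    using a by (auto simp: unit_shift_invariant_def)
  show "Im (fourier_coeff \<nu> q) = 0" using a by (auto simp: complex_is_Real_iff)
  have "emeasure \<nu> {0..<1} \<le> emeasure \<nu> {0..1}" using s by (intro emeasure_mono) auto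
  also have "\<dots> < \<infinity>" using a by auto
  finally show "finite_measure (restrict_space \<nu> {0..<1})"
    using s sets_eq_imp_space_eq[OF s] by (intro finite_measureI) (auto simp: space_restrict_space emeasure_restrict_space)
qed

lemma fourier_coeff_trig:
  assumes "positive_fourier_measure \<nu>"
  shows "(LINT x|restrict_space \<nu> {0..<1}. cos (2 * pi * of_int q * x)) = Re (fourier_coeff \<nu> q)"
    "(LINT x|restrict_space \<nu> {0..<1}. sin (2 * pi * of_int q * x)) = 0"
    "Re (fourier_coeff \<nu> q) \<le> Re (fourier_coeff \<nu> 0)"
proof -
  note nu = positive_fourier_measureD[OF assms]
  let ?N = "restrict_space \<nu> {0..<1::real}"
  interpret N: finite_measure ?N by (rule nu)
  have mN: "g \<in> borel_measurable ?N" if "g \<in> borel_measurable borel" for g :: "real \<Rightarrow> 'c::topological_space"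
    using that by (intro measurable_restrict_space1) (simp add: measurable_cong_sets[OF nu(1) refl])
  have fc: "fourier_coeff \<nu> q = (LINT x|?N. cis (- (2 * pi * of_int q * x)))" for q
    unfolding fourier_coeff_def set_lebesgue_integral_def
    using nu(1) sets_eq_imp_space_eq[OF nu(1)]
    by (subst integral_restrict_space) (auto simp: cis_conv_exp mult_ac)
  have i: "integrable ?N (\<lambda>x. cis (- (2 * pi * of_int q * x)))" for q
    by (rule N.integrable_const_bound[where B = 1])
      (auto intro!: mN borel_measurable_continuous_onI continuous_intros)
  show c: "(LINT x|?N. cos (2 * pi * of_int q * x)) = Re (fourier_coeff \<nu> q)" for q
    unfolding fc integral_Re[OF i, symmetric] by simp
  have "(LINT x|?N. - sin (2 * pi * of_int q * x)) = Im (fourier_coeff \<nu> q)"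
    unfolding fc integral_Im[OF i, symmetric] by simp
  then show "(LINT x|?N. sin (2 * pi * of_int q * x)) = 0" using nu(4)[of q] by simp
  have "(LINT x|?N. cos (2 * pi * of_int q * x)) \<le> (LINT x|?N. 1)"
    by (intro integral_mono N.integrable_const_bound[where B = 1])
      (auto intro!: mN borel_measurable_continuous_onI continuous_intros)
  then show "Re (fourier_coeff \<nu> q) \<le> Re (fourier_coeff \<nu> 0)" using c[of q] c[of 0] by simp
qed

definition initial_weight :: "real measure \<Rightarrow> real \<Rightarrow> int \<Rightarrow> real" where
  "initial_weight \<nu> t q = theta_coeff t q * Re (fourier_coeff \<nu> q)"

lemma even_weight_initial:
  assumes nu: "positive_fourier_measure \<nu>" and t: "0 < t"
  shows "even_weight (initial_weight \<nu> t)"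
  unfolding even_weight_def
proof (intro conjI allI)
  note pm = positive_fourier_measureD[OF nu] and ev = even_weight_theta_coeff[OF t]
  show "0 \<le> initial_weight \<nu> t q" for q
    using pm(5)[of q] even_weightD(1)[OF ev, of q] by (simp add: initial_weight_def)
  show "initial_weight \<nu> t (- q) = initial_weight \<nu> t q" for q
    using pm(6)[of q] even_weightD(2)[OF ev, of q] by (simp add: initial_weight_def)
  show "initial_weight \<nu> t summable_on UNIV"
    unfolding initial_weight_def
    using fourier_coeff_trig(3)[OF nu] pm(5) even_weightD(1)[OF ev]
    by (intro summable_on_comparison_test[OF summable_on_cmult_left[OF even_weightD(3)[OF ev], of "Re (fourier_coeff \<nu> 0)"]])
      (auto intro!: mult_left_mono simp: less_imp_le)
qed

text \<open>Unfolding the integral over \<open>\<nu>\<close> replaces the Gaussian by its periodization \<open>theta_sum t\<close>. Its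
  cosine series is integrated term by term over one period of \<open>\<nu>\<close>; the sine parts vanish because
  the Fourier coefficients of \<open>\<nu>\<close> are real.\<close>

lemma initial_potential:
  assumes nu: "positive_fourier_measure \<nu>" and t: "0 < t"
  shows "(LINT \<zeta>|\<nu>. gauss t (z - \<zeta>)) = cos_series (initial_weight \<nu> t) z"
    "exp (- (1 / (2 * t))) * Re (fourier_coeff \<nu> 0) \<le> cos_series (initial_weight \<nu> t) z"
proof -
  note pm = positive_fourier_measureD[OF nu] and ev = even_weight_theta_coeff[OF t]
  let ?N = "restrict_space \<nu> {0..<1::real}"
  interpret N: finite_measure ?N by (rule pm)
  have mN: "g \<in> borel_measurable ?N" if "g \<in> borel_measurable borel" for g :: "real \<Rightarrow> real"
    using that by (intro measurable_restrict_space1) (simp add: measurable_cong_sets[OF pm(1) refl])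
  have sp: "space \<nu> = UNIV" using sets_eq_imp_space_eq[OF pm(1)] by simp
  have th: "theta_sum t (x - z) = cos_series (theta_coeff t) (x - z)" for x by (rule theta_poisson[OF t])
  have mth: "(\<lambda>x. theta_sum t (x - z)) \<in> borel_measurable borel"
    unfolding th by (intro borel_measurable_continuous_onI continuous_on_compose2[OF continuous_on_cos_series[OF ev, of UNIV]] continuous_intros) auto
  have th0: "0 \<le> theta_sum t x" for x using theta_sum_lower[OF t, of x] exp_ge_zero order_trans by blast
  have mg: "(\<lambda>\<zeta>. gauss t (z - \<zeta>)) \<in> borel_measurable borel" unfolding gauss_def by measurable
  have "(LINT \<zeta>|\<nu>. gauss t (z - \<zeta>)) = enn2real (\<integral>\<^sup>+\<zeta>. ennreal (gauss t (z - \<zeta>)) \<partial>\<nu>)"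
    using mg by (intro integral_eq_nn_integral) (auto simp: gauss_def measurable_cong_sets[OF pm(1) refl])
  also have "(\<integral>\<^sup>+\<zeta>. ennreal (gauss t (z - \<zeta>)) \<partial>\<nu>) = (\<integral>\<^sup>+x. ennreal (theta_sum t (x - z)) * indicator {0..<1} x \<partial>\<nu>)"
  proof (rule nn_integral_unfold_periods_real[OF pm(2) mg])
    have "gauss t (z - (x + of_int j)) = gauss t (x - z + of_int j)" for x j
      using power2_commute[of z "x + of_int j"] by (simp add: gauss_def algebra_simps)
    then show "((\<lambda>j. gauss t (z - (x + of_int j))) has_sum theta_sum t (x - z)) UNIV" for x
      using gauss_summable_all[OF t, of "x - z"] by simp
  qed (simp add: gauss_def)
  also have "\<dots> = (\<integral>\<^sup>+x. ennreal (theta_sum t (x - z)) \<partial>?N)"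
    using pm(1) sp by (subst nn_integral_restrict_space) auto
  also have "enn2real \<dots> = (LINT x|?N. theta_sum t (x - z))"
    using mth th0 by (intro integral_eq_nn_integral[symmetric] mN) auto
  finally have 1: "(LINT \<zeta>|\<nu>. gauss t (z - \<zeta>)) = (LINT x|?N. theta_sum t (x - z))" .
  have le: "norm (theta_coeff t q * cos (2 * pi * of_int q * (x - z))) \<le> theta_coeff t q" for q x
    by (simp add: abs_mult even_weightD[OF ev] mult_left_le)
  have mf: "(\<lambda>x. theta_coeff t q * cos (2 * pi * of_int q * (x - z))) \<in> borel_measurable ?N" for q
    by (intro mN borel_measurable_continuous_onI continuous_intros)
  note I = integral_infsum_int[OF N.finite_measure_axioms mf le even_weightD(3)[OF ev]]
  have "(LINT x|?N. theta_sum t (x - z)) = (\<Sum>\<^sub>\<infinity>q. LINT x|?N. theta_coeff t q * cos (2 * pi * of_int q * (x - z)))"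
    unfolding th cos_series_def by (rule I(1))
  also have "\<dots> = cos_series (initial_weight \<nu> t) z"
    unfolding cos_series_def
  proof (rule infsum_cong)
    fix q
    have ic: "integrable ?N (\<lambda>x. cos (2 * pi * of_int q * x))" and isn: "integrable ?N (\<lambda>x. sin (2 * pi * of_int q * x))"
      by (rule N.integrable_const_bound[where B = 1];
        auto intro!: mN borel_measurable_continuous_onI continuous_intros)+
    have "(\<lambda>x. theta_coeff t q * cos (2 * pi * of_int q * (x - z))) =
      (\<lambda>x. theta_coeff t q * (cos (2 * pi * of_int q * z) * cos (2 * pi * of_int q * x) + sin (2 * pi * of_int q * z) * sin (2 * pi * of_int q * x)))"
      by (simp add: right_diff_distrib cos_diff mult_ac fun_eq_iff)
    then show "(LINT x|?N. theta_coeff t q * cos (2 * pi * of_int q * (x - z))) = initial_weight \<nu> t q * cos (2 * pi * of_int q * z)"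
      using ic isn by (simp add: fourier_coeff_trig[OF nu] initial_weight_def)
  qed
  finally show 2: "(LINT \<zeta>|\<nu>. gauss t (z - \<zeta>)) = cos_series (initial_weight \<nu> t) z" using 1 by simp
  have "exp (- (1 / (2 * t))) * Re (fourier_coeff \<nu> 0) = (LINT x|?N. exp (- (1 / (2 * t))))"
    using fourier_coeff_trig(1)[OF nu, of 0] by simp
  also have "\<dots> \<le> (LINT x|?N. theta_sum t (x - z))"
  proof (rule integral_mono)
    show "integrable ?N (\<lambda>x. theta_sum t (x - z))" using I(2) unfolding th cos_series_def .
  qed (auto intro: theta_sum_lower t)
  finally show "exp (- (1 / (2 * t))) * Re (fourier_coeff \<nu> 0) \<le> cos_series (initial_weight \<nu> t) z" using 1 2 by simp
qed

section \<open>All potentials as cosine series\<close>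

primrec pot_weight :: "nat \<Rightarrow> real \<Rightarrow> real measure \<Rightarrow> (nat \<Rightarrow> real) \<Rightarrow> nat \<Rightarrow> int \<Rightarrow> real" where
  "pot_weight b \<beta> \<nu> sg 0 = initial_weight \<nu> (sg 0 / \<beta>)"
| "pot_weight b \<beta> \<nu> sg (Suc k) =
     (\<lambda>q. exp (- (2 * pi\<^sup>2 * (real_of_int q)\<^sup>2 * (sg (Suc k) / \<beta>))) * conv_pow (pot_weight b \<beta> \<nu> sg k) b q)"

lemma conv_pow_pos:
  assumes x: "even_weight x" and pos: "\<And>q. 0 < x q"
  shows "0 < conv_pow x (Suc m) q"
proof -
  have 0: "0 < conv_pow x m 0"
  proof (induction m)
    case (Suc m)
    then have "0 < x 0 * conv_pow x m (0 - 0)" using pos[of 0] by simp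
    also have "\<dots> \<le> conv_pow x (Suc m) 0"
      using conv_ge_term[OF x even_weight_conv_pow(1)[OF x], of 0 m 0] by simp
    finally show ?case .
  qed simp
  then have "0 < x q * conv_pow x m (q - q)" using pos[of q] by simp
  also have "\<dots> \<le> conv_pow x (Suc m) q"
    using conv_ge_term[OF x even_weight_conv_pow(1)[OF x], of q m q] by simp
  finally show ?thesis .
qed

text \<open>Besides the series representation the induction carries the lower bound of \<open>exp (- pot)\<close>, which
  keeps the logarithms in the definition of \<open>pot\<close> away from zero arguments.\<close>

lemma pot_series:
  assumes nu: "positive_fourier_measure \<nu>" and beta: "0 < \<beta>" and b: "1 \<le> b"
  shows "(\<And>i. i \<le> k \<Longrightarrow> 0 < sg i) \<Longrightarrow>
    even_weight (pot_weight b \<beta> \<nu> sg k) \<and> (\<forall>q. 0 < pot_weight b \<beta> \<nu> sg k q) \<and>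
    (\<forall>z. normal_density 0 (sqrt (sg k / \<beta>)) 1 * pot_weight b \<beta> \<nu> sg k 0 \<le> cos_series (pot_weight b \<beta> \<nu> sg k) z \<and>
      exp (- pot b \<beta> \<nu> sg k z) = cos_series (pot_weight b \<beta> \<nu> sg k) z)"
proof (induction k)
  case 0
  define t where "t = sg 0 / \<beta>"
  have t: "0 < t" using 0[of 0] beta by (simp add: t_def)
  note pm = positive_fourier_measureD[OF nu]
  let ?w = "initial_weight \<nu> t"
  have pos: "0 < ?w q" for q using pm(5)[of q] t by (simp add: initial_weight_def theta_coeff_def)
  have lower: "normal_density 0 (sqrt t) 1 * ?w 0 \<le> cos_series ?w z" for z
    using initial_potential(2)[OF nu t, of z] t by (simp add: initial_weight_def theta_coeff_def normal_density_def)
  have "exp (- pot b \<beta> \<nu> sg 0 z) = cos_series ?w z" for z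
  proof -
    have "(LINT \<zeta>|\<nu>. exp (- (1 / 2) * \<beta> * inverse (sg 0) * (z - \<zeta>)\<^sup>2)) = (LINT \<zeta>|\<nu>. gauss t (z - \<zeta>))"
      by (simp add: gauss_def t_def field_simps)
    moreover have "0 < cos_series ?w z"
      using lower[of z] mult_pos_pos[OF normal_density_pos[of "sqrt t" 0 1] pos[of 0]] t by simp
    ultimately show ?thesis using initial_potential(1)[OF nu t, of z] by simp
  qed
  then show ?case using even_weight_initial[OF nu t] pos lower by (simp add: t_def)
next
  case (Suc k)
  define w where "w = pot_weight b \<beta> \<nu> sg k"
  define t where "t = sg (Suc k) / \<beta>"
  have t: "0 < t" using Suc.prems[of "Suc k"] beta by (simp add: t_def)
  have w: "even_weight w" "\<And>q. 0 < w q" and wz: "\<And>z. exp (- pot b \<beta> \<nu> sg k z) = cos_series w z"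
    using Suc by (auto simp: w_def)
  note A = even_weight_conv_pow(1)[OF w(1), of b]
  define W where "W = pot_weight b \<beta> \<nu> sg (Suc k)"
  have weq: "W = (\<lambda>q. exp (- (2 * pi\<^sup>2 * (real_of_int q)\<^sup>2 * t)) * conv_pow w b q)"
    by (simp add: W_def w_def t_def)
  obtain m where m: "b = Suc m" using b by (cases b) auto
  have "0 < conv_pow w b q" for q unfolding m by (rule conv_pow_pos[OF w])
  then have pos: "0 < W q" for q
    unfolding weq by simp
  have ev: "even_weight W"
    unfolding even_weight_def
  proof (intro conjI allI)
    show "0 \<le> W q" for q using pos[of q] by simp
    show "W (- q) = W q" for q unfolding weq using even_weightD(2)[OF A, of q] by simp
    show "W summable_on UNIV"
      unfolding weq using t even_weightD(1)[OF A]
      by (intro summable_on_comparison_test[OF even_weightD(3)[OF A]] mult_left_le_one_le mult_nonneg_nonneg) auto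
  qed
  have powr: "exp (- real b * pot b \<beta> \<nu> sg k z) = cos_series (conv_pow w b) z" for z
    using wz[of z] exp_of_nat_mult[of b "- pot b \<beta> \<nu> sg k z"] by (simp add: cos_series_conv_pow[OF w(1)])
  have avg: "(LINT x|centred_normal t. cos_series (conv_pow w b) (z + x)) = cos_series W z" for z
    unfolding weq by (rule centred_normal_cos_series[OF A t])
  have "0 \<le> cos_series (conv_pow w b) z" for z using powr[of z] exp_ge_zero by metis
  note bound = centred_normal_lower_bound[OF A t this]
  have "W 0 = conv_pow w b 0" by (simp add: weq)
  then have lower: "normal_density 0 (sqrt t) 1 * W 0 \<le> cos_series W z" for z
    using bound[of z] unfolding avg by simp
  have "0 < cos_series W z" for z
    using lower[of z] mult_pos_pos[OF normal_density_pos[of "sqrt t" 0 1] pos[of 0]] t by simp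
  moreover have "pot b \<beta> \<nu> sg (Suc k) z = - ln (cos_series W z)" for z
    by (simp only: pot.simps powr t_def[symmetric] avg)
  ultimately have "exp (- pot b \<beta> \<nu> sg (Suc k) z) = cos_series W z" for z by simp
  then show ?case using ev pos lower unfolding t_def W_def by blast
qed

lemma pot_coeff_eq:
  assumes "even_weight w" "\<And>z. exp (- pot b \<beta> \<nu> sg k z) = cos_series w z"
  shows "pot_coeff b \<beta> \<nu> sg k q = of_real (w q)"
proof -
  have "exp (of_real (- pot b \<beta> \<nu> sg k z) - 2 * of_real pi * \<i> * of_int q * of_real z) =
    of_real (cos_series w z) * cis (- (2 * pi * of_int q * z))" for z
  proof -
    have "of_real (- pot b \<beta> \<nu> sg k z) - 2 * of_real pi * \<i> * of_int q * of_real z =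
      of_real (- pot b \<beta> \<nu> sg k z) + \<i> * of_real (- (2 * pi * of_int q * z))" by (simp add: mult_ac)
    then show ?thesis by (simp only: exp_add exp_of_real cis_conv_exp assms(2))
  qed
  then show ?thesis
    using cos_series_fourier_coeff[OF assms(1), of q] by (simp add: pot_coeff_def)
qed

section \<open>Smoothness of logarithms of trigonometric series\<close>

text \<open>Finite orders of differentiability allow inductive closure proofs for products, reciprocals and
  logarithms; \<open>smoothI\<close> converts back to iterated derivatives.\<close>

primrec differentiable_upto :: "nat \<Rightarrow> (real \<Rightarrow> real) \<Rightarrow> bool" where
  "differentiable_upto 0 f \<longleftrightarrow> True"
| "differentiable_upto (Suc n) f \<longleftrightarrow> (\<exists>f'. (\<forall>x. (f has_real_derivative f' x) (at x)) \<and> differentiable_upto n f')"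

lemma differentiable_upto_SucI:
  "(\<And>x. (f has_real_derivative f' x) (at x)) \<Longrightarrow> differentiable_upto n f' \<Longrightarrow> differentiable_upto (Suc n) f"
  by auto

lemma differentiable_upto_Suc_imp: "differentiable_upto (Suc n) f \<Longrightarrow> differentiable_upto n f"
proof (induction n arbitrary: f)
  case (Suc n)
  then obtain f' where "\<And>x. (f has_real_derivative f' x) (at x)" "differentiable_upto (Suc n) f'"
    by (subst (asm) differentiable_upto.simps(2)) blast
  then show ?case using Suc.IH[of f'] by (intro differentiable_upto_SucI)
qed simp

lemma differentiable_upto_const: "differentiable_upto n (\<lambda>x. c)"
proof (induction n arbitrary: c)
  case (Suc n)
  show ?case by (rule differentiable_upto_SucI[OF _ Suc[of 0]]) simp
qed simp

lemma differentiable_upto_add: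
  "differentiable_upto n f \<Longrightarrow> differentiable_upto n g \<Longrightarrow> differentiable_upto n (\<lambda>x. f x + g x)"
proof (induction n arbitrary: f g)
  case (Suc n)
  then obtain f' g' where "\<And>x. (f has_real_derivative f' x) (at x)" "differentiable_upto n f'"
    "\<And>x. (g has_real_derivative g' x) (at x)" "differentiable_upto n g'" by auto
  then show ?case
    using Suc.IH[of f' g'] by (intro differentiable_upto_SucI[where f' = "\<lambda>x. f' x + g' x"]) (auto intro!: derivative_eq_intros)
qed simp

lemma differentiable_upto_mult:
  "differentiable_upto n f \<Longrightarrow> differentiable_upto n g \<Longrightarrow> differentiable_upto n (\<lambda>x. f x * g x)"
proof (induction n arbitrary: f g)
  case (Suc n)
  then obtain f' g' where d: "\<And>x. (f has_real_derivative f' x) (at x)" "differentiable_upto n f'"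
    "\<And>x. (g has_real_derivative g' x) (at x)" "differentiable_upto n g'" by auto
  then have "differentiable_upto n (\<lambda>x. f' x * g x + f x * g' x)"
    using Suc.IH[of f' g] Suc.IH[of f g'] Suc.prems[THEN differentiable_upto_Suc_imp]
    by (intro differentiable_upto_add)
  moreover have "((\<lambda>x. f x * g x) has_real_derivative f' x * g x + f x * g' x) (at x)" for x
    using d by (auto intro!: derivative_eq_intros)
  ultimately show ?case by (intro differentiable_upto_SucI)
qed simp

lemma differentiable_upto_inverse:
  assumes "\<And>x. 0 < f x"
  shows "differentiable_upto n f \<Longrightarrow> differentiable_upto n (\<lambda>x. inverse (f x))"
proof (induction n)
  case (Suc n)
  then obtain f' where d: "\<And>x. (f has_real_derivative f' x) (at x)" "differentiable_upto n f'" by auto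
  have i: "differentiable_upto n (\<lambda>x. inverse (f x))"
    using Suc differentiable_upto_Suc_imp by blast
  have "differentiable_upto n (\<lambda>x. -1 * (f' x * (inverse (f x) * inverse (f x))))"
    using differentiable_upto_mult[OF differentiable_upto_const differentiable_upto_mult[OF d(2) differentiable_upto_mult[OF i i]]] .
  moreover have "((\<lambda>x. inverse (f x)) has_real_derivative -1 * (f' x * (inverse (f x) * inverse (f x)))) (at x)" for x
    using d assms[of x] by (auto intro!: derivative_eq_intros)
  ultimately show ?case by (intro differentiable_upto_SucI)
qed simp

lemma differentiable_upto_minus_ln:
  assumes pos: "\<And>x. 0 < f x" and f: "\<And>n. differentiable_upto n f"
  shows "differentiable_upto n (\<lambda>x. - ln (f x))"
proof (cases n)
  case (Suc m)
  obtain f' where d: "\<And>x. (f has_real_derivative f' x) (at x)" "differentiable_upto m f'"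
    using f[of "Suc m"] by auto
  have "differentiable_upto m (\<lambda>x. (-1 * f' x) * inverse (f x))"
    using differentiable_upto_mult[OF differentiable_upto_mult[OF differentiable_upto_const d(2)] differentiable_upto_inverse[OF pos f]] .
  moreover have "((\<lambda>x. - ln (f x)) has_real_derivative (-1 * f' x) * inverse (f x)) (at x)" for x
    using d(1) pos[of x] by (auto intro!: derivative_eq_intros simp: divide_inverse)
  ultimately show ?thesis unfolding Suc by (intro differentiable_upto_SucI)
qed simp

lemma smoothI:
  assumes "\<And>n. differentiable_upto n f"
  shows "smooth f"
proof -
  have "differentiable_upto (Suc n) f \<Longrightarrow> (deriv ^^ n) f field_differentiable at x" for n x
  proof (induction n arbitrary: f)
    case 0
    then show ?case by (auto simp: field_differentiable_def)
  next
    case (Suc n)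
    then obtain f' where d: "\<And>x. (f has_real_derivative f' x) (at x)" "differentiable_upto (Suc n) f'"
      by (subst (asm) differentiable_upto.simps(2)) blast
    have "deriv f = f'" using d(1) by (auto intro!: ext DERIV_imp_deriv)
    then show ?case using Suc.IH[OF d(2)] by (simp add: funpow_swap1)
  qed
  then show ?thesis using assms by (simp add: smooth_def)
qed

text \<open>The phase makes the class of these series closed under differentiation.\<close>

definition phase_series :: "(int \<Rightarrow> real) \<Rightarrow> real \<Rightarrow> real \<Rightarrow> real" where
  "phase_series c \<phi> z = (\<Sum>\<^sub>\<infinity>q. c q * cos (2 * pi * of_int q * z + \<phi>))"

lemma phase_series_DERIV:
  assumes c0: "(\<lambda>q. \<bar>c q\<bar>) summable_on UNIV" and c1: "(\<lambda>q. \<bar>2 * pi * of_int q * c q\<bar>) summable_on UNIV"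
  shows "(phase_series c \<phi> has_real_derivative phase_series (\<lambda>q. 2 * pi * of_int q * c q) (\<phi> + pi / 2) z) (at z)"
proof -
  define f where "f i z = c (int_decode i) * cos (2 * pi * of_int (int_decode i) * z + \<phi>)" for i z
  define f' where "f' i z = 2 * pi * of_int (int_decode i) * c (int_decode i) * cos (2 * pi * of_int (int_decode i) * z + (\<phi> + pi / 2))" for i z
  have s: "(\<lambda>q. norm (a q * cos (2 * pi * of_int q * z + \<psi>))) summable_on UNIV" if "(\<lambda>q. \<bar>a q\<bar>) summable_on UNIV" for a z \<psi>
    by (rule summable_on_comparison_test[OF that]) (auto simp: abs_mult mult_left_le)
  have "phase_series c \<phi> = (\<lambda>z. \<Sum>i. f i z)"
    unfolding phase_series_def[abs_def] f_def by (rule ext) (rule infsum_eq_suminf_int_decode[OF s[OF c0]])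
  moreover have "phase_series (\<lambda>q. 2 * pi * of_int q * c q) (\<phi> + pi / 2) z = (\<Sum>i. f' i z)"
    unfolding phase_series_def f'_def by (rule infsum_eq_suminf_int_decode[OF s[OF c1]])
  moreover have "((\<lambda>z. \<Sum>i. f i z) has_real_derivative (\<Sum>i. f' i z)) (at z)"
  proof (rule has_field_derivative_series'(2)[of UNIV])
    show "(f i has_real_derivative f' i x) (at x within UNIV)" for i x
    proof -
      have "cos (y + (\<phi> + pi / 2)) = - sin (y + \<phi>)" for y using cos_add[of "y + \<phi>" "pi / 2"] by (simp add: add.assoc)
      then show ?thesis unfolding f_def f'_def by (auto intro!: derivative_eq_intros)
    qed
    show "uniformly_convergent_on UNIV (\<lambda>n x. \<Sum>i<n. f' i x)"
      by (rule Weierstrass_m_test'[of _ _ "\<lambda>i. \<bar>2 * pi * of_int (int_decode i) * c (int_decode i)\<bar>"])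
        (use sums_int_decode(2)[of "\<lambda>q. \<bar>2 * pi * of_int q * c q\<bar>"] c1 in \<open>auto simp: f'_def abs_mult mult_left_le\<close>)
    show "summable (\<lambda>n. f n z)"
      unfolding f_def using sums_int_decode(1)[OF s[OF c0]] by (simp add: sums_iff)
  qed auto
  ultimately show ?thesis by simp
qed

lemma differentiable_upto_phase_series:
  assumes "\<And>j. (\<lambda>q. \<bar>real_of_int q\<bar> ^ j * \<bar>c q\<bar>) summable_on UNIV"
  shows "differentiable_upto n (phase_series c \<phi>)"
  using assms
proof (induction n arbitrary: c \<phi>)
  case (Suc n)
  have s: "(\<lambda>q. \<bar>real_of_int q\<bar> ^ j * \<bar>2 * pi * of_int q * c q\<bar>) summable_on UNIV" for j
    using summable_on_cmult_right[OF Suc.prems[of "Suc j"], of "2 * pi"] by (simp add: abs_mult mult_ac)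
  have "(phase_series c \<phi> has_real_derivative phase_series (\<lambda>q. 2 * pi * of_int q * c q) (\<phi> + pi / 2) z) (at z)" for z
    using Suc.prems[of 0] s[of 0] by (intro phase_series_DERIV) auto
  moreover have "differentiable_upto n (phase_series (\<lambda>q. 2 * pi * of_int q * c q) (\<phi> + pi / 2))"
    by (rule Suc.IH) (rule s)
  ultimately show ?case by (rule differentiable_upto_SucI)
qed simp

section \<open>Uniform decay of the coefficients\<close>

context critical_flow
begin

text \<open>Half of the exponent in \<open>theta ^ (q\<^sup>2)\<close> absorbs the geometric factor \<open>B ^ \<bar>q\<bar>\<close>, and the other
  half is the claimed Gaussian decay.\<close>

lemma gaussian_decay:
  "\<exists>\<eta>>0. \<exists>C>0. \<forall>n\<ge>1. \<forall>k\<le>n. \<forall>q. r n k q \<le> C * exp (- \<eta> * (real_of_int q)\<^sup>2) / (1 + sqrt (real k)) ^ nat \<bar>q\<bar>"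
proof -
  obtain H where H: "1 \<le> H" and r: "\<And>n k q. 1 \<le> n \<Longrightarrow> k \<le> n \<Longrightarrow> 0 \<le> q \<Longrightarrow>
      r n k (q + 1) \<le> H * r n k 1 * theta ^ (2 * nat q) * r n k q"
    using uniform_ratio by blast
  obtain C where C: "1 \<le> C" "\<And>n k. 1 \<le> n \<Longrightarrow> k \<le> n \<Longrightarrow> r n k 1 \<le> C / sqrt (1 + real k)"
    using slope_decay by blast
  define th where "th = sqrt theta"
  have th: "0 < th" "th < 1" "th\<^sup>2 = theta" using theta by (auto simp: th_def)
  define B where "B = 2 * (H * C) / theta"
  have B: "0 < B" using H C(1) theta by (simp add: B_def)
  define g where "g = gauss_weight th (B * th)"
  have gs: "g summable_on UNIV" using gauss_weight_summable[OF th(1,2), of "B * th" 0] B th by (simp add: g_def)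
  have g0: "0 \<le> g q" for q using B th by (simp add: g_def gauss_weight_def)
  define Cf where "Cf = infsum g UNIV + 1"
  have Cf: "0 < Cf" "\<And>q. g q \<le> Cf"
  proof -
    show "0 < Cf" using infsum_nonneg[of UNIV g] g0 by (simp add: Cf_def add_nonneg_pos)
    show "g q \<le> Cf" for q using finite_sum_le_infsum[OF gs, of "{q}"] g0 by (simp add: Cf_def)
  qed
  define \<eta> where "\<eta> = - ln th"
  have eta: "0 < \<eta>" using th by (simp add: \<eta>_def)
  have thq: "th ^ (m * m) = exp (- \<eta> * (real m)\<^sup>2)" for m
  proof -
    have "exp (- \<eta> * (real m)\<^sup>2) = exp (real (m * m) * ln th)" by (simp add: \<eta>_def power2_eq_square mult.commute)
    also have "\<dots> = th ^ (m * m)" using th by (simp only: exp_of_nat_mult exp_ln)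
    finally show ?thesis ..
  qed
  have "r n k q \<le> Cf * exp (- \<eta> * (real_of_int q)\<^sup>2) / (1 + sqrt (real k)) ^ nat \<bar>q\<bar>"
    if n: "1 \<le> n" and k: "k \<le> n" for n k q
  proof -
    define m where "m = nat \<bar>q\<bar>"
    have R0: "0 < r n k 1" by (rule r_pos[OF n k])
    have "(1 + sqrt (real k))\<^sup>2 \<le> (2 * sqrt (1 + real k))\<^sup>2"
      using sum_squares_bound[of 1 "sqrt (real k)"] by (simp add: power2_sum power_mult_distrib)
    then have "1 + sqrt (real k) \<le> 2 * sqrt (1 + real k)" by (rule power2_le_imp_le) simp
    then have "C / sqrt (1 + real k) \<le> 2 * C / (1 + sqrt (real k))"
      using C(1) mult_left_mono[of "1 + sqrt (real k)" "2 * sqrt (1 + real k)" C]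
      by (simp add: divide_simps add_pos_nonneg)
    then have HR: "H * r n k 1 \<le> B * theta / (1 + sqrt (real k))"
      using mult_left_mono[of "r n k 1" "2 * C / (1 + sqrt (real k))" H] C(2)[OF n k] H theta by (simp add: B_def mult_ac)
    have "r n k q \<le> gauss_weight theta (H * r n k 1) q"
      using r[OF n k] H R0 by (intro r_le_gauss_weight n k) auto
    also have "\<dots> = (H * r n k 1) ^ m * theta ^ (m * (m - 1))" by (simp add: gauss_weight_def m_def)
    also have "\<dots> \<le> (B * theta / (1 + sqrt (real k))) ^ m * theta ^ (m * (m - 1))"
      using HR H R0 theta by (intro mult_right_mono power_mono) auto
    also have "\<dots> = B ^ m * theta ^ (m * m) / (1 + sqrt (real k)) ^ m"
    proof -
      have "m + m * (m - 1) = m * m" by (cases m) auto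
      then show ?thesis by (simp add: power_divide power_mult_distrib mult.assoc flip: power_add)
    qed
    also have "B ^ m * theta ^ (m * m) = g q * th ^ (m * m)"
    proof -
      have "m + m * (m - 1) = m * m" by (cases m) auto
      then have "g q = B ^ m * th ^ (m * m)"
        by (simp add: g_def gauss_weight_def m_def[symmetric] power_mult_distrib mult.assoc flip: power_add)
      then show ?thesis by (simp add: th(3)[symmetric] mult.assoc power2_eq_square power_mult_distrib)
    qed
    also have "g q * th ^ (m * m) / (1 + sqrt (real k)) ^ m \<le> Cf * th ^ (m * m) / (1 + sqrt (real k)) ^ m"
      using Cf(2) th by (intro divide_right_mono mult_right_mono) auto
    also have "th ^ (m * m) = exp (- \<eta> * (real_of_int q)\<^sup>2)" unfolding thq by (simp add: m_def)
    finally show ?thesis by (simp add: m_def)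
  qed
  then show ?thesis using eta Cf by blast
qed

text \<open>One dominating sequence for the first two derivatives: a first power of \<open>r n k 1\<close> can be split
  off from every coefficient with \<open>q \<noteq> 0\<close>, a second power from those with \<open>\<bar>q\<bar> \<ge> 2\<close>.\<close>

lemma moment_bounds:
  "\<exists>g. g summable_on UNIV \<and> (\<forall>n\<ge>1. \<forall>k\<le>n. (\<forall>q. q \<noteq> 0 \<longrightarrow> (real_of_int q)\<^sup>2 * r n k q \<le> r n k 1 * g q) \<and>
     (\<forall>q. 2 \<le> \<bar>q\<bar> \<longrightarrow> \<bar>real_of_int q\<bar> * r n k q \<le> (r n k 1)\<^sup>2 * g q) \<and>
     (\<forall>j. (\<lambda>q. \<bar>real_of_int q\<bar> ^ j * r n k q) summable_on UNIV))"
proof -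
  obtain H where H: "1 \<le> H" and r: "\<And>n k q. 1 \<le> n \<Longrightarrow> k \<le> n \<Longrightarrow> 0 \<le> q \<Longrightarrow>
      r n k (q + 1) \<le> H * r n k 1 * theta ^ (2 * nat q) * r n k q"
    using uniform_ratio by blast
  obtain X C where C: "1 \<le> C" and RC: "\<And>n k. 1 \<le> n \<Longrightarrow> k \<le> n \<Longrightarrow> r n k 1 \<le> C"
    using uniform_decay_norm by blast
  define h where "h = gauss_weight theta (H * C)"
  define g where "g q = \<bar>real_of_int q\<bar> ^ 2 * h q" for q
  have hs: "(\<lambda>q. \<bar>real_of_int q\<bar> ^ j * h q) summable_on UNIV" for j
    unfolding h_def using H C by (intro gauss_weight_summable theta) auto
  have h0: "0 \<le> h q" for q using H C theta by (simp add: h_def gauss_weight_def)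
  have main: "r n k q \<le> (r n k 1 / C) ^ i * h q" if n: "1 \<le> n" and k: "k \<le> n" and i: "i \<le> nat \<bar>q\<bar>" for n k q i
  proof -
    have R0: "0 < r n k 1" by (rule r_pos[OF n k])
    have "r n k q \<le> gauss_weight theta (H * r n k 1) q"
      using r[OF n k] H R0 by (intro r_le_gauss_weight n k) auto
    also have "\<dots> = (r n k 1 / C) ^ nat \<bar>q\<bar> * h q"
      using C by (simp add: gauss_weight_def h_def power_mult_distrib power_divide)
    also have "\<dots> \<le> (r n k 1 / C) ^ i * h q"
      using i R0 RC[OF n k] C h0 by (intro mult_right_mono power_decreasing) auto
    finally show ?thesis .
  qed
  have RC': "(r n k 1 / C) ^ i \<le> r n k 1 ^ i" if "1 \<le> n" "k \<le> n" for n k i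
    using r_pos[OF that, of 1] C by (intro power_mono) (auto simp: divide_le_eq mult_left_le)
  show ?thesis
  proof (intro exI[of _ g] conjI allI impI)
    show "g summable_on UNIV" unfolding g_def by (rule hs)
    fix n k :: nat assume n: "1 \<le> n" and k: "k \<le> n"
    show "(real_of_int q)\<^sup>2 * r n k q \<le> r n k 1 * g q" if "q \<noteq> 0" for q
    proof -
      have "r n k q \<le> (r n k 1 / C) ^ 1 * h q" using that by (intro main n k) auto
      also have "\<dots> \<le> r n k 1 ^ 1 * h q" by (intro mult_right_mono RC' n k h0)
      finally have "(real_of_int q)\<^sup>2 * r n k q \<le> (real_of_int q)\<^sup>2 * (r n k 1 ^ 1 * h q)" by (intro mult_left_mono) auto
      then show ?thesis by (simp add: g_def mult_ac)
    qed
    show "\<bar>real_of_int q\<bar> * r n k q \<le> (r n k 1)\<^sup>2 * g q" if "2 \<le> \<bar>q\<bar>" for q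
    proof -
      have "r n k q \<le> (r n k 1 / C) ^ 2 * h q" using that by (intro main n k) auto
      also have "\<dots> \<le> (r n k 1)\<^sup>2 * h q" by (intro mult_right_mono RC' n k h0)
      finally have "\<bar>real_of_int q\<bar> * r n k q \<le> \<bar>real_of_int q\<bar> ^ 2 * ((r n k 1)\<^sup>2 * h q)"
        using that r_pos[OF n k, of q] self_le_power[of "\<bar>real_of_int q\<bar>" 2] by (intro mult_mono) auto
      then show ?thesis by (simp add: g_def mult_ac)
    qed
    show "(\<lambda>q. \<bar>real_of_int q\<bar> ^ j * r n k q) summable_on UNIV" for j
      using main[OF n k, of 0] r_pos[OF n k]
      by (intro summable_on_comparison_test[OF hs]) (auto intro!: mult_left_mono simp: less_imp_le)
  qed
qed

end

section \<open>Derivatives of the potential\<close>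

lemma cos_series_eq_phase_series: "cos_series c = phase_series c 0"
  by (simp add: cos_series_def phase_series_def fun_eq_iff)

lemma abs_phase_series_le:
  assumes "\<And>q. \<bar>c q\<bar> \<le> B * g q" "g summable_on UNIV"
  shows "\<bar>phase_series c \<phi> z\<bar> \<le> B * infsum g UNIV"
proof -
  have s: "(\<lambda>q. B * g q) summable_on UNIV" by (intro summable_on_cmult_right assms)
  have le: "norm (c q * cos (2 * pi * of_int q * z + \<phi>)) \<le> B * g q" for q
    using assms(1)[of q] mult_left_mono[OF abs_cos_le_one, of "\<bar>c q\<bar>" "2 * pi * of_int q * z + \<phi>"] by (simp add: abs_mult)
  have n: "(\<lambda>q. norm (c q * cos (2 * pi * of_int q * z + \<phi>))) summable_on UNIV"
    by (rule summable_on_comparison_test[OF s]) (use le in auto)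
  show ?thesis
    unfolding phase_series_def infsum_cmult_right'[symmetric]
    using norm_infsum_le[OF has_sum_infsum[OF abs_summable_summable[OF n]] has_sum_infsum[OF s] le] by simp
qed

text \<open>The terms \<open>q = 1\<close> and \<open>q = - 1\<close> of the derivative of the cosine series add up to
  \<open>- 4 * pi * r 1 * sin (2 * pi * z)\<close>, the others are of order \<open>(r 1)\<^sup>2\<close>. Replacing the
  denominator by \<open>1\<close> costs a further factor \<open>r 1\<close>.\<close>

lemma potential_estimates:
  fixes r g :: "int \<Rightarrow> real"
  assumes r: "even_weight r" "r 0 = 1" and sm: "\<And>j. (\<lambda>q. \<bar>real_of_int q\<bar> ^ j * r q) summable_on UNIV"
    and g: "g summable_on UNIV" and g1: "\<And>q. q \<noteq> 0 \<Longrightarrow> (real_of_int q)\<^sup>2 * r q \<le> r 1 * g q"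
    and g2: "\<And>q. 2 \<le> \<bar>q\<bar> \<Longrightarrow> \<bar>real_of_int q\<bar> * r q \<le> (r 1)\<^sup>2 * g q"
    and m: "0 < m" "\<And>z. m \<le> cos_series r z" and w0: "0 < w0"
    and v: "\<And>z. v z = - ln (w0 * cos_series r z)" and G: "G = infsum (\<lambda>q. \<bar>g q\<bar>) UNIV" and r1: "0 < r 1"
  shows "smooth v" 
    "\<bar>deriv v z\<bar> \<le> 2 * pi * r 1 * G / m"
    "\<bar>deriv (deriv v) z\<bar> \<le> 4 * pi\<^sup>2 * r 1 * G / m + (2 * pi * r 1 * G / m)\<^sup>2"
    "\<bar>deriv v z - 4 * pi * r 1 * sin (2 * pi * z)\<bar> \<le> 6 * pi * (r 1)\<^sup>2 * G / m"
    "v differentiable at z"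
proof -
  define f where "f = cos_series r"
  define f' where "f' = phase_series (\<lambda>q. 2 * pi * of_int q * r q) (pi / 2)"
  define f'' where "f'' = phase_series (\<lambda>q. 2 * pi * of_int q * (2 * pi * of_int q * r q)) (pi / 2 + pi / 2)"
  have r0: "0 \<le> r q" for q using r by (simp add: even_weightD)
  have s0: "(\<lambda>q. \<bar>r q\<bar>) summable_on UNIV" using sm[of 0] r0 by simp
  have s1: "(\<lambda>q. \<bar>2 * pi * of_int q * r q\<bar>) summable_on UNIV"
    using summable_on_cmult_right[OF sm[of 1], of "2 * pi"] r0 by (simp add: abs_mult mult_ac)
  have s2: "(\<lambda>q. \<bar>2 * pi * of_int q * (2 * pi * of_int q * r q)\<bar>) summable_on UNIV"
  proof -
    have "\<bar>2 * pi * of_int q * (2 * pi * of_int q * r q)\<bar> = 4 * pi * pi * (\<bar>real_of_int q\<bar> ^ 2 * r q)" for q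
    proof -
      have "2 * pi * of_int q * (2 * pi * of_int q * r q) = 4 * pi * pi * ((real_of_int q)\<^sup>2 * r q)"
        by (simp add: power2_eq_square)
      moreover have "0 \<le> 4 * pi * pi * ((real_of_int q)\<^sup>2 * r q)" using r0[of q] by simp
      ultimately show ?thesis by (simp only: abs_of_nonneg power2_abs)
    qed
    then show ?thesis by (simp only:) (rule summable_on_cmult_right[OF sm])
  qed
  have f: "(f has_real_derivative f' z) (at z)" for z
    using phase_series_DERIV[OF s0 s1, of 0 z] by (simp add: f_def f'_def cos_series_eq_phase_series)
  have f'D: "(f' has_real_derivative f'' z) (at z)" for z
    unfolding f'_def f''_def by (rule phase_series_DERIV[OF s1 s2])
  have fm: "m \<le> f z" and fpos: "0 < f z" for z using m(1) m(2)[of z] by (auto simp: f_def)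
  have "differentiable_upto n (\<lambda>z. w0 * f z)" for n
    unfolding f_def cos_series_eq_phase_series using sm r0
    by (intro differentiable_upto_mult differentiable_upto_const differentiable_upto_phase_series) simp
  then have "differentiable_upto n (\<lambda>z. - ln (w0 * f z))" for n
    using w0 fpos by (intro differentiable_upto_minus_ln) auto
  moreover have veq: "v = (\<lambda>z. - ln (w0 * f z))" using v by (auto simp: f_def)
  ultimately show "smooth v" by (intro smoothI) simp
  have vD: "(v has_real_derivative - f' z / f z) (at z)" for z
    unfolding veq using f fpos[of z] w0 by (auto intro!: derivative_eq_intros)
  then show "v differentiable at z" by (auto simp: real_differentiable_def)
  have dv: "deriv v = (\<lambda>z. - f' z / f z)" using vD by (auto intro!: DERIV_imp_deriv)
  have "((\<lambda>z. - f' z / f z) has_real_derivative - f'' z / f z + (f' z / f z)\<^sup>2) (at z)"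
    using f f'D fpos[of z] by (auto intro!: derivative_eq_intros simp: power2_eq_square field_simps)
  then have ddv: "deriv (deriv v) z = - f'' z / f z + (f' z / f z)\<^sup>2"
    unfolding dv by (rule DERIV_imp_deriv)
  have gG: "(\<lambda>q. \<bar>g q\<bar>) summable_on UNIV" using summable_on_iff_abs_summable_on_real[THEN iffD1, OF g] by simp
  have G0: "0 \<le> G" unfolding G by (intro infsum_nonneg) auto
  have q2: "(real_of_int q)\<^sup>2 * r q \<le> r 1 * \<bar>g q\<bar>" for q
  proof (cases "q = 0")
    case False
    then show ?thesis using g1[OF False] mult_left_mono[OF abs_ge_self[of "g q"] less_imp_le[OF r1]] by linarith
  qed (use r1 in simp)
  have q1: "\<bar>real_of_int q\<bar> * r q \<le> r 1 * \<bar>g q\<bar>" for q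
  proof -
    have "\<bar>real_of_int q\<bar> \<le> (real_of_int q)\<^sup>2"
      using self_le_power[of "\<bar>real_of_int q\<bar>" 2] by (cases "q = 0") auto
    then have "\<bar>real_of_int q\<bar> * r q \<le> (real_of_int q)\<^sup>2 * r q" by (intro mult_right_mono r0)
    then show ?thesis using q2[of q] by simp
  qed
  have f'b: "\<bar>f' z\<bar> \<le> 2 * pi * r 1 * G" for z
    unfolding f'_def G
  proof (rule abs_phase_series_le[OF _ gG])
    show "\<bar>2 * pi * real_of_int q * r q\<bar> \<le> 2 * pi * r 1 * \<bar>g q\<bar>" for q
      using mult_left_mono[OF q1[of q], of "2 * pi"] r0 by (simp add: abs_mult mult_ac)
  qed
  have f''b: "\<bar>f'' z\<bar> \<le> 4 * pi\<^sup>2 * r 1 * G" for z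
    unfolding f''_def G
  proof (rule abs_phase_series_le[OF _ gG])
    show "\<bar>2 * pi * real_of_int q * (2 * pi * real_of_int q * r q)\<bar> \<le> 4 * pi\<^sup>2 * r 1 * \<bar>g q\<bar>" for q
      using mult_left_mono[OF q2[of q], of "4 * pi\<^sup>2"] r0 by (simp add: abs_mult mult_ac power2_eq_square)
  qed
  have "f z - 1 = phase_series (\<lambda>q. if q = 0 then 0 else r q) 0 z" for z
  proof -
    have s: "(\<lambda>q. r q * cos (2 * pi * of_int q * z)) summable_on A" for A
      using abs_summable_summable[OF cos_term_summable[OF r(1)]] by (rule summable_on_subset) auto
    have "f z = (\<Sum>\<^sub>\<infinity>q\<in>{0} \<union> -{0}. r q * cos (2 * pi * of_int q * z))" by (simp add: f_def cos_series_def)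
    also have "\<dots> = 1 + (\<Sum>\<^sub>\<infinity>q\<in>-{0}. r q * cos (2 * pi * of_int q * z))"
      by (subst infsum_Un_disjoint) (auto simp: s r(2))
    also have "(\<Sum>\<^sub>\<infinity>q\<in>-{0}. r q * cos (2 * pi * of_int q * z)) = phase_series (\<lambda>q. if q = 0 then 0 else r q) 0 z"
      unfolding phase_series_def by (rule infsum_cong_neutral) auto
    finally show ?thesis by simp
  qed
  moreover have "\<bar>phase_series (\<lambda>q. if q = 0 then 0 else r q) 0 z\<bar> \<le> r 1 * G" for z
    unfolding G
  proof (rule abs_phase_series_le[OF _ gG])
    show "\<bar>if q = 0 then 0 else r q\<bar> \<le> r 1 * \<bar>g q\<bar>" for q
    proof (cases "q = 0")
      case False
      then have "1 * r q \<le> \<bar>real_of_int q\<bar> * r q" by (intro mult_right_mono r0) auto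
      then show ?thesis using False q1[of q] r0[of q] by simp
    qed (use r1 in simp)
  qed
  ultimately have f1: "\<bar>f z - 1\<bar> \<le> r 1 * G" for z by simp
  have f'1: "\<bar>f' z + 4 * pi * r 1 * sin (2 * pi * z)\<bar> \<le> 2 * pi * (r 1)\<^sup>2 * G"
  proof -
    let ?c = "\<lambda>q. 2 * pi * of_int q * r q"
    have s: "(\<lambda>q. ?c q * cos (2 * pi * of_int q * z + pi / 2)) summable_on A" for A
    proof (rule summable_on_subset[OF abs_summable_summable])
      show "(\<lambda>q. norm (?c q * cos (2 * pi * of_int q * z + pi / 2))) summable_on UNIV"
        by (rule summable_on_comparison_test[OF s1]) (auto simp: abs_mult mult_left_le)
    qed auto
    have "f' z = (\<Sum>\<^sub>\<infinity>q\<in>{1, -1} \<union> -{1, -1}. ?c q * cos (2 * pi * of_int q * z + pi / 2))"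
      by (simp add: f'_def phase_series_def)
    also have "\<dots> = (\<Sum>q\<in>{1, -1}. ?c q * cos (2 * pi * of_int q * z + pi / 2)) + (\<Sum>\<^sub>\<infinity>q\<in>-{1, -1}. ?c q * cos (2 * pi * of_int q * z + pi / 2))"
      by (subst infsum_Un_disjoint) (auto simp: s)
    also have "(\<Sum>q\<in>{1, -1}. ?c q * cos (2 * pi * of_int q * z + pi / 2)) = - (4 * pi * r 1 * sin (2 * pi * z))"
      using even_weightD(2)[OF r(1), of 1] by (simp add: cos_add)
    also have "(\<Sum>\<^sub>\<infinity>q\<in>-{1, -1}. ?c q * cos (2 * pi * of_int q * z + pi / 2)) = phase_series (\<lambda>q. if \<bar>q\<bar> \<le> 1 then 0 else ?c q) (pi / 2) z"
      unfolding phase_series_def by (rule infsum_cong_neutral) auto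
    finally have "f' z + 4 * pi * r 1 * sin (2 * pi * z) = phase_series (\<lambda>q. if \<bar>q\<bar> \<le> 1 then 0 else ?c q) (pi / 2) z" by simp
    moreover have "\<bar>phase_series (\<lambda>q. if \<bar>q\<bar> \<le> 1 then 0 else ?c q) (pi / 2) z\<bar> \<le> 2 * pi * (r 1)\<^sup>2 * G"
      unfolding G
    proof (rule abs_phase_series_le[OF _ gG])
      show "\<bar>if \<bar>q\<bar> \<le> 1 then 0 else ?c q\<bar> \<le> 2 * pi * (r 1)\<^sup>2 * \<bar>g q\<bar>" for q
      proof (cases "\<bar>q\<bar> \<le> 1")
        case False
        then have "\<bar>real_of_int q\<bar> * r q \<le> (r 1)\<^sup>2 * \<bar>g q\<bar>"
          using g2[of q] mult_left_mono[OF abs_ge_self[of "g q"], of "(r 1)\<^sup>2"] by simp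
        from mult_left_mono[OF this, of "2 * pi"] show ?thesis using False r0[of q] by (simp add: abs_mult mult_ac)
      qed simp
    qed
    ultimately show ?thesis by simp
  qed
  have divm: "\<bar>a / f z\<bar> \<le> A / m" if "\<bar>a\<bar> \<le> A" for a A
    unfolding abs_divide using that fm[of z] m(1) by (intro frac_le) auto
  have dvb: "\<bar>f' z / f z\<bar> \<le> 2 * pi * r 1 * G / m" by (rule divm[OF f'b])
  then show "\<bar>deriv v z\<bar> \<le> 2 * pi * r 1 * G / m" by (simp add: dv)
  have "\<bar>(f' z / f z)\<^sup>2\<bar> \<le> (2 * pi * r 1 * G / m)\<^sup>2"
    using power_mono[OF dvb abs_ge_zero, of 2] by (simp only: power2_abs abs_power2)
  then show "\<bar>deriv (deriv v) z\<bar> \<le> 4 * pi\<^sup>2 * r 1 * G / m + (2 * pi * r 1 * G / m)\<^sup>2"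
    unfolding ddv using divm[OF f''b[of z]] by linarith
  define S where "S = 4 * pi * r 1 * sin (2 * pi * z)"
  have "deriv v z - S = - (f' z + S + S * (f z - 1)) / f z"
    using fpos[of z] by (simp add: dv field_simps)
  also have "\<bar>\<dots>\<bar> \<le> (2 * pi * (r 1)\<^sup>2 * G + 4 * pi * r 1 * (r 1 * G)) / m"
  proof (rule divm)
    have "\<bar>S\<bar> \<le> 4 * pi * r 1" using r1 by (simp add: S_def abs_mult mult_left_le)
    then have "\<bar>S * (f z - 1)\<bar> \<le> 4 * pi * r 1 * (r 1 * G)"
      unfolding abs_mult using f1[of z] r1 by (intro mult_mono) auto
    then show "\<bar>- (f' z + S + S * (f z - 1))\<bar> \<le> 2 * pi * (r 1)\<^sup>2 * G + 4 * pi * r 1 * (r 1 * G)"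
      using f'1 unfolding S_def[symmetric] by linarith
  qed
  also have "\<dots> = 6 * pi * (r 1)\<^sup>2 * G / m" by (simp add: power2_eq_square algebra_simps)
  finally show "\<bar>deriv v z - 4 * pi * r 1 * sin (2 * pi * z)\<bar> \<le> 6 * pi * (r 1)\<^sup>2 * G / m" by (simp add: S_def)
qed

section \<open>The potentials at the critical inverse temperature\<close>

text \<open>The average of \<open>exp (- b * v)\<close> lies between the extreme values of this function.\<close>

lemma pot_Suc_near_multiple:
  assumes t: "0 < sg (Suc k) / \<beta>" and m: "(\<lambda>x. exp (- real b * pot b \<beta> \<nu> sg k x)) \<in> borel_measurable borel"
    and osc: "\<And>x y. \<bar>pot b \<beta> \<nu> sg k x - pot b \<beta> \<nu> sg k y\<bar> \<le> e"
  shows "\<bar>pot b \<beta> \<nu> sg (Suc k) z - real b * pot b \<beta> \<nu> sg k z'\<bar> \<le> real b * e"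
proof -
  let ?M = "centred_normal (sg (Suc k) / \<beta>)" and ?v = "pot b \<beta> \<nu> sg k"
  interpret M: prob_space ?M by (rule prob_space_centred_normal[OF t])
  define I where "I = (LINT \<zeta>|?M. exp (- real b * ?v (z + \<zeta>)))"
  have bd: "exp (- real b * ?v z' - real b * e) \<le> exp (- real b * ?v x) \<and> exp (- real b * ?v x) \<le> exp (- real b * ?v z' + real b * e)" for x
  proof -
    have "\<bar>real b * (?v x - ?v z')\<bar> \<le> real b * e"
      unfolding abs_mult using osc by (intro mult_mono) auto
    then have "\<bar>real b * ?v x - real b * ?v z'\<bar> \<le> real b * e" by (simp only: right_diff_distrib)
    then show ?thesis by (auto simp: abs_le_iff)
  qed
  have i: "integrable ?M (\<lambda>\<zeta>. exp (- real b * ?v (z + \<zeta>)))"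
  proof (rule M.integrable_const_bound)
    show "AE x in ?M. norm (exp (- real b * ?v (z + x))) \<le> exp (- real b * ?v z' + real b * e)" using bd by simp
    have "(\<lambda>\<zeta>. exp (- real b * ?v (z + \<zeta>))) \<in> borel_measurable borel"
      using measurable_compose[OF _ m, of "\<lambda>\<zeta>. z + \<zeta>" borel] by simp
    then show "(\<lambda>\<zeta>. exp (- real b * ?v (z + \<zeta>))) \<in> borel_measurable ?M" by (simp add: centred_normal_def)
  qed
  have "exp (- real b * ?v z' - real b * e) = (LINT \<zeta>|?M. exp (- real b * ?v z' - real b * e))"
    by (simp add: M.prob_space)
  also have "\<dots> \<le> I" unfolding I_def using i bd by (intro integral_mono) auto
  finally have lo: "exp (- real b * ?v z' - real b * e) \<le> I" .
  have "I \<le> (LINT \<zeta>|?M. exp (- real b * ?v z' + real b * e))" unfolding I_def using i bd by (intro integral_mono) auto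
  then have hi: "I \<le> exp (- real b * ?v z' + real b * e)" by (simp add: M.prob_space)
  have I0: "0 < I" using lo exp_gt_zero less_le_trans by blast
  have "- real b * ?v z' - real b * e \<le> ln I" using lo I0 by (simp add: ln_ge_iff)
  moreover have "ln I \<le> - real b * ?v z' + real b * e"
    using ln_mono[OF hi I0] by (simp only: ln_exp)
  moreover have "pot b \<beta> \<nu> sg (Suc k) z = - ln I" by (simp add: I_def)
  ultimately show ?thesis by linarith
qed

lemma periodic_oscillation_le:
  fixes v :: "real \<Rightarrow> real"
  assumes d: "\<And>z. v differentiable at z" "\<And>z. \<bar>deriv v z\<bar> \<le> D" and per: "\<And>z m. v (z + of_int m) = v z"
  shows "\<bar>v x - v y\<bar> \<le> D"
proof -
  have lip: "\<bar>v x - v y\<bar> \<le> D" if "x \<le> y" "y \<le> x + 1" for x y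
  proof (cases "x = y")
    case True
    then show ?thesis using d(2)[of x] by simp
  next
    case False
    then have "x < y" using that by simp
    moreover have "(v has_real_derivative deriv v z) (at z)" for z
      using d(1)[of z] by (simp add: DERIV_deriv_iff_real_differentiable)
    ultimately obtain z where "v y - v x = (y - x) * deriv v z" using MVT2[of x y v "deriv v"] by blast
    then have "\<bar>v x - v y\<bar> = \<bar>(y - x) * deriv v z\<bar>" by (simp only: abs_minus_commute[of "v x"])
    also have "\<dots> = (y - x) * \<bar>deriv v z\<bar>" using that by (simp add: abs_mult)
    also have "\<dots> \<le> 1 * D" using that d(2)[of z] by (intro mult_mono) auto
    finally show ?thesis by simp
  qed
  have "\<bar>v (x + of_int \<lfloor>y - x\<rfloor>) - v y\<bar> \<le> D" by (rule lip) linarith+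
  then show ?thesis by (simp add: per)
qed

lemma almost_unit_variancesD:
  assumes "almost_unit_variances d s"
  defines "smin \<equiv> Inf {s n k | n k. 1 \<le> n \<and> k \<le> n}"
  shows "0 \<le> d j" "summable d" "0 < smin" "1 \<le> n \<Longrightarrow> k \<le> n \<Longrightarrow> smin \<le> s n k"
    "1 \<le> n \<Longrightarrow> k \<le> n \<Longrightarrow> \<bar>s n k - 1\<bar> \<le> d (min k (n - k))"
    "1 \<le> n \<Longrightarrow> k \<le> n \<Longrightarrow> s n k \<le> 1 + suminf d"
proof -
  note a = assms(1)[unfolded almost_unit_variances_def]
  show d0: "0 \<le> d j" for j using a by blast
  show sd: "summable d" and "0 < smin" using a by (auto simp: smin_def)
  show sn: "1 \<le> n \<Longrightarrow> k \<le> n \<Longrightarrow> \<bar>s n k - 1\<bar> \<le> d (min k (n - k))" for n k using a by blast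
  have "bdd_below {s n k | n k. 1 \<le> n \<and> k \<le> n}"
    by (rule bdd_belowI[of _ 0]) (use a in \<open>auto simp: less_imp_le\<close>)
  then show "1 \<le> n \<Longrightarrow> k \<le> n \<Longrightarrow> smin \<le> s n k"
    unfolding smin_def by (intro cInf_lower) auto
  have "d j \<le> suminf d" for j using sum_le_suminf[OF sd, of "{j}"] d0 by simp
  from this[of "min k (n - k)"] show "1 \<le> n \<Longrightarrow> k \<le> n \<Longrightarrow> s n k \<le> 1 + suminf d"
    using sn[of n k] by linarith
qed

text \<open>The value of \<open>beta_c\<close> makes the factor \<open>b powr (- y)\<close> at \<open>x = 1\<close>, which cancels the combinatorial
  factor \<open>b\<close> of the convolution power when \<open>y = 1\<close>.\<close>

lemma gauss_factor_eq:
  assumes "2 \<le> b"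
  shows "exp (- (2 * pi\<^sup>2 * x * (y / beta_c b))) = real b powr (- y * x)"
  using assms by (simp add: beta_c_def powr_def)

definition normalized_weight :: "nat \<Rightarrow> real \<Rightarrow> real measure \<Rightarrow> (nat \<Rightarrow> nat \<Rightarrow> real) \<Rightarrow> nat \<Rightarrow> nat \<Rightarrow> int \<Rightarrow> real" where
  "normalized_weight b \<beta> \<nu> s n k q = pot_weight b \<beta> \<nu> (s n) k q / pot_weight b \<beta> \<nu> (s n) k 0"

text \<open>The initial ratio bound combines the bounded ratios of the coefficients of \<open>\<nu>\<close> with the Gaussian
  factor of the first smoothing; the lower bound for the first coefficient uses that the variances
  are bounded from above.\<close>

lemma critical_flow_potentials:
  assumes b: "2 \<le> b" and s: "almost_unit_variances d s" and nu: "positive_fourier_measure \<nu>"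
  shows "\<exists>smin c0 l0. critical_flow b d s smin (normalized_weight b (beta_c b) \<nu> s) c0 l0"
proof -
  define smin where "smin = Inf {s n k | n k. 1 \<le> n \<and> k \<le> n}"
  note sD = almost_unit_variancesD[OF s, folded smin_def]
  have beta: "0 < beta_c b" using b by (simp add: beta_c_def)
  let ?w = "\<lambda>n. pot_weight b (beta_c b) \<nu> (s n)" and ?r = "normalized_weight b (beta_c b) \<nu> s"
  have W: "even_weight (?w n k)" "0 < ?w n k q" if "1 \<le> n" "k \<le> n" for n k q
    using pot_series[OF nu beta, where b = b and k = k and sg = "s n"] b sD(3) sD(4)[of n] that by (force simp: less_le_trans)+
  define fc where "fc q = Re (fourier_coeff \<nu> q)" for q
  have fc: "0 < fc q" for q using positive_fourier_measureD(5)[OF nu] by (simp add: fc_def)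
  have w0: "?w n 0 q = theta_coeff (s n 0 / beta_c b) 0 * (real b powr (- s n 0 * (real_of_int q)\<^sup>2) * fc q)" for n q
    using gauss_factor_eq[OF b, of "(real_of_int q)\<^sup>2" "s n 0"] by (simp add: initial_weight_def theta_coeff_def fc_def)
  have r0: "?r n 0 q = real b powr (- s n 0 * (real_of_int q)\<^sup>2) * fc q / fc 0" if "1 \<le> n" for n q
    using W(2)[OF that le0, of 0] fc[of 0] b unfolding normalized_weight_def w0 by (auto simp: zero_less_mult_iff)
  obtain N where N: "\<And>q. 0 \<le> q \<Longrightarrow> fc (q + 1) / fc q \<le> N"
    using nu unfolding positive_fourier_measure_def bdd_above_def fc_def by blast
  define l0 where "l0 = real b powr (- (1 + suminf d)) * fc 1 / fc 0"
  have "critical_flow b d s smin ?r N l0"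
  proof
    show "even_weight (?r n k)" if "1 \<le> n" "k \<le> n" for n k
    proof -
      have "(\<lambda>q. ?w n k q / ?w n k 0) summable_on UNIV"
        using summable_on_cmult_left[OF even_weightD(3)[OF W(1)[OF that]], of "1 / ?w n k 0"] by simp
      then show ?thesis using even_weightD(1,2)[OF W(1)[OF that]] by (simp add: even_weight_def normalized_weight_def[abs_def])
    qed
    show "0 < ?r n k q" if "1 \<le> n" "k \<le> n" for n k q using W(2)[OF that] by (simp add: normalized_weight_def)
    show "?r n k 0 = 1" if "1 \<le> n" "k \<le> n" for n k using W(2)[OF that, of 0] by (simp add: normalized_weight_def)
    show "?r n (Suc k) q = real b powr (- s n (Suc k) * (real_of_int q)\<^sup>2) * conv_pow (?r n k) b q / conv_pow (?r n k) b 0"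
      if "1 \<le> n" "k < n" for n k q
    proof -
      have "?r n k = (\<lambda>q. (1 / ?w n k 0) * ?w n k q)" by (simp add: normalized_weight_def fun_eq_iff)
      then have c: "conv_pow (?r n k) b = (\<lambda>q. (1 / ?w n k 0) ^ b * conv_pow (?w n k) b q)" by (simp only: conv_pow_scale)
      have "0 < ?w n k 0" using W(2)[of n k 0] that by simp
      then show ?thesis
        unfolding c using gauss_factor_eq[OF b, of "(real_of_int q)\<^sup>2" "s n (Suc k)"] by (simp add: normalized_weight_def)
    qed
    show "?r n 0 (q + 1) \<le> N * (real b powr - smin) ^ (2 * nat q) * ?r n 0 q" if n: "1 \<le> n" and q: "0 \<le> q" for n q
    proof -
      have N0: "0 \<le> N" using N[OF q] fc[of q] fc[of "q + 1"] by (meson divide_nonneg_nonneg less_imp_le order_trans)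
      have "- s n 0 * (real_of_int (q + 1))\<^sup>2 \<le> - smin * (2 * real_of_int q) + - s n 0 * (real_of_int q)\<^sup>2"
      proof -
        have "smin * (2 * real_of_int q) \<le> s n 0 * (2 * real_of_int q + 1)"
          using sD(3) sD(4)[OF n, of 0] q by (intro mult_mono) auto
        then show ?thesis by (simp add: power2_eq_square algebra_simps)
      qed
      then have "real b powr (- s n 0 * (real_of_int (q + 1))\<^sup>2) \<le> real b powr (- smin * (2 * real_of_int q) + - s n 0 * (real_of_int q)\<^sup>2)"
        using b by (intro powr_mono) auto
      also have "\<dots> = (real b powr - smin) ^ (2 * nat q) * real b powr (- s n 0 * (real_of_int q)\<^sup>2)"
        unfolding powr_add using b q by (subst powr_power) (auto simp: mult_ac)
      finally have "real b powr (- s n 0 * (real_of_int (q + 1))\<^sup>2) * fc (q + 1) \<le>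
          (real b powr - smin) ^ (2 * nat q) * real b powr (- s n 0 * (real_of_int q)\<^sup>2) * (N * fc q)"
        using N[OF q] fc[of q] fc[of "q + 1"] by (intro mult_mono) (auto simp: divide_simps)
      then show ?thesis unfolding r0[OF n] using fc[of 0] by (simp add: divide_simps mult_ac)
    qed
    show "l0 \<le> ?r n 0 1" if n: "1 \<le> n" for n
      unfolding r0[OF n] l0_def using sD(6)[OF n, of 0] b fc[of 0] fc[of 1]
      by (intro divide_right_mono mult_right_mono powr_mono) auto
    show "0 < l0" using fc[of 0] fc[of 1] b by (simp add: l0_def)
  qed (use b sD in auto)
  then show ?thesis by blast
qed

theorem theorem3p5:
  fixes b :: nat and \<beta> :: real and d :: "nat \<Rightarrow> real" and s :: "nat \<Rightarrow> nat \<Rightarrow> real"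
    and \<nu> :: "real measure"
    and v :: "nat \<Rightarrow> nat \<Rightarrow> real \<Rightarrow> real" and a :: "nat \<Rightarrow> nat \<Rightarrow> int \<Rightarrow> complex"
  assumes "2 \<le> b" and "\<beta> = beta_c b"
    and "almost_unit_variances d s" and "positive_fourier_measure \<nu>"
  defines "v \<equiv> \<lambda>n k. pot b \<beta> \<nu> (s n) k" and "a \<equiv> \<lambda>n k q. pot_coeff b \<beta> \<nu> (s n) k q"
  shows
    "(\<exists>\<eta>>0. \<exists>C>0.
        (\<forall>n\<ge>1. \<forall>k\<le>n. \<forall>q. a n k q / a n k 0 \<in> \<real> \<and> 0 < Re (a n k q / a n k 0) \<and>
           Re (a n k q / a n k 0)
             \<le> C * exp (- \<eta> * (real_of_int q)\<^sup>2) / (1 + sqrt (real k)) ^ nat \<bar>q\<bar>) \<and>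
        (\<forall>n\<ge>1. \<forall>k\<le>n. smooth (v n k)) \<and>
        (\<forall>n\<ge>1. \<forall>k<n. \<forall>z z'. \<bar>v n (k + 1) z - real b * v n k z'\<bar> \<le> C / sqrt (1 + real k)) \<and>
        (\<forall>n\<ge>1. \<forall>k\<le>n. \<forall>z. max \<bar>deriv (v n k) z\<bar> \<bar>deriv (deriv (v n k)) z\<bar>
           \<le> C / sqrt (1 + real k))) \<and>
     (\<exists>K>0. \<forall>n\<ge>1. \<forall>k\<in>{1..n}.
        cmod (a n k 1 / a n k 0 - of_real (1 / sqrt (real k) * limit_const b))
          \<le> K * error_scale d n k) \<and>
     (\<exists>K>0. \<forall>n\<ge>1. \<forall>k\<in>{1..n}. \<forall>z.
        \<bar>deriv (v n k) z - 4 * pi / sqrt (real k) * limit_const b * sin (2 * pi * z)\<bar>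
          \<le> K * error_scale d n k)"
proof -
  note b = \<open>2 \<le> b\<close> and sv = \<open>almost_unit_variances d s\<close> and nu = \<open>positive_fourier_measure \<nu>\<close>
  define r where "r = normalized_weight b (beta_c b) \<nu> s"
  obtain smin c0 l0 where "critical_flow b d s smin r c0 l0"
    using critical_flow_potentials[OF b sv nu] unfolding r_def by blast
  then interpret critical_flow b d s smin r c0 l0 .
  have beta: "0 < \<beta>" "\<beta> = beta_c b" using b \<open>\<beta> = beta_c b\<close> by (auto simp: beta_c_def)
  let ?w = "\<lambda>n. pot_weight b \<beta> \<nu> (s n)"
  define smax where "smax = 1 + suminf d"
  \<comment> \<open>A common lower bound of the Gaussian densities at \<open>1\<close> for all variances between \<open>smin\<close> and \<open>smax\<close>.\<close>
  define m where "m = 1 / sqrt (2 * pi * (smax / \<beta>)) * exp (- (1 / (2 * (smin / \<beta>))))"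
  have smax: "0 < smax" using suminf_nonneg[OF d_summable] d_nonneg by (simp add: smax_def add_pos_nonneg)
  have m0: "0 < m" using smax beta by (simp add: m_def)
  have sle: "s n k \<le> smax" if "1 \<le> n" "k \<le> n" for n k
    unfolding smax_def by (rule almost_unit_variancesD(6)[OF sv that])
  have spos: "0 < s n k" if "1 \<le> n" "k \<le> n" for n k using smin_le[OF that] smin_pos by simp
  have series: "even_weight (?w n k)" "0 < ?w n k q" "exp (- v n k z) = cos_series (?w n k) z"
    "normal_density 0 (sqrt (s n k / \<beta>)) 1 * ?w n k 0 \<le> cos_series (?w n k) z" if "1 \<le> n" "k \<le> n" for n k q z
    using pot_series[OF nu beta(1), where b = b and k = k and sg = "s n"] b spos[OF that(1)] that(2) unfolding v_def by auto
  have wr: "?w n k q = ?w n k 0 * r n k q" if "1 \<le> n" "k \<le> n" for n k q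
    using series(2)[OF that, of 0] by (simp add: r_def normalized_weight_def beta)
  have fr: "cos_series (?w n k) z = ?w n k 0 * cos_series (r n k) z" if "1 \<le> n" "k \<le> n" for n k z
    unfolding cos_series_def infsum_cmult_right'[symmetric] using wr[OF that] by (intro infsum_cong) (metis mult.assoc)
  have veq: "v n k z = - ln (?w n k 0 * cos_series (r n k) z)" if "1 \<le> n" "k \<le> n" for n k z
    unfolding fr[OF that, symmetric] series(3)[OF that, symmetric] by simp
  have lower: "m \<le> cos_series (r n k) z" if nk: "1 \<le> n" "k \<le> n" for n k z
  proof -
    have "m \<le> normal_density 0 (sqrt (s n k / \<beta>)) 1"
    proof -
      have "1 / sqrt (2 * pi * (smax / \<beta>)) \<le> 1 / sqrt (2 * pi * (s n k / \<beta>))"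
        using sle[OF nk] spos[OF nk] beta(1) smax
        by (intro divide_left_mono real_sqrt_le_mono mult_left_mono divide_right_mono mult_pos_pos) auto
      moreover have "exp (- (1 / (2 * (smin / \<beta>)))) \<le> exp (- (1 / (2 * (s n k / \<beta>))))"
        using smin_le[OF nk] smin_pos beta(1) by (simp add: divide_simps)
      ultimately have "m \<le> 1 / sqrt (2 * pi * (s n k / \<beta>)) * exp (- (1 / (2 * (s n k / \<beta>))))"
        unfolding m_def using spos[OF nk] beta(1) by (intro mult_mono) auto
      then show ?thesis using spos[OF nk] beta(1) by (simp add: normal_density_def)
    qed
    then have "m * ?w n k 0 \<le> normal_density 0 (sqrt (s n k / \<beta>)) 1 * ?w n k 0"
      using series(2)[OF nk, of 0] by (intro mult_right_mono) auto
    also have "\<dots> \<le> ?w n k 0 * cos_series (r n k) z" using series(4)[OF nk, of z] fr[OF nk] by simp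
    finally show ?thesis using series(2)[OF nk, of 0] by simp
  qed
  obtain g where g: "g summable_on UNIV" and g': "\<forall>n\<ge>1. \<forall>k\<le>n.
      (\<forall>q. q \<noteq> 0 \<longrightarrow> (real_of_int q)\<^sup>2 * r n k q \<le> r n k 1 * g q) \<and>
      (\<forall>q. 2 \<le> \<bar>q\<bar> \<longrightarrow> \<bar>real_of_int q\<bar> * r n k q \<le> (r n k 1)\<^sup>2 * g q) \<and>
      (\<forall>j. (\<lambda>q. \<bar>real_of_int q\<bar> ^ j * r n k q) summable_on UNIV)"
    using moment_bounds by (elim exE conjE) (rule that)
  define G where "G = infsum (\<lambda>q. \<bar>g q\<bar>) UNIV"
  have G0: "0 \<le> G" unfolding G_def by (intro infsum_nonneg) auto
  define P where "P = 2 * pi * G / m"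
  have P0: "0 \<le> P" using G0 m0 by (simp add: P_def)
  have est: "smooth (v n k)" "\<bar>deriv (v n k) z\<bar> \<le> P * r n k 1"
      "\<bar>deriv (deriv (v n k)) z\<bar> \<le> 2 * pi * P * r n k 1 + P\<^sup>2 * (r n k 1)\<^sup>2"
      "\<bar>deriv (v n k) z - 4 * pi * r n k 1 * sin (2 * pi * z)\<bar> \<le> 3 * P * (r n k 1)\<^sup>2"
      "v n k differentiable at z" if nk: "1 \<le> n" "k \<le> n" for n k z
  proof -
    have gm: "q \<noteq> 0 \<Longrightarrow> (real_of_int q)\<^sup>2 * r n k q \<le> r n k 1 * g q"
      "2 \<le> \<bar>q\<bar> \<Longrightarrow> \<bar>real_of_int q\<bar> * r n k q \<le> (r n k 1)\<^sup>2 * g q"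
      "(\<lambda>q. \<bar>real_of_int q\<bar> ^ j * r n k q) summable_on UNIV" for q j
      using g'[rule_format, OF nk] by simp_all
    note e = potential_estimates[where r = "r n k" and v = "v n k" and g = g and m = m,
      OF r_even[OF nk] r_0[OF nk] gm(3) g gm(1,2) m0 lower[OF nk] series(2)[OF nk, of 0] veq[OF nk] G_def r_pos[OF nk]]
    show "smooth (v n k)" by (rule e(1))
    show "v n k differentiable at z" by (rule e(5))
    show "\<bar>deriv (v n k) z\<bar> \<le> P * r n k 1" using e(2)[of z] by (simp add: P_def mult_ac)
    show "\<bar>deriv (deriv (v n k)) z\<bar> \<le> 2 * pi * P * r n k 1 + P\<^sup>2 * (r n k 1)\<^sup>2"
      using e(3)[of z] by (simp add: P_def power2_eq_square mult_ac)
    show "\<bar>deriv (v n k) z - 4 * pi * r n k 1 * sin (2 * pi * z)\<bar> \<le> 3 * P * (r n k 1)\<^sup>2"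
      using e(4)[of z] by (simp add: P_def mult_ac)
  qed
  obtain C where C: "1 \<le> C" "\<And>n k. 1 \<le> n \<Longrightarrow> k \<le> n \<Longrightarrow> r n k 1 \<le> C / sqrt (1 + real k)"
    using slope_decay by blast
  have R2: "(r n k 1)\<^sup>2 \<le> C\<^sup>2 / (1 + real k)" if nk: "1 \<le> n" "k \<le> n" for n k
    using power_mono[OF C(2)[OF nk], of 2] r_pos[OF nk, of 1] by (simp add: power_divide)
  obtain \<eta> Cg where eta: "0 < \<eta>" and Cg: "0 < Cg" and decay: "\<And>n k q. 1 \<le> n \<Longrightarrow> k \<le> n \<Longrightarrow>
      r n k q \<le> Cg * exp (- \<eta> * (real_of_int q)\<^sup>2) / (1 + sqrt (real k)) ^ nat \<bar>q\<bar>"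
    using gaussian_decay by blast
  have aeq: "a n k q / a n k 0 = of_real (r n k q)" if nk: "1 \<le> n" "k \<le> n" for n k q
  proof -
    have "a n k q = of_real (?w n k q)" for q
      unfolding a_def using series(1,3)[OF nk] unfolding v_def by (intro pot_coeff_eq)
    then show ?thesis by (simp add: r_def normalized_weight_def beta)
  qed
  define D1 where "D1 = P * C"
  define D2 where "D2 = 2 * pi * P * C + P\<^sup>2 * C\<^sup>2"
  have sq: "1 / (1 + real k) \<le> 1 / sqrt (1 + real k)" for k
  proof -
    have "sqrt (1 + real k) \<le> 1 + real k" by (rule real_le_lsqrt) (auto simp: power2_eq_square)
    then show ?thesis by (intro divide_left_mono) auto
  qed
  have d1: "\<bar>deriv (v n k) z\<bar> \<le> D1 / sqrt (1 + real k)" if nk: "1 \<le> n" "k \<le> n" for n k z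
  proof -
    have "P * r n k 1 \<le> P * (C / sqrt (1 + real k))" using P0 C(2)[OF nk] by (intro mult_left_mono)
    then show ?thesis using est(2)[OF nk, of z] by (simp add: D1_def)
  qed
  have d2: "\<bar>deriv (deriv (v n k)) z\<bar> \<le> D2 / sqrt (1 + real k)" if nk: "1 \<le> n" "k \<le> n" for n k z
  proof -
    have "2 * pi * P * r n k 1 \<le> 2 * pi * P * (C / sqrt (1 + real k))" using P0 C(2)[OF nk] by (intro mult_left_mono) auto
    moreover have "P\<^sup>2 * (r n k 1)\<^sup>2 \<le> P\<^sup>2 * (C\<^sup>2 * (1 / sqrt (1 + real k)))"
      using R2[OF nk] mult_left_mono[OF sq[of k], of "C\<^sup>2"] by (intro mult_left_mono) auto
    ultimately show ?thesis using est(3)[OF nk, of z] by (simp add: D2_def add_divide_distrib)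
  qed
  have step: "\<bar>v n (k + 1) z - real b * v n k z'\<bar> \<le> real b * D1 / sqrt (1 + real k)" if n: "1 \<le> n" and k: "k < n" for n k z z'
  proof -
    have nk: "1 \<le> n" "k \<le> n" using n k by auto
    have "exp (- real b * v n k x) = cos_series (?w n k) x ^ b" for x
      using series(3)[OF nk, of x] exp_of_nat_mult[of b "- v n k x"] by simp
    then have m: "(\<lambda>x. exp (- real b * pot b \<beta> \<nu> (s n) k x)) \<in> borel_measurable borel"
      unfolding v_def
      by (simp only:) (intro borel_measurable_continuous_onI continuous_intros continuous_on_cos_series series(1) nk)
    have osc: "\<bar>v n k x - v n k y\<bar> \<le> D1 / sqrt (1 + real k)" for x y
      by (rule periodic_oscillation_le[OF est(5)[OF nk] d1[OF nk]]) (simp add: veq[OF nk] cos_series_periodic)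
    have "0 < s n (Suc k) / \<beta>" using spos[of n "Suc k"] n k beta(1) by simp
    from pot_Suc_near_multiple[OF this m osc[unfolded v_def]] show ?thesis by (simp add: v_def)
  qed
  define Cf where "Cf = max Cg (max (real b * D1) (max D1 D2))"
  have Cf: "Cg \<le> Cf" "real b * D1 \<le> Cf" "D1 \<le> Cf" "D2 \<le> Cf" "0 < Cf" using Cg by (auto simp: Cf_def)
  have up: "A / sqrt (1 + real k) \<le> Cf / sqrt (1 + real k)" if "A \<le> Cf" for A k
    using that by (intro divide_right_mono) auto
  obtain K where K: "0 < K" and asym: "\<And>n k. 1 \<le> n \<Longrightarrow> k \<in> {1..n} \<Longrightarrow>
      \<bar>r n k 1 - 1 / sqrt (real k) * limit_const b\<bar> \<le> K * error_scale d n k"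
    using slope_asymptotics by blast
  have es: "1 / real k \<le> error_scale d n k" for n k
    using d_nonneg by (auto simp: error_scale_def intro!: divide_nonneg_nonneg infsum_nonneg)
  show ?thesis
  proof (intro conjI)
    show "\<exists>\<eta>>0. \<exists>C>0.
        (\<forall>n\<ge>1. \<forall>k\<le>n. \<forall>q. a n k q / a n k 0 \<in> \<real> \<and> 0 < Re (a n k q / a n k 0) \<and>
           Re (a n k q / a n k 0)
             \<le> C * exp (- \<eta> * (real_of_int q)\<^sup>2) / (1 + sqrt (real k)) ^ nat \<bar>q\<bar>) \<and>
        (\<forall>n\<ge>1. \<forall>k\<le>n. smooth (v n k)) \<and>
        (\<forall>n\<ge>1. \<forall>k<n. \<forall>z z'. \<bar>v n (k + 1) z - real b * v n k z'\<bar> \<le> C / sqrt (1 + real k)) \<and>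
        (\<forall>n\<ge>1. \<forall>k\<le>n. \<forall>z. max \<bar>deriv (v n k) z\<bar> \<bar>deriv (deriv (v n k)) z\<bar>
           \<le> C / sqrt (1 + real k))"
    proof (rule exI[of _ \<eta>], rule conjI[OF eta], rule exI[of _ Cf], intro conjI allI impI Cf(5))
      fix n k :: nat and q :: int assume nk: "1 \<le> n" "k \<le> n"
      show "a n k q / a n k 0 \<in> \<real>" "0 < Re (a n k q / a n k 0)"
        unfolding aeq[OF nk] using r_pos[OF nk] by auto
      have "Cg * exp (- \<eta> * (real_of_int q)\<^sup>2) / (1 + sqrt (real k)) ^ nat \<bar>q\<bar> \<le> Cf * exp (- \<eta> * (real_of_int q)\<^sup>2) / (1 + sqrt (real k)) ^ nat \<bar>q\<bar>"
        by (intro divide_right_mono mult_right_mono Cf) auto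
      then show "Re (a n k q / a n k 0) \<le> Cf * exp (- \<eta> * (real_of_int q)\<^sup>2) / (1 + sqrt (real k)) ^ nat \<bar>q\<bar>"
        unfolding aeq[OF nk] using decay[OF nk, of q] by simp
    next
      fix n k :: nat assume nk: "1 \<le> n" "k \<le> n"
      show "smooth (v n k)" by (rule est(1)[OF nk])
    next
      fix n k :: nat and z z' :: real assume nk: "1 \<le> n" "k < n"
      show "\<bar>v n (k + 1) z - real b * v n k z'\<bar> \<le> Cf / sqrt (1 + real k)"
        using step[OF nk, of z z'] up[OF Cf(2), of k] by linarith
    next
      fix n k :: nat and z :: real assume nk: "1 \<le> n" "k \<le> n"
      show "max \<bar>deriv (v n k) z\<bar> \<bar>deriv (deriv (v n k)) z\<bar> \<le> Cf / sqrt (1 + real k)"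
        using d1[OF nk, of z] d2[OF nk, of z] up[OF Cf(3), of k] up[OF Cf(4), of k] by simp
    qed
    show "\<exists>K>0. \<forall>n\<ge>1. \<forall>k\<in>{1..n}. cmod (a n k 1 / a n k 0 - of_real (1 / sqrt (real k) * limit_const b)) \<le> K * error_scale d n k"
    proof (intro exI[of _ K] conjI K allI impI ballI)
      fix n k :: nat assume n: "1 \<le> n" and k: "k \<in> {1..n}"
      then have "a n k 1 / a n k 0 = of_real (r n k 1)" by (intro aeq) auto
      then show "cmod (a n k 1 / a n k 0 - of_real (1 / sqrt (real k) * limit_const b)) \<le> K * error_scale d n k"
        using asym[OF n k] by (simp only: of_real_diff[symmetric] norm_of_real)
    qed
    show "\<exists>K>0. \<forall>n\<ge>1. \<forall>k\<in>{1..n}. \<forall>z.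
        \<bar>deriv (v n k) z - 4 * pi / sqrt (real k) * limit_const b * sin (2 * pi * z)\<bar> \<le> K * error_scale d n k"
    proof (intro exI[of _ "3 * P * C\<^sup>2 + 4 * pi * K"] conjI allI impI ballI)
      show "0 < 3 * P * C\<^sup>2 + 4 * pi * K" using P0 K by (intro add_nonneg_pos) auto
      fix n k :: nat and z :: real assume n: "1 \<le> n" and k: "k \<in> {1..n}"
      then have nk: "1 \<le> n" "k \<le> n" and k1: "1 \<le> k" by auto
      have "(r n k 1)\<^sup>2 \<le> C\<^sup>2 / (1 + real k)" by (rule R2[OF nk])
      also have "\<dots> \<le> C\<^sup>2 / real k" using k1 by (intro divide_left_mono) auto
      also have "\<dots> \<le> C\<^sup>2 * error_scale d n k" using mult_left_mono[OF es[of k n], of "C\<^sup>2"] by simp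
      finally have "3 * P * (r n k 1)\<^sup>2 \<le> 3 * P * (C\<^sup>2 * error_scale d n k)" using P0 by (intro mult_left_mono) auto
      then have 1: "\<bar>deriv (v n k) z - 4 * pi * r n k 1 * sin (2 * pi * z)\<bar> \<le> 3 * P * C\<^sup>2 * error_scale d n k"
        using est(4)[OF nk, of z] by simp
      have "\<bar>4 * pi * (r n k 1 - 1 / sqrt (real k) * limit_const b) * sin (2 * pi * z)\<bar> \<le>
          4 * pi * \<bar>r n k 1 - 1 / sqrt (real k) * limit_const b\<bar> * 1"
        unfolding abs_mult by (intro mult_mono) auto
      also have "\<dots> \<le> 4 * pi * (K * error_scale d n k) * 1"
        using asym[OF n k] by (intro mult_right_mono mult_left_mono) auto
      finally have 2: "\<bar>4 * pi * (r n k 1 - 1 / sqrt (real k) * limit_const b) * sin (2 * pi * z)\<bar> \<le> 4 * pi * K * error_scale d n k"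
        by simp
      have "deriv (v n k) z - 4 * pi / sqrt (real k) * limit_const b * sin (2 * pi * z) =
        (deriv (v n k) z - 4 * pi * r n k 1 * sin (2 * pi * z)) + 4 * pi * (r n k 1 - 1 / sqrt (real k) * limit_const b) * sin (2 * pi * z)"
        by (simp add: algebra_simps)
      then show "\<bar>deriv (v n k) z - 4 * pi / sqrt (real k) * limit_const b * sin (2 * pi * z)\<bar> \<le> (3 * P * C\<^sup>2 + 4 * pi * K) * error_scale d n k"
        using 1 2 by (simp only: distrib_right)
    qed
  qed
qed

end
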